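(* Let $C\subseteq\mathbb{R}^n$ be the positive orthant and let $B_1,\ldots,B_n\subseteq C$ be lattice polyhedra with each $C\setminus B_i$ bounded. If the tuple $(B_1,\ldots,B_n)$ is minimal with mixed volume $2$, then, after reordering the polyhedra and permuting the coordinates, there is $k\in\{1,\ldots,n\}$ such that $B_1=\cdots=B_k=C_{1,\ldots,1,2,\ldots,2}$ (with $k-1$ entries equal to $1$ followed by $n-k+1$ entries equal to $2$) and $B_{k+1}=\cdots=B_n=C_{1,\ldots,1}$.
   Context: A lattice polyhedron is an intersection of finitely many closed half-spaces all of whose vertices lie in $\mathbb{Z}^n$. Lattice volume is $n!$ times Euclidean volume. For polyhedra $B\subseteq C$ with $C\setminus B$ bounded, put $\mathrm{V}(C,B)=$ lattice volume of $C\setminus B$, and define the relative mixed volume $\mathrm{Vol}_C((C,B_1),\ldots,(C,B_n))=\sum_{I\subseteq\{1,\ldots,n\}}(-1)^{n-|I|}\,\mathrm{V}\big(C,\sum_{i\in I}B_i\big)$ (Minkowski sums; empty sum $=C$); it is the unique symmetric, Minkowski-multilinear function with $\mathrm{Vol}_C((C,B),\ldots,(C,B))=\mathrm{V}(C,B)$. For $a_1,\ldots,a_n>0$, $C_{a_1,\ldots,a_n}=\{x\in C:\sum_i x_i/a_i\ge 1\}$. A tuple $(B_1,\ldots,B_n)$ is minimal with mixed volume $V$ if $\mathrm{Vol}_C((C,B_1),\ldots,(C,B_n))=V$ and, for every $i$ and every point $\delta\in C\setminus B_i$, replacing $B_i$ by $\mathrm{conv}(B_i\cup\{\delta\})$ gives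 mixed volume strictly less than $V$.
   Formalization: The displayed alternating sum of lattice volumes is divided by n!, so that the relative mixed volume of a constant tuple (C,B),…,(C,B) equals V(C,B) as stated; without this factor the claim fails, e.g. for n=2 and B_1=B_2=C_{1,1}. *)

theory Defs
  imports "HOL-Analysis.Analysis" "HOL-Library.Set_Algebras"
begin

definition pos_orthant :: "(real ^ 'n) set" where
  "pos_orthant = {x. \<forall>i. 0 \<le> x $ i}"

definition lattice_polyhedron :: "(real ^ 'n) set \<Rightarrow> bool" where
  "lattice_polyhedron P \<longleftrightarrow>
     polyhedron P \<and> (\<forall>v. v extreme_point_of P \<longrightarrow> (\<forall>i. v $ i \<in> \<int>))"

text \<open>Lattice volume of the complement of \<open>B\<close> in \<open>C\<close>. It is only meaningful when
  this complement is bounded: \<^const>\<open>measure\<close> is 0 on sets of infinite measure.\<close>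

definition rel_volume :: "(real ^ 'n) set \<Rightarrow> (real ^ 'n) set \<Rightarrow> real" where
  "rel_volume C B = fact CARD('n) * measure lebesgue (C - B)"

text \<open>The empty Minkowski sum is \<open>C\<close>, the neutral element among the polyhedra considered,
  whereas \<^const>\<open>sum\<close> over the empty set would give the singleton of the origin.\<close>

definition rel_minkowski_sum ::
    "(real ^ 'n) set \<Rightarrow> ('i \<Rightarrow> (real ^ 'n) set) \<Rightarrow> 'i set \<Rightarrow> (real ^ 'n) set" where
  "rel_minkowski_sum C B I = (if I = {} then C else (\<Sum>i\<in>I. B i))"

text \<open>An \<open>n\<close>-tuple of polyhedra in \<open>n\<close>-dimensional space is indexed by the type \<open>'n\<close> that also
  indexes the coordinates. The alternating sum of lattice volumes is the polarization of an
  \<open>n\<close>-homogeneous function, so its value on a constant tuple \<open>B\<close> is \<open>n!\<close> times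
  \<open>rel_volume C B\<close>; the division by \<open>n!\<close> makes the mixed volume of a constant tuple
  equal to \<open>rel_volume C B\<close>.\<close>

definition rel_mixed_volume ::
    "(real ^ 'n) set \<Rightarrow> ('n \<Rightarrow> (real ^ 'n) set) \<Rightarrow> real" where
  "rel_mixed_volume C B =
     (\<Sum>I\<in>Pow (UNIV :: 'n set).
        (-1) ^ (CARD('n) - card I) * rel_volume C (rel_minkowski_sum C B I)) / fact CARD('n)"

definition minimal_with_mixed_volume ::
    "(real ^ 'n) set \<Rightarrow> ('n \<Rightarrow> (real ^ 'n) set) \<Rightarrow> real \<Rightarrow> bool" where
  "minimal_with_mixed_volume C B V \<longleftrightarrow>
     rel_mixed_volume C B = V \<and>
     (\<forall>i. \<forall>\<delta>\<in>C - B i. rel_mixed_volume C (B(i := convex hull (B i \<union> {\<delta>}))) < V)"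

definition truncated_orthant :: "('n \<Rightarrow> real) \<Rightarrow> (real ^ 'n) set" where
  "truncated_orthant a = {x \<in> pos_orthant. (\<Sum>i\<in>UNIV. x $ i / a i) \<ge> 1}"

end

theory Submission
  imports Defs
begin

text \<open>
  For polytopes \<open>Q\<^sub>i = conv A\<^sub>i\<close>, the gradient of \<open>f = \<Sum>i. ln (\<Sum>a\<in>A\<^sub>i. w\<^sub>i\<^sub>a exp (a \<bullet> x))\<close> maps the whole
  space injectively onto the interior of the Minkowski sum, so the volume of the sum is the integral
  of \<open>det (Hess f)\<close> and the mixed volume is the integral of a nonnegative mixed discriminant, whatever
  the weights are. Letting weights degenerate and applying Fatou's lemma yields monotonicity of mixed
  volumes and, more generally, that the mixed cells of a subdivision contribute at most the mixed
  volume. Truncation to boxes turns the relative mixed volume \<open>M\<close> into a difference of mixed volumes.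

  Let \<open>E\<^sub>i\<close> be the set of \<open>j\<close> with \<open>e\<^sub>j \<in> B\<^sub>i\<close>. If there is a perfect matching \<open>e\<^bsub>\<sigma>(i)\<^esub> \<in> B\<^sub>i\<close>, then
  \<open>M(B) \<le> 1\<close>. Otherwise Hall's theorem gives a set \<open>K\<close> of members and a set \<open>J\<close> of coordinates with
  \<open>|J| = |K| - 1\<close> and \<open>E\<^sub>i \<subseteq> J\<close> for \<open>i \<in> K\<close>. As the \<open>B\<^sub>i\<close> are lattice polyhedra, \<open>B\<^sub>i\<close> lies in
  \<open>\<Gamma> = {x. \<Sum>j\<in>J. x\<^sub>j + \<Sum>j\<notin>J. x\<^sub>j / 2 \<ge> 1}\<close> for \<open>i \<in> K\<close> and in \<open>\<Delta> = {x. \<Sum>j. x\<^sub>j \<ge> 1} \<subseteq> \<Gamma> / 2\<close> for the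
  other \<open>i\<close>. Since \<open>M\<close> of copies of \<open>\<Gamma>\<close> scaled by \<open>c\<^sub>i\<close> is \<open>2 ^ (n - |J|) * (\<Prod>i. c\<^sub>i)\<close>, all tuples below
  these bounds satisfy \<open>M \<ge> 2 ^ (n - |J|) / 2 ^ (n - |K|) = 2\<close>, so minimality forces equality.
\<close>

section \<open>Change of variables over an arbitrary finite index type\<close>

text \<open>A copy of a finite index type that is well-ordered, as the library's change of variables
  formula demands.\<close>

typedef 'n ranked = "{..<CARD('n::finite)}"
  by (rule exI[of _ 0]) auto

instance ranked :: (finite) finite
proof
  show "finite (UNIV :: 'a ranked set)"
    unfolding type_definition.univ[OF type_definition_ranked] by simp
qed

instantiation ranked :: (finite) linorder
begin

definition less_eq_ranked :: "'a ranked \<Rightarrow> 'a ranked \<Rightarrow> bool" where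
  "a \<le> b \<longleftrightarrow> Rep_ranked a \<le> Rep_ranked b"

definition less_ranked :: "'a ranked \<Rightarrow> 'a ranked \<Rightarrow> bool" where
  "a < b \<longleftrightarrow> Rep_ranked a < Rep_ranked b"

instance
  by intro_classes (auto simp: less_eq_ranked_def less_ranked_def Rep_ranked_inject)

end

instance ranked :: (finite) wellorder
proof
  fix P :: "'a ranked \<Rightarrow> bool" and a :: "'a ranked"
  assume step: "\<And>x. (\<And>y. y < x \<Longrightarrow> P y) \<Longrightarrow> P x"
  show "P a"
    by (induction a rule: measure_induct_rule[of Rep_ranked])
       (auto simp: less_ranked_def intro: step)
qed

lemma card_ranked: "CARD('n::finite ranked) = CARD('n)"
  unfolding type_definition.card[OF type_definition_ranked] by simp

definition reindex :: "('m \<Rightarrow> 'n) \<Rightarrow> real ^ 'n::finite \<Rightarrow> real ^ 'm::finite" where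
  "reindex r x = (\<chi> i. x $ r i)"

lemma reindex_component [simp]: "reindex r x $ i = x $ r i"
  by (simp add: reindex_def)

lemma linear_reindex: "linear (reindex r)"
  by (rule linearI) (simp_all add: vec_eq_iff)

lemma reindex_inv [simp]:
  assumes "bij r"
  shows "reindex (inv r) (reindex r x) = x" "reindex r (reindex (inv r) y) = y"
  using assms by (simp_all add: vec_eq_iff bij_is_surj bij_is_inj surj_f_inv_f inv_f_f)

lemma continuous_on_reindex: "continuous_on S (reindex r)"
  by (rule linear_continuous_on) (simp add: linear_reindex linear_conv_bounded_linear[symmetric])

lemma borel_measurable_reindex [measurable]: "reindex r \<in> borel_measurable borel"
  by (intro borel_measurable_continuous_onI continuous_on_reindex)

lemma prod_Basis_cart: "(\<Prod>b\<in>Basis. x \<bullet> b) = (\<Prod>i\<in>UNIV. (x :: real ^ 'n::finite) $ i)"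
proof -
  have "Basis = range (\<lambda>i::'n. axis i (1::real))"
    by (auto simp: Basis_vec_def)
  moreover have "inj (\<lambda>i::'n. axis i (1::real))"
    by (auto simp: inj_on_def axis_eq_axis)
  ultimately show ?thesis
    by (subst \<open>Basis = _\<close>, subst prod.reindex) (simp_all add: inner_axis)
qed

text \<open>Relabelling the coordinates carries boxes to boxes with the same edge lengths, and
  \<open>lborel\<close> is characterised by its values on boxes.\<close>

lemma distr_lborel_reindex:
  fixes r :: "'m::finite \<Rightarrow> 'n::finite"
  assumes r: "bij r"
  shows "distr lborel borel (reindex r) = lborel"
proof (rule lborel_eqI[symmetric])
  fix l u :: "real ^ 'm"
  assume le: "\<And>b. b \<in> Basis \<Longrightarrow> l \<bullet> b \<le> u \<bullet> b"
  let ?s = "reindex (inv r)"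
  have vim: "reindex r -` box l u = box (?s l) (?s u)"
  proof -
    have *: "(\<forall>i. P (r i) i) \<longleftrightarrow> (\<forall>j. P j (inv r j))" for P :: "'n \<Rightarrow> 'm \<Rightarrow> bool"
      using r by (metis bij_inv_eq_iff)
    show ?thesis
      by (simp add: set_eq_iff mem_box_cart *[of "\<lambda>j i. l $ i < _ $ j \<and> _ $ j < u $ i"])
  qed
  have le': "l $ i \<le> u $ i" for i
    using le[of "axis i 1"] by (simp add: inner_axis axis_in_Basis_iff)
  have "b \<in> Basis \<Longrightarrow> ?s l \<bullet> b \<le> ?s u \<bullet> b" for b
    by (auto simp: Basis_vec_def inner_axis le')
  then have "emeasure (distr lborel borel (reindex r)) (box l u) = (\<Prod>b\<in>Basis. (?s u - ?s l) \<bullet> b)"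
    by (subst emeasure_distr) (simp_all add: vim)
  also have "(\<Prod>b\<in>Basis. (?s u - ?s l) \<bullet> b) = (\<Prod>b\<in>Basis. (u - l) \<bullet> b)"
    unfolding prod_Basis_cart
    using prod.reindex_bij_betw[OF bij_imp_bij_inv[OF r], of "\<lambda>i. (u - l) $ i"] by simp
  finally show "emeasure (distr lborel borel (reindex r)) (box l u) = (\<Prod>b\<in>Basis. (u - l) \<bullet> b)" .
qed simp

text \<open>Conjugation by \<open>r\<close> is a sign-preserving bijection between the permutations
  of the two index types, and it matches the Leibniz terms one by one.\<close>

lemma det_reindex:
  fixes A :: "real ^ 'n::finite ^ 'n" and r :: "'m::finite \<Rightarrow> 'n"
  assumes r: "bij r"
  shows "det (\<chi> i j. A $ r i $ r j) = det A"
proof -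
  let ?h = "map_permutation UNIV r"
  have r': "bij_betw r UNIV UNIV" using r by simp
  have h: "?h p (r i) = r (p i)" for p i
    by (rule map_permutation_apply) (use r bij_is_inj in auto)
  have "(\<Sum>q\<in>{q. q permutes UNIV}. of_int (sign q) * (\<Prod>j\<in>UNIV. A $ j $ q j))
      = (\<Sum>p\<in>{p. p permutes UNIV}. of_int (sign (?h p)) * (\<Prod>j\<in>UNIV. A $ j $ ?h p j))"
  proof (rule sum.reindex_bij_witness[where j="map_permutation UNIV (inv r)" and i="?h"])
    fix q :: "'n \<Rightarrow> 'n" assume q: "q \<in> {q. q permutes UNIV}"
    show "map_permutation UNIV (inv r) q \<in> {p. p permutes UNIV}"
      using q map_permutation_permutes[OF bij_imp_bij_inv[OF r]] by blast
    show *: "?h (map_permutation UNIV (inv r) q) = q"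
      by (rule map_permutation_compose_inv) (use q r in \<open>auto simp: bij_imp_bij_inv surj_f_inv_f bij_is_surj\<close>)
    show "of_int (sign (?h (map_permutation UNIV (inv r) q))) *
        (\<Prod>j\<in>UNIV. A $ j $ ?h (map_permutation UNIV (inv r) q) j) = of_int (sign q) * (\<Prod>j\<in>UNIV. A $ j $ q j)"
      by (simp add: *)
  next
    fix p :: "'m \<Rightarrow> 'm" assume p: "p \<in> {p. p permutes UNIV}"
    show "?h p \<in> {q. q permutes UNIV}"
      using p map_permutation_permutes[OF r'] by blast
    show "map_permutation UNIV (inv r) (?h p) = p"
      by (rule map_permutation_compose_inv[OF r']) (use p r in \<open>auto simp: inv_f_f bij_is_inj\<close>)
  qed
  also have "\<dots> = (\<Sum>p\<in>{p. p permutes UNIV}. of_int (sign p) * (\<Prod>i\<in>UNIV. A $ r i $ r (p i)))"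
  proof (rule sum.cong[OF refl])
    fix p :: "'m \<Rightarrow> 'm" assume p: "p \<in> {p. p permutes UNIV}"
    have "sign (?h p) = sign p"
      by (rule sign_map_permutation) (use p r bij_is_inj in auto)
    moreover have "(\<Prod>j\<in>UNIV. A $ j $ ?h p j) = (\<Prod>i\<in>UNIV. A $ r i $ ?h p (r i))"
      by (rule prod.reindex_bij_betw[OF r', symmetric])
    ultimately show "of_int (sign (?h p)) * (\<Prod>j\<in>UNIV. A $ j $ ?h p j)
        = of_int (sign p) * (\<Prod>i\<in>UNIV. A $ r i $ r (p i))"
      by (simp add: h)
  qed
  finally show ?thesis
    by (simp add: det_def)
qed

text \<open>The change of variables formula is applied to the copy \<open>F\<close> of
  \<open>f\<close> over \<open>'n ranked\<close>. Measures and determinants do not depend on the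
  labelling, so the result carries back.\<close>

proposition integral_det_derivative:
  fixes f :: "real ^ 'n::finite \<Rightarrow> real ^ 'n"
  assumes der: "\<And>x. (f has_derivative (\<lambda>h. A x *v h)) (at x)"
    and inj: "inj f"
    and bd: "bounded (range f)"
    and cont: "continuous_on UNIV (\<lambda>x. det (A x))"
    and nonneg: "\<And>x. 0 \<le> det (A x)"
  shows "range f \<in> sets borel" "integrable lborel (\<lambda>x. det (A x))"
    "integral\<^sup>L lborel (\<lambda>x. det (A x)) = measure lborel (range f)"
proof -
  obtain r :: "'n ranked \<Rightarrow> 'n" where r: "bij r"
    using finite_same_card_bij[of "UNIV :: 'n ranked set" "UNIV :: 'n set"] card_ranked[where 'n='n]
    by (metis finite_class.finite_UNIV)
  let ?t = "reindex r" and ?s = "reindex (inv r)"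
  have contf: "continuous_on UNIV f"
    by (rule has_derivative_continuous_on[where f'="\<lambda>x h. A x *v h"]) (simp add: der)
  \<comment> \<open>A continuous image of the whole space is a countable union of images of compact
    balls.\<close>
  have borel_range: "range g \<in> sets borel" if "continuous_on UNIV g" for g :: "'c::euclidean_space \<Rightarrow> 'd::euclidean_space"
  proof -
    have "(\<Union>n. cball (0 :: 'c) (real n)) = UNIV"
      using real_arch_simple by auto
    then have "range g = (\<Union>n. g ` cball 0 (real n))"
      unfolding image_UN[symmetric] by simp
    moreover have "g ` cball 0 (real n) \<in> sets borel" for n
      by (intro borel_compact compact_continuous_image continuous_on_subset[OF that]) auto
    ultimately show ?thesis by auto
  qed
  show rf: "range f \<in> sets borel" by (rule borel_range[OF contf])
  define F where "F = (\<lambda>y. ?t (f (?s y)))"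
  define A' where "A' = (\<lambda>y. (\<chi> i j. A (?s y) $ r i $ r j))"
  have A': "?t (A (?s y) *v ?s h) = A' y *v h" for y h
    using sum.reindex_bij_betw[OF r, of "\<lambda>j. A (?s y) $ _ $ j * h $ inv r j"]
    by (simp add: vec_eq_iff A'_def matrix_vector_mult_def inv_f_f bij_is_inj[OF r])
  have derF: "(F has_derivative (\<lambda>h. A' y *v h)) (at y)" for y
  proof -
    have 1: "(?s has_derivative ?s) (at y)"
      by (rule linear_imp_has_derivative[OF linear_reindex])
    have 2: "(?t has_derivative ?t) (at (f (?s y)))"
      by (rule linear_imp_has_derivative[OF linear_reindex])
    from has_derivative_compose[OF has_derivative_compose[OF 1 der] 2]
    show ?thesis by (simp add: F_def A')
  qed
  have rangeF: "range F = ?t ` range f"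
  proof -
    have "range ?s = UNIV"
      using reindex_inv(1)[OF r] by (metis surjI)
    then show ?thesis unfolding F_def by (metis image_comp comp_def image_image)
  qed
  have injF: "inj F"
    unfolding F_def
  proof (rule injI)
    fix y z assume "?t (f (?s y)) = ?t (f (?s z))"
    then have "f (?s y) = f (?s z)" by (metis reindex_inv(1)[OF r])
    then have "?s y = ?s z" using inj by (simp add: inj_eq)
    then show "y = z" by (metis reindex_inv(2)[OF r])
  qed
  have contF: "continuous_on UNIV F"
    by (rule has_derivative_continuous_on[where f'="\<lambda>x h. A' x *v h"]) (simp add: derF)
  have vim: "?t -` range F = range f"
    unfolding rangeF using reindex_inv(1)[OF r] by (auto simp: image_iff) metis
  have rF: "range F \<in> sets borel" by (rule borel_range[OF contF])
  have mF: "measure lborel (range F) = measure lborel (range f)"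
    by (subst distr_lborel_reindex[OF r, symmetric], subst measure_distr) (auto simp: vim rF)
  have bF: "bounded (range F)"
    unfolding rangeF by (intro bounded_linear_image bd) (use linear_reindex linear_conv_bounded_linear in blast)
  have lmF: "range F \<in> lmeasurable"
    using bF rF by (simp add: bounded_set_imp_lmeasurable)
  have detA': "det (A' y) = det (A (?s y))" for y
    unfolding A'_def by (rule det_reindex[OF r])
  have "((\<lambda>y. \<bar>det (matrix (\<lambda>h. A' y *v h))\<bar>) has_integral measure lebesgue (range F)) UNIV"
    using has_measure_differentiable_image[of UNIV F "\<lambda>y h. A' y *v h" "measure lebesgue (range F)"]
      derF injF lmF by auto
  then have hi: "((\<lambda>y. det (A (?s y))) has_integral measure lborel (range F)) UNIV"
    using rF by (simp add: matrix_of_matrix_vector_mul detA' nonneg)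
  have meas: "(\<lambda>x. det (A x)) \<in> borel_measurable borel"
    by (intro borel_measurable_continuous_onI cont)
  then have meas': "(\<lambda>y. det (A (?s y))) \<in> borel_measurable borel"
    by measurable
  \<comment> \<open>Nonnegativity makes the gauge integral a Lebesgue integral; it has also removed
    the absolute value of the Jacobian.\<close>
  have "has_bochner_integral lborel (\<lambda>y. det (A (?s y))) (measure lborel (range F))"
    by (rule has_bochner_integral_nn_integral)
       (use meas' nonneg nn_integral_has_integral_lborel[OF meas' _ hi] in auto)
  then have "integrable lborel (\<lambda>y. det (A (?s y)))"
      and "integral\<^sup>L lborel (\<lambda>y. det (A (?s y))) = measure lborel (range F)"
    by (auto simp: has_bochner_integral_iff)
  then have "integrable (distr lborel borel ?t) (\<lambda>y. det (A (?s y)))"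
      and "integral\<^sup>L (distr lborel borel ?t) (\<lambda>y. det (A (?s y))) = measure lborel (range F)"
    unfolding distr_lborel_reindex[OF r] by auto
  then show "integrable lborel (\<lambda>x. det (A x))" "integral\<^sup>L lborel (\<lambda>x. det (A x)) = measure lborel (range f)"
    using meas' by (simp_all add: integrable_distr_eq integral_distr reindex_inv[OF r] mF)
qed

section \<open>Alternating sums and mixed discriminants\<close>

text \<open>This is polarization: if \<open>\<phi> I\<close> is the value of a homogeneous
  polynomial of degree \<open>CARD('n)\<close> at the indicator vector of \<open>I\<close>, the
  result is the coefficient of the monomial that uses every index exactly once.\<close>

definition alt_sum :: "('n::finite set \<Rightarrow> real) \<Rightarrow> real" where
  "alt_sum \<phi> = (\<Sum>I\<in>Pow UNIV. (-1) ^ (CARD('n) - card I) * \<phi> I)"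

lemma alt_sum_diff: "alt_sum (\<lambda>I. \<phi> I - \<psi> I) = alt_sum \<phi> - alt_sum \<psi>"
  by (simp add: alt_sum_def sum_subtractf right_diff_distrib)

lemma alt_sum_cmult: "alt_sum (\<lambda>I. c * \<phi> I) = c * alt_sum \<phi>"
  unfolding alt_sum_def sum_distrib_left by (rule sum.cong) auto

lemma alt_sum_sum: "alt_sum (\<lambda>I. \<Sum>k\<in>K. \<phi> k I) = (\<Sum>k\<in>K. alt_sum (\<phi> k))"
  unfolding alt_sum_def sum_distrib_left by (rule sum.swap)

text \<open>The sets without \<open>i\<close> are paired with the sets containing \<open>i\<close>;
  the two members of a pair carry opposite signs.\<close>

lemma alt_sum_cancel:
  fixes \<phi> :: "'n::finite set \<Rightarrow> real"
  assumes "\<And>I. i \<notin> I \<Longrightarrow> \<phi> (insert i I) = \<phi> I"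
  shows "alt_sum \<phi> = 0"
proof -
  let ?f = "\<lambda>I. (-1) ^ (CARD('n) - card I) * \<phi> I"
  let ?X = "{I. i \<notin> I}"
  have dec: "Pow (UNIV :: 'n set) = ?X \<union> insert i ` ?X"
  proof -
    have "I \<in> ?X \<union> insert i ` ?X" for I
    proof (cases "i \<in> I")
      case True
      then have "I = insert i (I - {i})" by auto
      then show ?thesis by blast
    qed auto
    then show ?thesis by auto
  qed
  have inj: "inj_on (insert i) ?X"
    by (auto simp: inj_on_def)
  have "alt_sum \<phi> = sum ?f ?X + sum ?f (insert i ` ?X)"
    unfolding alt_sum_def dec by (rule sum.union_disjoint) auto
  also have "sum ?f (insert i ` ?X) = (\<Sum>I\<in>?X. ?f (insert i I))"
    by (subst sum.reindex[OF inj]) simp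
  also have "\<dots> = (\<Sum>I\<in>?X. - ?f I)"
  proof (rule sum.cong[OF refl])
    fix I assume I: "I \<in> ?X"
    \<comment> \<open>The upper bound on the cardinality is needed because the exponent of the sign
      is a truncated difference.\<close>
    then have "card (insert i I) \<le> CARD('n)" "card (insert i I) = Suc (card I)"
      using card_mono[of UNIV "insert i I"] by auto
    then have "CARD('n) - card I = Suc (CARD('n) - card (insert i I))"
      by auto
    then show "?f (insert i I) = - ?f I"
      using assms I by auto
  qed
  finally show ?thesis by (simp add: sum_negf)
qed

lemma alt_sum_superset: "alt_sum (\<lambda>I. if R \<subseteq> I then 1 else 0) = (if R = UNIV then 1 else 0)"
proof (cases "R = UNIV")
  case True
  have "alt_sum (\<lambda>I. if R \<subseteq> I then 1 else 0) = (\<Sum>I\<in>{UNIV :: 'a set}. 1)"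
    unfolding alt_sum_def by (rule sum.mono_neutral_cong_right) (auto simp: True)
  then show ?thesis using True by simp
next
  case False
  then obtain i where "i \<notin> R" by auto
  then show ?thesis
    using False by (subst alt_sum_cancel[of i]) auto
qed

text \<open>A selection \<open>f\<close> counts for exactly the sets that contain the range of
  \<open>\<tau> f\<close>. By \<open>alt_sum_superset\<close> only surjective
  \<open>\<tau> f\<close> survive, and these are bijective because the type is finite.\<close>

lemma alt_sum_selections:
  fixes \<tau> :: "'b \<Rightarrow> 'n::finite \<Rightarrow> 'n" and g :: "'b \<Rightarrow> real"
  assumes "finite F"
  shows "alt_sum (\<lambda>I. \<Sum>f\<in>{f \<in> F. range (\<tau> f) \<subseteq> I}. g f) = (\<Sum>f\<in>{f \<in> F. bij (\<tau> f)}. g f)"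
proof -
  have "alt_sum (\<lambda>I. \<Sum>f\<in>{f \<in> F. range (\<tau> f) \<subseteq> I}. g f)
      = alt_sum (\<lambda>I. \<Sum>f\<in>F. g f * (if range (\<tau> f) \<subseteq> I then 1 else 0))"
    by (simp add: sum.If_cases[OF assms] if_distrib Int_def cong: if_cong)
  also have "\<dots> = (\<Sum>f\<in>F. g f * (if range (\<tau> f) = UNIV then 1 else 0))"
    by (simp add: alt_sum_sum alt_sum_cmult alt_sum_superset)
  also have "\<dots> = (\<Sum>f\<in>F. g f * (if bij (\<tau> f) then 1 else 0))"
    by (rule sum.cong) (auto simp: bij_def finite_UNIV_surj_inj)
  also have "\<dots> = (\<Sum>f\<in>{f \<in> F. bij (\<tau> f)}. g f)"
    by (simp add: sum.If_cases[OF assms] if_distrib Int_def cong: if_cong)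
  finally show ?thesis .
qed

section \<open>Permanents, determinants of sums and mixed discriminants\<close>

lemma prod_sum_choices:
  fixes a :: "'b \<Rightarrow> 'n::finite \<Rightarrow> 'c::comm_semiring_1"
  assumes "finite K"
  shows "(\<Prod>j\<in>UNIV. \<Sum>i\<in>K. a i j) = (\<Sum>f\<in>{f. \<forall>j. f j \<in> K}. \<Prod>j\<in>UNIV. a (f j) j)"
  using prod_sum_PiE[of UNIV "\<lambda>_. K" "\<lambda>j i. a i j"] assms
  by (simp add: PiE_UNIV_domain Pi_def)

text \<open>The right-hand side is the permanent of \<open>a\<close>. It evaluates the mixed volumes
  of boxes and of slabs.\<close>

lemma alt_sum_prod_sum:
  fixes a :: "'n::finite \<Rightarrow> 'n \<Rightarrow> real"
  shows "alt_sum (\<lambda>I. \<Prod>j\<in>UNIV. \<Sum>i\<in>I. a i j) = (\<Sum>p\<in>{p. bij p}. \<Prod>j\<in>UNIV. a (p j) j)"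
proof -
  have "alt_sum (\<lambda>I. \<Prod>j\<in>UNIV. \<Sum>i\<in>I. a i j)
      = alt_sum (\<lambda>I. \<Sum>p\<in>{p \<in> UNIV. range p \<subseteq> I}. \<Prod>j\<in>UNIV. a (p j) j)"
    by (simp add: prod_sum_choices image_subset_iff)
  then show ?thesis
    using alt_sum_selections[where F=UNIV and \<tau>="\<lambda>p. p :: 'n \<Rightarrow> 'n" and g="\<lambda>p. \<Prod>j\<in>UNIV. a (p j) j"]
    by simp
qed

lemma finite_choices:
  assumes "finite K"
  shows "finite {f :: 'n::finite \<Rightarrow> 'b. \<forall>j. f j \<in> K}"
  using finite_PiE[of "UNIV :: 'n set" "\<lambda>_. K"] assms by (simp add: PiE_UNIV_domain Pi_def)

lemma card_permutes_UNIV: "card {p :: 'n::finite \<Rightarrow> 'n. p permutes UNIV} = fact CARD('n)"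
  by (rule card_permutations) auto

lemma det_rows_sum_choices:
  fixes a :: "'n::finite \<Rightarrow> 'b \<Rightarrow> 'c::comm_ring_1 ^ 'n"
  assumes "finite K"
  shows "det (\<chi> i. \<Sum>k\<in>K. a i k) = (\<Sum>f\<in>{f. \<forall>i. f i \<in> K}. det (\<chi> i. a i (f i)))"
proof -
  have "det (\<chi> i. \<Sum>k\<in>K. a i k) = (\<Sum>p\<in>{p. p permutes UNIV}. of_int (sign p) *
      (\<Sum>f\<in>{f. \<forall>i. f i \<in> K}. \<Prod>i\<in>UNIV. a i (f i) $ p i))" (is "_ = ?r p")
    unfolding det_def
    by (rule sum.cong[OF refl])
       (simp add: sum_component prod_sum_choices[OF assms, of "\<lambda>k i. a i k $ _ i"])
  also have "?r p = (\<Sum>f\<in>{f. \<forall>i. f i \<in> K}. det (\<chi> i. a i (f i)))"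
    unfolding det_def sum_distrib_left by (subst sum.swap) simp
  finally show ?thesis .
qed

text \<open>This is the Cauchy-Binet formula for a weighted sum of rank-one matrices. The sum runs
  over ordered selections, in which each unordered one is met in every order; hence the division by
  \<open>n!\<close>.\<close>

lemma det_sum_outer:
  fixes v :: "'b \<Rightarrow> real ^ 'n::finite" and c :: "'b \<Rightarrow> real"
  assumes "finite K"
  shows "det (\<chi> a b. \<Sum>k\<in>K. c k * v k $ a * v k $ b)
    = (\<Sum>f\<in>{f. \<forall>j. f j \<in> K}. (\<Prod>j\<in>UNIV. c (f j)) * (det (\<chi> j. v (f j)))\<^sup>2) / fact CARD('n)"
proof -
  let ?F = "{f :: 'n \<Rightarrow> 'b. \<forall>j. f j \<in> K}"
  let ?P = "{p :: 'n \<Rightarrow> 'n. p permutes UNIV}"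
  let ?D = "\<lambda>f. det (\<chi> j. v (f j))"
  let ?g = "\<lambda>f. (\<Prod>j\<in>UNIV. c (f j)) * (\<Prod>j\<in>UNIV. v (f j) $ j) * ?D f"
  have "(\<chi> a b. \<Sum>k\<in>K. c k * v k $ a * v k $ b) = (\<chi> a. \<Sum>k\<in>K. (c k * v k $ a) *s v k)"
    by (simp add: vec_eq_iff sum_component)
  then have det: "det (\<chi> a b. \<Sum>k\<in>K. c k * v k $ a * v k $ b) = sum ?g ?F"
    by (simp add: det_rows_sum_choices[OF assms] det_rows_mul prod.distrib)
  \<comment> \<open>Renaming the selection by \<open>p\<close> does not change the total. Summing
    these equal expressions over all \<open>p\<close> turns the product of single entries into a
    second determinant.\<close>
  have "sum ?g ?F = (\<Sum>f\<in>?F. (\<Prod>j\<in>UNIV. c (f j)) * (of_int (sign p) * (\<Prod>j\<in>UNIV. v (f j) $ (p j))) * ?D f)"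
    if p: "p \<in> ?P" for p
  proof -
    have bp: "bij p" using p by (simp add: permutes_bij)
    have "sum ?g ?F = (\<Sum>f\<in>?F. ?g (\<lambda>j. f (inv p j)))"
      by (rule sum.reindex_bij_witness[where i="\<lambda>f j. f (inv p j)" and j="\<lambda>f j. f (p j)"])
         (auto simp: bij_is_inj[OF bp] surj_f_inv_f[OF bij_is_surj[OF bp]] inv_f_f)
    also have "\<dots> = (\<Sum>f\<in>?F. (\<Prod>j\<in>UNIV. c (f j)) * (of_int (sign p) * (\<Prod>j\<in>UNIV. v (f j) $ (p j))) * ?D f)"
    proof (rule sum.cong[OF refl])
      fix f
      have 1: "(\<Prod>j\<in>UNIV. c (f (inv p j))) = (\<Prod>j\<in>UNIV. c (f j))"
        using prod.reindex_bij_betw[OF bij_imp_bij_inv[OF bp], of "\<lambda>j. c (f j)"] by simp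
      have 2: "(\<Prod>j\<in>UNIV. v (f (inv p j)) $ j) = (\<Prod>j\<in>UNIV. v (f j) $ (p j))"
        using prod.reindex_bij_betw[OF bp, of "\<lambda>j. v (f (inv p j)) $ j"]
        by (simp add: inv_f_f bij_is_inj[OF bp])
      have pi: "inv p permutes UNIV" using p by (simp add: permutes_inv)
      have "?D (\<lambda>j. f (inv p j)) = of_int (sign (inv p)) * ?D f"
        using det_permute_rows[OF pi, of "\<chi> j. v (f j)"] by simp
      moreover have "sign (inv p) = sign p"
        using p by (metis finite_class.finite_UNIV mem_Collect_eq permutation_permutes sign_inverse)
      ultimately show "?g (\<lambda>j. f (inv p j)) = (\<Prod>j\<in>UNIV. c (f j)) * (of_int (sign p) * (\<Prod>j\<in>UNIV. v (f j) $ (p j))) * ?D f"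
        by (simp add: 1 2)
    qed
    finally show ?thesis .
  qed
  then have "(\<Sum>p\<in>?P. sum ?g ?F)
     = (\<Sum>p\<in>?P. \<Sum>f\<in>?F. (\<Prod>j\<in>UNIV. c (f j)) * (of_int (sign p) * (\<Prod>j\<in>UNIV. v (f j) $ (p j))) * ?D f)"
    by (rule sum.cong[OF refl])
  also have "\<dots> = (\<Sum>f\<in>?F. (\<Prod>j\<in>UNIV. c (f j)) * (\<Sum>p\<in>?P. of_int (sign p) * (\<Prod>j\<in>UNIV. v (f j) $ (p j))) * ?D f)"
    by (subst sum.swap) (simp add: sum_distrib_left sum_distrib_right)
  also have "\<dots> = (\<Sum>f\<in>?F. (\<Prod>j\<in>UNIV. c (f j)) * (?D f)\<^sup>2)"
    by (simp add: det_def power2_eq_square mult.assoc)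
  finally have "fact CARD('n) * sum ?g ?F = (\<Sum>f\<in>?F. (\<Prod>j\<in>UNIV. c (f j)) * (?D f)\<^sup>2)"
    by (simp add: card_permutes_UNIV)
  then show ?thesis
    unfolding det by (simp add: field_simps)
qed

lemma det_sum_outer_nonneg:
  fixes v :: "'b \<Rightarrow> real ^ 'n::finite"
  assumes "finite K" "\<And>k. k \<in> K \<Longrightarrow> 0 \<le> c k"
  shows "0 \<le> det (\<chi> a b. \<Sum>k\<in>K. c k * v k $ a * v k $ b)"
  unfolding det_sum_outer[OF assms(1)]
  by (intro divide_nonneg_pos sum_nonneg mult_nonneg_nonneg prod_nonneg) (auto intro: assms)

text \<open>Expand over selections of pairs \<open>(i, s)\<close>. Polarization keeps those that use
  every \<open>i\<close> once, and each of them contributes a product of weights times a squared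
  determinant.\<close>

lemma mixed_discriminant_nonneg:
  fixes v :: "'n \<Rightarrow> 's \<Rightarrow> real ^ 'n::finite"
  assumes "finite \<Omega>" "\<And>i s. s \<in> \<Omega> \<Longrightarrow> 0 \<le> c i s"
  shows "0 \<le> alt_sum (\<lambda>I. det (\<Sum>i\<in>I. \<chi> a b. \<Sum>s\<in>\<Omega>. c i s * v i s $ a * v i s $ b))"
proof -
  let ?F = "{f :: 'n \<Rightarrow> 'n \<times> 's. \<forall>j. f j \<in> UNIV \<times> \<Omega>}"
  let ?g = "\<lambda>f. (\<Prod>j\<in>UNIV. case_prod c (f j)) * (det (\<chi> j. case_prod v (f j)))\<^sup>2 / fact CARD('n)"
  have F: "finite ?F" by (rule finite_choices) (simp add: assms)
  have "det (\<Sum>i\<in>I. \<chi> a b. \<Sum>s\<in>\<Omega>. c i s * v i s $ a * v i s $ b)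
      = (\<Sum>f\<in>{f \<in> ?F. range (\<lambda>j. fst (f j)) \<subseteq> I}. ?g f)" for I
  proof -
    have "(\<Sum>i\<in>I. \<chi> a b. \<Sum>s\<in>\<Omega>. c i s * v i s $ a * v i s $ b)
        = (\<chi> a b. \<Sum>k\<in>I \<times> \<Omega>. case_prod c k * case_prod v k $ a * case_prod v k $ b)"
      by (simp add: vec_eq_iff sum_component sum.cartesian_product case_prod_beta)
    moreover have "{f. \<forall>j. f j \<in> I \<times> \<Omega>} = {f \<in> ?F. range (\<lambda>j. fst (f j)) \<subseteq> I}"
      by (auto simp: mem_Times_iff)
    ultimately show ?thesis
      using assms by (simp add: det_sum_outer sum_divide_distrib)
  qed
  then have "alt_sum (\<lambda>I. det (\<Sum>i\<in>I. \<chi> a b. \<Sum>s\<in>\<Omega>. c i s * v i s $ a * v i s $ b))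
      = (\<Sum>f\<in>{f \<in> ?F. bij (\<lambda>j. fst (f j))}. ?g f)"
    using alt_sum_selections[OF F, where \<tau>="\<lambda>f j. fst (f j)" and g="?g"] by simp
  also have "\<dots> \<ge> 0"
    by (intro sum_nonneg divide_nonneg_pos mult_nonneg_nonneg prod_nonneg)
       (auto simp: case_prod_beta mem_Times_iff intro: assms)
  finally show ?thesis .
qed

section \<open>Covariance matrices of exponentially tilted weights\<close>

text \<open>For \<open>v = tilt pt w x\<close> this is the gradient at \<open>x\<close> of the
  logarithm of \<open>sum (tilt pt w x) \<Omega>\<close>.\<close>

definition wmean :: "'s set \<Rightarrow> ('s \<Rightarrow> real ^ 'n::finite) \<Rightarrow> ('s \<Rightarrow> real) \<Rightarrow> real ^ 'n" where
  "wmean \<Omega> pt v = (\<Sum>s\<in>\<Omega>. (v s / sum v \<Omega>) *\<^sub>R pt s)"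

text \<open>The covariance matrix of the points under the normalised weights. For
  \<open>v = tilt pt w x\<close> it is the Hessian of the same logarithm.\<close>

definition wcov :: "'s set \<Rightarrow> ('s \<Rightarrow> real ^ 'n::finite) \<Rightarrow> ('s \<Rightarrow> real) \<Rightarrow> real ^ 'n ^ 'n" where
  "wcov \<Omega> pt v = (\<chi> a b. \<Sum>s\<in>\<Omega>. v s / sum v \<Omega> * (pt s - wmean \<Omega> pt v) $ a * (pt s - wmean \<Omega> pt v) $ b)"

definition tilt :: "('s \<Rightarrow> real ^ 'n::finite) \<Rightarrow> ('s \<Rightarrow> real) \<Rightarrow> real ^ 'n \<Rightarrow> 's \<Rightarrow> real" where
  "tilt pt w x s = w s * exp (pt s \<bullet> x)"

definition weights_on :: "'s set \<Rightarrow> ('s \<Rightarrow> real) \<Rightarrow> bool" where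
  "weights_on \<Omega> w \<longleftrightarrow> finite \<Omega> \<and> (\<forall>s\<in>\<Omega>. 0 \<le> w s) \<and> (\<exists>s\<in>\<Omega>. 0 < w s)"

abbreviation wsupp :: "'s set \<Rightarrow> ('s \<Rightarrow> real) \<Rightarrow> 's set" where
  "wsupp \<Omega> w \<equiv> {s \<in> \<Omega>. 0 < w s}"

lemma weights_on_sum_pos: "weights_on \<Omega> w \<Longrightarrow> 0 < sum w \<Omega>"
  unfolding weights_on_def by (auto intro!: sum_pos2)

lemma weights_on_tilt: "weights_on \<Omega> w \<Longrightarrow> weights_on \<Omega> (tilt pt w x)"
  by (auto simp: weights_on_def tilt_def intro!: bexI)

text \<open>This invariance allows a degenerating family of weights to be renormalised before
  passing to the limit.\<close>

lemma wcov_scale: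
  assumes "c \<noteq> 0"
  shows "wcov \<Omega> pt (\<lambda>s. c * v s) = wcov \<Omega> pt v"
  using assms by (simp add: wcov_def wmean_def sum_distrib_left[symmetric])

lemma wcov_mult_vec:
  "wcov \<Omega> pt v *v h = (\<Sum>s\<in>\<Omega>. (v s / sum v \<Omega> * ((pt s - wmean \<Omega> pt v) \<bullet> h)) *\<^sub>R (pt s - wmean \<Omega> pt v))"
proof (rule vec_eq_iff[THEN iffD2], rule allI)
  fix a
  let ?q = "\<lambda>s. v s / sum v \<Omega>" and ?d = "\<lambda>s. pt s - wmean \<Omega> pt v"
  have "(wcov \<Omega> pt v *v h) $ a = (\<Sum>b\<in>UNIV. \<Sum>s\<in>\<Omega>. ?q s * ?d s $ a * ?d s $ b * h $ b)"
    by (simp only: matrix_vector_mult_def wcov_def vec_lambda_beta sum_distrib_right)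
  also have "\<dots> = (\<Sum>s\<in>\<Omega>. \<Sum>b\<in>UNIV. ?q s * ?d s $ a * ?d s $ b * h $ b)"
    by (rule sum.swap)
  also have "\<dots> = (\<Sum>s\<in>\<Omega>. ((?q s * (?d s \<bullet> h)) *\<^sub>R ?d s) $ a)"
    by (rule sum.cong[OF refl]) (simp add: inner_vec_def sum_distrib_left sum_distrib_right mult_ac)
  finally show "(wcov \<Omega> pt v *v h) $ a = (\<Sum>s\<in>\<Omega>. (?q s * (?d s \<bullet> h)) *\<^sub>R ?d s) $ a"
    by (simp only: sum_component)
qed

lemma wmean_inner:
  "wmean \<Omega> pt v \<bullet> h = (\<Sum>s\<in>\<Omega>. v s / sum v \<Omega> * (pt s \<bullet> h))"
  by (simp add: wmean_def inner_sum_left)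

text \<open>Second moment minus the product of the means: the form in which the quotient rule
  produces the derivative of \<open>wmean\<close>.\<close>

lemma wcov_mult_vec_expand:
  assumes "sum v \<Omega> \<noteq> 0"
  shows "wcov \<Omega> pt v *v h =
    (\<Sum>s\<in>\<Omega>. (v s / sum v \<Omega> * (pt s \<bullet> h)) *\<^sub>R pt s) - (wmean \<Omega> pt v \<bullet> h) *\<^sub>R wmean \<Omega> pt v"
proof -
  let ?m = "wmean \<Omega> pt v" and ?q = "\<lambda>s. v s / sum v \<Omega>"
  have q: "sum ?q \<Omega> = 1"
    using assms by (simp add: sum_divide_distrib[symmetric])
  have 1: "(\<Sum>s\<in>\<Omega>. (?q s * (pt s \<bullet> h)) *\<^sub>R ?m) = (?m \<bullet> h) *\<^sub>R ?m"
    by (simp add: wmean_inner[of \<Omega> pt v h] scaleR_sum_left)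
  have 2: "(\<Sum>s\<in>\<Omega>. (?q s * (?m \<bullet> h)) *\<^sub>R pt s) = (?m \<bullet> h) *\<^sub>R ?m"
    unfolding wmean_def[of \<Omega> pt v] scaleR_sum_right by (simp add: mult.commute wmean_def)
  have 3: "(\<Sum>s\<in>\<Omega>. (?q s * (?m \<bullet> h)) *\<^sub>R ?m) = (?m \<bullet> h) *\<^sub>R ?m"
    using q by (simp only: scaleR_sum_left[symmetric] sum_distrib_right[symmetric] mult_1)
  have "wcov \<Omega> pt v *v h = (\<Sum>s\<in>\<Omega>. (?q s * (pt s \<bullet> h)) *\<^sub>R pt s - (?q s * (pt s \<bullet> h)) *\<^sub>R ?m
      - ((?q s * (?m \<bullet> h)) *\<^sub>R pt s - (?q s * (?m \<bullet> h)) *\<^sub>R ?m))"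
    unfolding wcov_mult_vec
    by (rule sum.cong) (simp_all add: inner_diff_left algebra_simps)
  also have "\<dots> = (\<Sum>s\<in>\<Omega>. (?q s * (pt s \<bullet> h)) *\<^sub>R pt s) - (?m \<bullet> h) *\<^sub>R ?m"
    by (simp only: sum_subtractf 1 2 3) simp
  finally show ?thesis .
qed

lemma wcov_quadratic:
  "(wcov \<Omega> pt v *v h) \<bullet> h = (\<Sum>s\<in>\<Omega>. v s / sum v \<Omega> * ((pt s - wmean \<Omega> pt v) \<bullet> h)\<^sup>2)"
  unfolding wcov_mult_vec by (simp add: inner_sum_left power2_eq_square mult.assoc)

lemma has_derivative_wmean_tilt:
  fixes pt :: "'s \<Rightarrow> real ^ 'n::finite"
  assumes w: "weights_on \<Omega> w"
  shows "((\<lambda>x. wmean \<Omega> pt (tilt pt w x)) has_derivative (\<lambda>h. wcov \<Omega> pt (tilt pt w x) *v h)) (at x)"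
proof -
  let ?Z = "\<lambda>x. sum (tilt pt w x) \<Omega>"
  let ?N = "\<lambda>x. \<Sum>s\<in>\<Omega>. tilt pt w x s *\<^sub>R pt s"
  let ?Z' = "\<lambda>h. \<Sum>s\<in>\<Omega>. tilt pt w x s * (pt s \<bullet> h)"
  let ?N' = "\<lambda>h. \<Sum>s\<in>\<Omega>. (tilt pt w x s * (pt s \<bullet> h)) *\<^sub>R pt s"
  have Z: "?Z x > 0" by (rule weights_on_sum_pos[OF weights_on_tilt[OF w]])
  have t: "((\<lambda>x. tilt pt w x s) has_derivative (\<lambda>h. tilt pt w x s * (pt s \<bullet> h))) (at x)" for s
    unfolding tilt_def by (auto intro!: derivative_eq_intros)
  have dZ: "(?Z has_derivative ?Z') (at x)"
    by (intro has_derivative_sum t)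
  have dN: "(?N has_derivative ?N') (at x)"
    by (intro has_derivative_sum has_derivative_scaleR_left t)
  have d: "((\<lambda>x. inverse (?Z x) *\<^sub>R ?N x) has_derivative
      (\<lambda>h. inverse (?Z x) *\<^sub>R ?N' h + (- (inverse (?Z x) * ?Z' h * inverse (?Z x))) *\<^sub>R ?N x)) (at x)"
    by (rule has_derivative_scaleR[OF Deriv.has_derivative_inverse[OF _ dZ] dN]) (use Z in auto)
  have 1: "(\<lambda>x. inverse (?Z x) *\<^sub>R ?N x) = (\<lambda>x. wmean \<Omega> pt (tilt pt w x))"
    by (rule ext) (simp add: wmean_def scaleR_sum_right divide_inverse mult.commute)
  have 2: "inverse (?Z x) *\<^sub>R ?N' h + (- (inverse (?Z x) * ?Z' h * inverse (?Z x))) *\<^sub>R ?N x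
      = wcov \<Omega> pt (tilt pt w x) *v h" for h
  proof -
    have "wmean \<Omega> pt (tilt pt w x) = inverse (?Z x) *\<^sub>R ?N x"
      using fun_cong[OF 1, of x] by simp
    moreover have "wmean \<Omega> pt (tilt pt w x) \<bullet> h = inverse (?Z x) * ?Z' h"
      by (simp add: wmean_inner sum_distrib_left divide_inverse mult_ac)
    ultimately show ?thesis
      using Z by (subst wcov_mult_vec_expand)
        (simp_all add: scaleR_sum_right divide_inverse sum_negf mult_ac)
  qed
  show ?thesis using d unfolding 1 2 .
qed

section \<open>Limits and positivity of covariance matrices\<close>

lemma tendsto_det:
  fixes A :: "'a \<Rightarrow> real ^ 'n::finite ^ 'n"
  assumes "(A \<longlongrightarrow> L) F"
  shows "((\<lambda>x. det (A x)) \<longlongrightarrow> det L) F"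
  unfolding det_def by (intro tendsto_intros assms)

lemma tendsto_wcov:
  fixes pt :: "'s \<Rightarrow> real ^ 'n::finite"
  assumes v: "\<And>s. s \<in> \<Omega> \<Longrightarrow> ((\<lambda>k. v k s) \<longlongrightarrow> u s) F" and "sum u \<Omega> \<noteq> 0"
  shows "((\<lambda>k. wcov \<Omega> pt (v k)) \<longlongrightarrow> wcov \<Omega> pt u) F"
proof -
  have q: "((\<lambda>k. v k s / sum (v k) \<Omega>) \<longlongrightarrow> u s / sum u \<Omega>) F" if "s \<in> \<Omega>" for s
    by (intro tendsto_divide tendsto_sum v that assms)
  have m: "((\<lambda>k. wmean \<Omega> pt (v k)) \<longlongrightarrow> wmean \<Omega> pt u) F"
    unfolding wmean_def by (intro tendsto_sum tendsto_scaleR q tendsto_const)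
  show ?thesis
    unfolding wcov_def
    by (intro vec_tendstoI, unfold vec_lambda_beta)
       (intro tendsto_sum tendsto_mult q tendsto_vec_nth tendsto_diff tendsto_const m)
qed

lemma tendsto_tilt: "((\<lambda>x. tilt pt w x s) \<longlongrightarrow> tilt pt w y s) (at y)"
  unfolding tilt_def by (intro tendsto_intros)

definition total_cov ::
  "'s set \<Rightarrow> ('i \<Rightarrow> 's \<Rightarrow> real ^ 'n::finite) \<Rightarrow> ('i \<Rightarrow> 's \<Rightarrow> real) \<Rightarrow> 'i set \<Rightarrow> real ^ 'n \<Rightarrow> real ^ 'n ^ 'n"
  where "total_cov \<Omega> pt w I x = (\<Sum>i\<in>I. wcov \<Omega> (pt i) (tilt (pt i) (w i) x))"

lemma sum_matrix_vector_mult: "(\<Sum>i\<in>I. A i) *v h = (\<Sum>i\<in>I. A i *v h)"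
  by (induction I rule: infinite_finite_induct) (auto simp: matrix_vector_mult_add_rdistrib)

lemma continuous_on_det_total_cov:
  assumes "finite I" "\<And>i. i \<in> I \<Longrightarrow> weights_on \<Omega> (w i)"
  shows "continuous_on UNIV (\<lambda>x. det (total_cov \<Omega> pt w I x))"
  unfolding continuous_on_def total_cov_def
proof (intro ballI tendsto_det tendsto_sum tendsto_wcov tendsto_within_subset[OF tendsto_tilt])
  fix x i assume "i \<in> I"
  then show "sum (tilt (pt i) (w i) x) \<Omega> \<noteq> 0"
    using weights_on_sum_pos[OF weights_on_tilt[OF assms(2)], of i "pt i" x] by simp
qed auto

lemma total_cov_as_outer:
  "total_cov \<Omega> pt w I x = (\<Sum>i\<in>I. \<chi> a b. \<Sum>s\<in>\<Omega>. (tilt (pt i) (w i) x s / sum (tilt (pt i) (w i) x) \<Omega>)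
    * (pt i s - wmean \<Omega> (pt i) (tilt (pt i) (w i) x)) $ a * (pt i s - wmean \<Omega> (pt i) (tilt (pt i) (w i) x)) $ b)"
  by (simp add: total_cov_def wcov_def)

lemma det_total_cov_nonneg:
  fixes pt :: "'i \<Rightarrow> 's \<Rightarrow> real ^ 'n::finite"
  assumes "finite I" "\<And>i. i \<in> I \<Longrightarrow> weights_on \<Omega> (w i)" "finite \<Omega>"
  shows "0 \<le> det (total_cov \<Omega> pt w I x)"
proof -
  let ?v = "\<lambda>(i, s). pt i s - wmean \<Omega> (pt i) (tilt (pt i) (w i) x)"
  let ?c = "\<lambda>(i, s). tilt (pt i) (w i) x s / sum (tilt (pt i) (w i) x) \<Omega>"
  have "total_cov \<Omega> pt w I x = (\<chi> a b. \<Sum>k\<in>I \<times> \<Omega>. ?c k * ?v k $ a * ?v k $ b)"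
    unfolding total_cov_as_outer
    by (simp add: vec_eq_iff sum_component sum.cartesian_product case_prod_beta)
  moreover have "0 \<le> det (\<chi> a b. \<Sum>k\<in>I \<times> \<Omega>. ?c k * ?v k $ a * ?v k $ b)"
  proof (rule det_sum_outer_nonneg)
    show "finite (I \<times> \<Omega>)" using assms by simp
    fix k assume k: "k \<in> I \<times> \<Omega>"
    then have "weights_on \<Omega> (tilt (pt (fst k)) (w (fst k)) x)"
      by (auto intro!: weights_on_tilt assms)
    then show "0 \<le> ?c k"
      using k weights_on_sum_pos by (auto simp: weights_on_def case_prod_beta intro!: divide_nonneg_pos)
  qed
  ultimately show ?thesis by simp
qed

lemma mixed_total_cov_nonneg:
  fixes pt :: "'n \<Rightarrow> 's \<Rightarrow> real ^ 'n::finite"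
  assumes w: "\<And>i. weights_on \<Omega> (w i)"
  shows "0 \<le> alt_sum (\<lambda>I. det (total_cov \<Omega> pt w I x))"
  unfolding total_cov_as_outer
proof (rule mixed_discriminant_nonneg)
  show "finite \<Omega>" using w by (auto simp: weights_on_def)
  fix i s assume "s \<in> \<Omega>"
  moreover have "weights_on \<Omega> (tilt (pt i) (w i) x)" by (rule weights_on_tilt[OF w])
  ultimately show "0 \<le> tilt (pt i) (w i) x s / sum (tilt (pt i) (w i) x) \<Omega>"
    using weights_on_sum_pos by (auto simp: weights_on_def intro!: divide_nonneg_pos)
qed

section \<open>Volume of a Minkowski sum of polytopes\<close>

lemma has_derivative_total_mean:
  assumes "finite I" "\<And>i. i \<in> I \<Longrightarrow> weights_on \<Omega> (w i)"
  shows "((\<lambda>x. \<Sum>i\<in>I. wmean \<Omega> (pt i) (tilt (pt i) (w i) x)) has_derivative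
    (\<lambda>h. total_cov \<Omega> pt w I x *v h)) (at x)"
  unfolding total_cov_def sum_matrix_vector_mult
  by (intro has_derivative_sum has_derivative_wmean_tilt assms)

lemma wmean_in_hull:
  assumes v: "weights_on \<Omega> v"
  shows "wmean \<Omega> pt v \<in> convex hull (pt ` wsupp \<Omega> v)"
proof -
  have fin: "finite \<Omega>" and nn: "\<And>s. s \<in> \<Omega> \<Longrightarrow> 0 \<le> v s" using v by (auto simp: weights_on_def)
  have Z: "sum v \<Omega> > 0" by (rule weights_on_sum_pos[OF v])
  have z: "v s = 0" if "s \<in> \<Omega> - wsupp \<Omega> v" for s
    using nn[of s] that by auto
  have S: "sum v (wsupp \<Omega> v) = sum v \<Omega>"
    by (rule sum.mono_neutral_left) (use fin z in auto)
  have "wmean \<Omega> pt v = (\<Sum>s\<in>wsupp \<Omega> v. (v s / sum v \<Omega>) *\<^sub>R pt s)"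
    unfolding wmean_def by (rule sum.mono_neutral_right) (use fin z in auto)
  also have "\<dots> \<in> convex hull (pt ` wsupp \<Omega> v)"
    by (rule convex_sum)
       (use fin Z S in \<open>auto simp: sum_divide_distrib[symmetric] hull_inc\<close>)
  finally show ?thesis .
qed

lemma wsupp_tilt [simp]: "wsupp \<Omega> (tilt pt w x) = wsupp \<Omega> w"
  by (auto simp: tilt_def zero_less_mult_iff)

lemma wcov_quadratic_nonneg:
  assumes v: "weights_on \<Omega> v"
  shows "0 \<le> (wcov \<Omega> pt v *v h) \<bullet> h"
  unfolding wcov_quadratic
  using v weights_on_sum_pos[OF v]
  by (intro sum_nonneg mult_nonneg_nonneg) (auto simp: weights_on_def)

text \<open>The quadratic form is the variance of the heights along \<open>h\<close>, and two points
  of different height cannot both lie at the mean height.\<close>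

lemma wcov_quadratic_pos:
  assumes v: "weights_on \<Omega> v" and st: "s \<in> wsupp \<Omega> v" "t \<in> wsupp \<Omega> v" "pt s \<bullet> h \<noteq> pt t \<bullet> h"
  shows "0 < (wcov \<Omega> pt v *v h) \<bullet> h"
proof -
  obtain r where r: "r \<in> wsupp \<Omega> v" "(pt r - wmean \<Omega> pt v) \<bullet> h \<noteq> 0"
  proof -
    have "(pt s - wmean \<Omega> pt v) \<bullet> h \<noteq> 0 \<or> (pt t - wmean \<Omega> pt v) \<bullet> h \<noteq> 0"
      using st(3) by (auto simp: inner_diff_left)
    then show ?thesis using that st(1,2) by blast
  qed
  have Z: "sum v \<Omega> > 0" by (rule weights_on_sum_pos[OF v])
  have "0 < v r / sum v \<Omega> * ((pt r - wmean \<Omega> pt v) \<bullet> h)\<^sup>2"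
    using r Z by (intro mult_pos_pos divide_pos_pos) auto
  then show ?thesis
    unfolding wcov_quadratic
    using r v Z by (intro sum_pos2[of _ r]) (auto simp: weights_on_def)
qed

text \<open>The mean inherits the common height of the supporting points, so every deviation with
  positive weight is orthogonal to \<open>h\<close>.\<close>

lemma wcov_kernel:
  assumes v: "weights_on \<Omega> v"
    and eq: "\<And>s t. s \<in> wsupp \<Omega> v \<Longrightarrow> t \<in> wsupp \<Omega> v \<Longrightarrow> pt s \<bullet> h = pt t \<bullet> h"
  shows "wcov \<Omega> pt v *v h = 0"
proof -
  obtain s0 where s0: "s0 \<in> wsupp \<Omega> v" using v by (auto simp: weights_on_def)
  have "wmean \<Omega> pt v \<in> {q. h \<bullet> q = h \<bullet> pt s0}"
  proof (rule subsetD[OF _ wmean_in_hull[OF v]], rule hull_minimal[OF image_subsetI])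
    fix s assume "s \<in> wsupp \<Omega> v"
    from eq[OF this s0] show "pt s \<in> {q. h \<bullet> q = h \<bullet> pt s0}"
      by (simp add: inner_commute)
  qed (rule convex_hyperplane)
  then have m: "wmean \<Omega> pt v \<bullet> h = pt s0 \<bullet> h" by (simp add: inner_commute)
  have "v s / sum v \<Omega> * ((pt s - wmean \<Omega> pt v) \<bullet> h) = 0" if "s \<in> \<Omega>" for s
  proof (cases "v s = 0")
    case False
    then have "s \<in> wsupp \<Omega> v" using v that by (auto simp: weights_on_def less_le)
    then have "pt s \<bullet> h = pt s0 \<bullet> h" using s0 by (rule eq)
    then show ?thesis by (simp add: m inner_diff_left)
  qed simp
  then show ?thesis
    unfolding wcov_mult_vec by (intro sum.neutral ballI) (simp only: scaleR_zero_left)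
qed

text \<open>The map is the gradient of a convex function, and \<open>nd\<close> makes that function
  strictly convex in every direction.\<close>

lemma inj_total_mean:
  fixes pt :: "'i \<Rightarrow> 's \<Rightarrow> real ^ 'n::finite"
  assumes I: "finite I" "\<And>i. i \<in> I \<Longrightarrow> weights_on \<Omega> (w i)"
    and nd: "\<And>h. h \<noteq> 0 \<Longrightarrow> \<exists>i\<in>I. \<exists>s\<in>wsupp \<Omega> (w i). \<exists>t\<in>wsupp \<Omega> (w i). pt i s \<bullet> h \<noteq> pt i t \<bullet> h"
  shows "inj (\<lambda>x. \<Sum>i\<in>I. wmean \<Omega> (pt i) (tilt (pt i) (w i) x))" (is "inj ?g")
proof (rule injI, rule ccontr)
  fix x y assume eq: "?g x = ?g y" and ne: "x \<noteq> y"
  define h where "h = y - x"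
  have h: "h \<noteq> 0" using ne by (simp add: h_def)
  \<comment> \<open>The directional derivative along the segment from \<open>x\<close> to
    \<open>y\<close>; its own derivative is a sum of variances, one of them positive.\<close>
  let ?\<phi> = "\<lambda>t::real. ?g (x + t *\<^sub>R h) \<bullet> h"
  have d: "(?\<phi> has_real_derivative (total_cov \<Omega> pt w I (x + t *\<^sub>R h) *v h) \<bullet> h) (at t)" for t
  proof -
    have "((\<lambda>t. x + t *\<^sub>R h) has_derivative (\<lambda>t. t *\<^sub>R h)) (at t)"
      by (auto intro!: derivative_eq_intros)
    from has_derivative_inner_left[OF has_derivative_compose[OF this has_derivative_total_mean[where I=I and \<Omega>=\<Omega> and w=w and pt=pt, OF I]]]
    show ?thesis
      unfolding has_field_derivative_def
      by (rule has_derivative_eq_rhs) (auto simp: fun_eq_iff matrix_vector_mult_scaleR)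
  qed
  have pos: "0 < (total_cov \<Omega> pt w I z *v h) \<bullet> h" for z
  proof -
    obtain i s t where ist: "i \<in> I" "s \<in> wsupp \<Omega> (w i)" "t \<in> wsupp \<Omega> (w i)" "pt i s \<bullet> h \<noteq> pt i t \<bullet> h"
      using nd[OF h] by blast
    have wt: "j \<in> I \<Longrightarrow> weights_on \<Omega> (tilt (pt j) (w j) z)" for j
      by (intro weights_on_tilt I)
    have "0 < (wcov \<Omega> (pt i) (tilt (pt i) (w i) z) *v h) \<bullet> h"
      by (rule wcov_quadratic_pos[OF wt[OF ist(1)], of s t]) (use ist in simp_all)
    then show ?thesis
      unfolding total_cov_def sum_matrix_vector_mult inner_sum_left
      by (intro sum_pos2[OF I(1) ist(1)] wcov_quadratic_nonneg wt) auto
  qed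
  have "?\<phi> 0 < ?\<phi> 1"
    by (rule DERIV_pos_imp_increasing) (use d pos in auto)
  then show False using eq by (simp add: h_def)
qed

lemma compact_set_sum:
  fixes B :: "'i \<Rightarrow> 'a::euclidean_space set"
  assumes "\<And>i. i \<in> I \<Longrightarrow> compact (B i)"
  shows "compact (\<Sum>i\<in>I. B i)"
  using assms
proof (induction I rule: infinite_finite_induct)
  case (insert i I)
  have "B i + sum B I = {x + y |x y. x \<in> B i \<and> y \<in> sum B I}"
    by (auto simp: set_plus_def)
  then show ?case using compact_sums[of "B i" "sum B I"] insert by simp
qed (auto simp: set_zero)

text \<open>A preimage of \<open>v\<close> is a critical point of \<open>F\<close>, the sum of
  log-partition functions minus \<open>v \<bullet> x\<close>. Since \<open>v\<close> is interior,
  \<open>F\<close> grows at least linearly and attains its minimum.\<close>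

lemma interior_in_range_total_mean:
  fixes pt :: "'i \<Rightarrow> 's \<Rightarrow> real ^ 'n::finite"
  assumes I: "finite I" "\<And>i. i \<in> I \<Longrightarrow> weights_on \<Omega> (w i)"
    and v: "v \<in> interior (\<Sum>i\<in>I. convex hull (pt i ` wsupp \<Omega> (w i)))"
  shows "v \<in> range (\<lambda>x. \<Sum>i\<in>I. wmean \<Omega> (pt i) (tilt (pt i) (w i) x))" (is "v \<in> range ?g")
proof -
  let ?Q = "\<Sum>i\<in>I. convex hull (pt i ` wsupp \<Omega> (w i))"
  let ?Z = "\<lambda>i x. sum (tilt (pt i) (w i) x) \<Omega>"
  define F where "F x = (\<Sum>i\<in>I. ln (?Z i x)) - v \<bullet> x" for x
  obtain e where e: "e > 0" "cball v e \<subseteq> ?Q"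
    using v unfolding mem_interior_cball by blast
  \<comment> \<open>The smallest logarithm of a positive weight, so that any single summand bounds
    the partition sum from below.\<close>
  define c where "c i = Min ((\<lambda>s. ln (w i s)) ` wsupp \<Omega> (w i))" for i
  have Zpos: "?Z i x > 0" if "i \<in> I" for i x
    by (intro weights_on_sum_pos weights_on_tilt I that)
  have lower: "c i + q \<bullet> x \<le> ln (?Z i x)"
    if "i \<in> I" "q \<in> convex hull (pt i ` wsupp \<Omega> (w i))" for i q x
  proof -
    have fin: "finite \<Omega>" and nn: "\<And>s. s \<in> \<Omega> \<Longrightarrow> 0 \<le> w i s"
      using I(2)[OF that(1)] by (auto simp: weights_on_def)
    have "c i + pt i s \<bullet> x \<le> ln (?Z i x)" if s: "s \<in> wsupp \<Omega> (w i)" for s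
    proof -
      have "c i \<le> ln (w i s)" unfolding c_def by (rule Min_le) (use s fin in auto)
      moreover have "ln (w i s) + pt i s \<bullet> x = ln (tilt (pt i) (w i) x s)"
        using s by (simp add: tilt_def ln_mult)
      moreover have "ln (tilt (pt i) (w i) x s) \<le> ln (?Z i x)"
      proof (rule ln_mono)
        show "0 < tilt (pt i) (w i) x s" using s by (simp add: tilt_def)
        show "tilt (pt i) (w i) x s \<le> ?Z i x"
          by (rule member_le_sum) (use s fin nn in \<open>auto simp: tilt_def\<close>)
      qed
      ultimately show ?thesis by linarith
    qed
    then have "x \<bullet> pt i s \<le> ln (?Z i x) - c i" if "s \<in> wsupp \<Omega> (w i)" for s
      using that by (simp add: inner_commute[of x] add.commute le_diff_eq)
    then have "convex hull (pt i ` wsupp \<Omega> (w i)) \<subseteq> {q. x \<bullet> q \<le> ln (?Z i x) - c i}"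
      by (intro hull_minimal convex_halfspace_le) auto
    then have "x \<bullet> q \<le> ln (?Z i x) - c i" using that by blast
    then show ?thesis by (simp add: inner_commute[of x])
  qed
  have lowerQ: "sum c I + q \<bullet> x \<le> (\<Sum>i\<in>I. ln (?Z i x))" if q: "q \<in> ?Q" for q x
  proof -
    obtain f where f: "q = sum f I" "\<And>i. i \<in> I \<Longrightarrow> f i \<in> convex hull (pt i ` wsupp \<Omega> (w i))"
      using q unfolding set_sum_alt[OF I(1)] by auto
    have "sum c I + q \<bullet> x = (\<Sum>i\<in>I. c i + f i \<bullet> x)"
      by (simp add: f(1) inner_sum_left sum.distrib)
    also have "\<dots> \<le> (\<Sum>i\<in>I. ln (?Z i x))"
      by (intro sum_mono lower f)
    finally show ?thesis .
  qed
  have coercive: "sum c I + e * norm x \<le> F x" for x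
  proof (cases "x = 0")
    case True
    have "v \<in> ?Q" using v interior_subset by blast
    from lowerQ[OF this, of x] True show ?thesis by (simp add: F_def)
  next
    case False
    \<comment> \<open>The point of the ball around \<open>v\<close> that is farthest in direction
      \<open>x\<close>; applying the lower bound there gains \<open>e * norm x\<close> over
      \<open>v\<close>.\<close>
    let ?q = "v + (e / norm x) *\<^sub>R x"
    have "?q \<in> ?Q" using e False by (intro subsetD[OF e(2)]) (auto simp: dist_norm)
    from lowerQ[OF this, of x]
    show ?thesis using False by (simp add: F_def inner_add_left dot_square_norm power2_eq_square)
  qed
  have dF: "(F has_derivative (\<lambda>h. (?g x - v) \<bullet> h)) (at x)" for x
  proof -
    have t: "((\<lambda>x. tilt (pt i) (w i) x s) has_derivative (\<lambda>h. tilt (pt i) (w i) x s * (pt i s \<bullet> h))) (at x)" for i s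
      unfolding tilt_def by (auto intro!: derivative_eq_intros)
    have "((\<lambda>x. ln (?Z i x)) has_derivative (\<lambda>h. wmean \<Omega> (pt i) (tilt (pt i) (w i) x) \<bullet> h)) (at x)" if "i \<in> I" for i
    proof -
      have "(?Z i has_derivative (\<lambda>h. \<Sum>s\<in>\<Omega>. tilt (pt i) (w i) x s * (pt i s \<bullet> h))) (at x)"
        by (intro has_derivative_sum t)
      from has_derivative_ln[OF Zpos[OF that] this]
      show ?thesis
        by (rule has_derivative_eq_rhs)
           (simp add: fun_eq_iff wmean_inner sum_divide_distrib divide_inverse sum_distrib_left mult_ac)
    qed
    then have "(F has_derivative (\<lambda>h. (\<Sum>i\<in>I. wmean \<Omega> (pt i) (tilt (pt i) (w i) x) \<bullet> h) - v \<bullet> h)) (at x)"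
      unfolding F_def by (intro derivative_intros) auto
    then show ?thesis by (simp add: inner_diff_left inner_sum_left)
  qed
  have contF: "continuous_on UNIV F"
    by (rule has_derivative_continuous_on[where f'="\<lambda>x h. (?g x - v) \<bullet> h"]) (simp add: dF)
  \<comment> \<open>Outside this radius coercivity gives \<open>F 0 \<le> F y\<close>, so a minimum
    over the ball is global. The maximum with 0 keeps the ball nonempty.\<close>
  define R where "R = max 0 ((F 0 - sum c I) / e)"
  have "\<exists>x\<in>cball 0 R. \<forall>y\<in>cball 0 R. F x \<le> F y"
    by (rule continuous_attains_inf[OF compact_cball _ continuous_on_subset[OF contF subset_UNIV]])
       (simp add: R_def)
  then obtain x where x: "x \<in> cball 0 R" "\<And>y. y \<in> cball 0 R \<Longrightarrow> F x \<le> F y" by blast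
  have "F x \<le> F y" for y
  proof (cases "norm y \<le> R")
    case False
    then have "(F 0 - sum c I) / e < norm y" by (simp add: R_def)
    then have "F 0 - sum c I < e * norm y" using e(1) by (simp add: field_simps)
    then have "F 0 \<le> F y" using coercive[of y] by linarith
    moreover have "F x \<le> F 0" by (rule x(2)) (simp add: R_def)
    ultimately show ?thesis by linarith
  qed (use x in auto)
  then have "(\<lambda>h. (?g x - v) \<bullet> h) = (\<lambda>h. 0)"
    by (rule differential_zero_maxmin[OF UNIV_I open_UNIV dF disjI2, OF ballI])
  from fun_cong[OF this, of "?g x - v"] have "?g x - v = 0" by simp
  then have "v = ?g x" by simp
  then show ?thesis by (rule range_eqI)
qed

lemma in_proper_hyperplane:
  fixes pt :: "'i \<Rightarrow> 's \<Rightarrow> real ^ 'n::finite"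
  assumes I: "finite I"
    and eq: "\<And>i s t. i \<in> I \<Longrightarrow> s \<in> S i \<Longrightarrow> t \<in> S i \<Longrightarrow> pt i s \<bullet> h = pt i t \<bullet> h"
  shows "\<exists>c. (\<Sum>i\<in>I. convex hull (pt i ` S i)) \<subseteq> {q. h \<bullet> q = c}"
proof -
  define c where "c i = h \<bullet> pt i (SOME s. s \<in> S i)" for i
  have sub: "convex hull (pt i ` S i) \<subseteq> {q. h \<bullet> q = c i}" if i: "i \<in> I" for i
  proof (rule hull_minimal[OF image_subsetI])
    fix s assume s: "s \<in> S i"
    then have "(SOME s. s \<in> S i) \<in> S i" by (rule someI)
    from eq[OF i s this] show "pt i s \<in> {q. h \<bullet> q = c i}"
      by (simp add: c_def inner_commute)
  qed (rule convex_hyperplane)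
  have "h \<bullet> q = sum c I" if q: "q \<in> (\<Sum>i\<in>I. convex hull (pt i ` S i))" for q
  proof -
    obtain f where f: "q = sum f I" "\<forall>i\<in>I. f i \<in> convex hull (pt i ` S i)"
      using q unfolding set_sum_alt[OF I] by auto
    then show ?thesis
      unfolding f(1) inner_sum_right using sub by (intro sum.cong) auto
  qed
  then have "(\<Sum>i\<in>I. convex hull (pt i ` S i)) \<subseteq> {q. h \<bullet> q = sum c I}" by blast
  then show ?thesis ..
qed

text \<open>If a nonzero \<open>h\<close> is constant on every support, \<open>Q\<close> lies in a
  hyperplane and the Hessian kills \<open>h\<close>, so both sides vanish. Otherwise the total mean
  is injective with a range between the interior of \<open>Q\<close> and \<open>Q\<close>, and the
  change of variables formula applies.\<close>

theorem volume_minkowski_sum: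
  fixes pt :: "'i \<Rightarrow> 's \<Rightarrow> real ^ 'n::finite"
  assumes I: "finite I" "\<And>i. i \<in> I \<Longrightarrow> weights_on \<Omega> (w i)"
    and \<Omega>: "finite \<Omega>"
  defines "Q \<equiv> \<Sum>i\<in>I. convex hull (pt i ` wsupp \<Omega> (w i))"
  shows "integrable lborel (\<lambda>x. det (total_cov \<Omega> pt w I x))"
    and "integral\<^sup>L lborel (\<lambda>x. det (total_cov \<Omega> pt w I x)) = measure lebesgue Q"
proof -
  let ?g = "\<lambda>x. \<Sum>i\<in>I. wmean \<Omega> (pt i) (tilt (pt i) (w i) x)"
  have convQ: "convex Q" unfolding Q_def by (intro convex_set_sum convex_convex_hull)
  have compQ: "compact Q"
    unfolding Q_def using \<Omega> by (intro compact_set_sum finite_imp_compact_convex_hull) auto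
  define const_on_supports where "const_on_supports h \<longleftrightarrow>
    (\<forall>i\<in>I. \<forall>s\<in>wsupp \<Omega> (w i). \<forall>t\<in>wsupp \<Omega> (w i). pt i s \<bullet> h = pt i t \<bullet> h)" for h
  have "integrable lborel (\<lambda>x. det (total_cov \<Omega> pt w I x)) \<and>
    integral\<^sup>L lborel (\<lambda>x. det (total_cov \<Omega> pt w I x)) = measure lebesgue Q"
  proof (cases "\<exists>h. h \<noteq> 0 \<and> const_on_supports h")
    case True
    then obtain h where h: "h \<noteq> 0"
      and eq: "\<And>i s t. i \<in> I \<Longrightarrow> s \<in> wsupp \<Omega> (w i) \<Longrightarrow> t \<in> wsupp \<Omega> (w i) \<Longrightarrow> pt i s \<bullet> h = pt i t \<bullet> h"
      unfolding const_on_supports_def by blast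
    have "\<exists>c. Q \<subseteq> {q. h \<bullet> q = c}"
      unfolding Q_def by (rule in_proper_hyperplane[OF I(1)], rule eq)
    then obtain c where "Q \<subseteq> {q. h \<bullet> q = c}" ..
    then have "negligible Q" using negligible_hyperplane[of h c] h negligible_subset by blast
    then have mQ: "measure lebesgue Q = 0" by (rule negligible_imp_measure0)
    have "det (total_cov \<Omega> pt w I x) = 0" for x
    proof -
      have "wcov \<Omega> (pt i) (tilt (pt i) (w i) x) *v h = 0" if "i \<in> I" for i
        by (rule wcov_kernel[OF weights_on_tilt[OF I(2)[OF that]]], rule eq[OF that])
           (simp_all only: wsupp_tilt)
      then have "total_cov \<Omega> pt w I x *v h = (total_cov \<Omega> pt w I x) *v 0"
        unfolding total_cov_def sum_matrix_vector_mult matrix_vector_mult_0_right sum.neutral_const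
        by (intro sum.neutral ballI)
      then have "\<not> inj ((*v) (total_cov \<Omega> pt w I x))"
        using h unfolding inj_def by metis
      then have "\<not> det (matrix ((*v) (total_cov \<Omega> pt w I x))) \<noteq> 0"
        using det_nz_iff_inj[OF matrix_vector_mul_linear] by blast
      then show ?thesis unfolding matrix_of_matrix_vector_mul by simp
    qed
    then show ?thesis using mQ by simp
  next
    case False
    have sub: "range ?g \<subseteq> Q"
    proof clarify
      fix x
      have "wmean \<Omega> (pt i) (tilt (pt i) (w i) x) \<in> convex hull (pt i ` wsupp \<Omega> (w i))" if "i \<in> I" for i
        using wmean_in_hull[OF weights_on_tilt[OF I(2)[OF that]], of "pt i" "pt i" x] by simp
      then show "?g x \<in> Q" unfolding Q_def set_sum_alt[OF I(1)] by blast
    qed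
    have int: "interior Q \<subseteq> range ?g"
      unfolding Q_def by (rule subsetI) (rule interior_in_range_total_mean[where I=I and \<Omega>=\<Omega> and w=w and pt=pt, OF I])
    have inj: "inj ?g"
    proof (rule inj_total_mean[where I=I and \<Omega>=\<Omega> and w=w and pt=pt, OF I])
      fix h :: "real ^ 'n" assume "h \<noteq> 0"
      with False have "\<not> const_on_supports h" by blast
      then show "\<exists>i\<in>I. \<exists>s\<in>wsupp \<Omega> (w i). \<exists>t\<in>wsupp \<Omega> (w i). pt i s \<bullet> h \<noteq> pt i t \<bullet> h"
        unfolding const_on_supports_def by (simp only: ball_simps(10))
    qed
    have der: "(?g has_derivative (\<lambda>h. total_cov \<Omega> pt w I x *v h)) (at x)" for x
      by (rule has_derivative_total_mean[OF I(1)]) (rule I(2))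
    have bd: "bounded (range ?g)"
      using compQ sub by (meson bounded_subset compact_imp_bounded)
    have cont: "continuous_on UNIV (\<lambda>x. det (total_cov \<Omega> pt w I x))"
      by (rule continuous_on_det_total_cov[OF I(1)]) (rule I(2))
    have nonneg: "0 \<le> det (total_cov \<Omega> pt w I x)" for x
      by (rule det_total_cov_nonneg[OF I(1) _ \<Omega>]) (rule I(2))
    note * = integral_det_derivative[where f="?g" and A="total_cov \<Omega> pt w I", OF der inj bd cont nonneg]
    have "measure lebesgue (range ?g) = measure lebesgue Q"
    proof (rule measure_negligible_symdiff)
      show "Q \<in> lmeasurable" using convQ compQ by (simp add: lmeasurable_compact)
      \<comment> \<open>The range and \<open>Q\<close> can differ only on the frontier of a convex
        set, which is negligible.\<close>
      have "(Q - range ?g) \<union> (range ?g - Q) \<subseteq> frontier Q"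
        using sub int closure_subset[of Q] unfolding frontier_def by blast
      then show "negligible ((Q - range ?g) \<union> (range ?g - Q))"
        by (rule negligible_subset[OF negligible_convex_frontier[OF convQ]])
    qed
    then have "measure lborel (range ?g) = measure lebesgue Q"
      by (rule trans[rotated]) (rule measure_completion[symmetric], unfold sets_lborel, rule *(1))
    then show ?thesis by (rule conjI[OF *(2) trans[OF *(3)]])
  qed
  then show "integrable lborel (\<lambda>x. det (total_cov \<Omega> pt w I x))"
    and "integral\<^sup>L lborel (\<lambda>x. det (total_cov \<Omega> pt w I x)) = measure lebesgue Q"
    by - (erule conjunct1, erule conjunct2)
qed

section \<open>Mixed volumes and degenerations\<close>

text \<open>There is no division by \<open>n!\<close>: a constant tuple of a convex body has
  \<open>n!\<close> times its volume, in agreement with lattice volume.\<close>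

definition mixed_vol :: "('n::finite \<Rightarrow> (real ^ 'n) set) \<Rightarrow> real" where
  "mixed_vol Q = alt_sum (\<lambda>I. measure lebesgue (\<Sum>i\<in>I. Q i))"

text \<open>Up to the factor \<open>n!\<close>, the mixed discriminant of the covariance matrices of
  the members.\<close>

definition mixed_cov ::
  "'s set \<Rightarrow> ('n \<Rightarrow> 's \<Rightarrow> real ^ 'n::finite) \<Rightarrow> ('n \<Rightarrow> 's \<Rightarrow> real) \<Rightarrow> real ^ 'n \<Rightarrow> real"
  where "mixed_cov \<Omega> pt w x = alt_sum (\<lambda>I. det (total_cov \<Omega> pt w I x))"

lemma mixed_cov_nonneg:
  fixes pt :: "'n::finite \<Rightarrow> 's \<Rightarrow> real ^ 'n"
  assumes w: "\<And>i. weights_on \<Omega> (w i)"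
  shows "0 \<le> mixed_cov \<Omega> pt w x"
  unfolding mixed_cov_def by (rule mixed_total_cov_nonneg[OF w])

lemma integral_mixed_cov:
  fixes pt :: "'n::finite \<Rightarrow> 's \<Rightarrow> real ^ 'n"
  assumes w: "\<And>i. weights_on \<Omega> (w i)"
  shows "integrable lborel (mixed_cov \<Omega> pt w)"
    and "integral\<^sup>L lborel (mixed_cov \<Omega> pt w) = mixed_vol (\<lambda>i. convex hull (pt i ` wsupp \<Omega> (w i)))"
proof -
  have \<Omega>: "finite \<Omega>" using w by (auto simp: weights_on_def)
  have vol: "integrable lborel (\<lambda>x. det (total_cov \<Omega> pt w I x))"
    "integral\<^sup>L lborel (\<lambda>x. det (total_cov \<Omega> pt w I x))
      = measure lebesgue (\<Sum>i\<in>I. convex hull (pt i ` wsupp \<Omega> (w i)))" for I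
    by (rule volume_minkowski_sum[OF finite w \<Omega>])+
  have int: "integrable lborel (\<lambda>x. c * det (total_cov \<Omega> pt w I x))" for I c
    using vol(1) by simp
  show "integrable lborel (mixed_cov \<Omega> pt w)"
    unfolding mixed_cov_def[abs_def] alt_sum_def by (intro Bochner_Integration.integrable_sum int)
  have "integral\<^sup>L lborel (mixed_cov \<Omega> pt w)
      = (\<Sum>I\<in>Pow UNIV. integral\<^sup>L lborel (\<lambda>x. (-1) ^ (CARD('n) - card I) * det (total_cov \<Omega> pt w I x)))"
    unfolding mixed_cov_def[abs_def] alt_sum_def by (intro Bochner_Integration.integral_sum int)
  also have "\<dots> = mixed_vol (\<lambda>i. convex hull (pt i ` wsupp \<Omega> (w i)))"
    unfolding mixed_vol_def alt_sum_def
    by (intro sum.cong refl) (simp only: integral_mult_right_zero vol(2))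
  finally show "integral\<^sup>L lborel (mixed_cov \<Omega> pt w) = mixed_vol (\<lambda>i. convex hull (pt i ` wsupp \<Omega> (w i)))" .
qed

lemma nn_integral_mixed_cov:
  fixes pt :: "'n::finite \<Rightarrow> 's \<Rightarrow> real ^ 'n"
  assumes w: "\<And>i. weights_on \<Omega> (w i)"
  shows "(\<integral>\<^sup>+x. ennreal (mixed_cov \<Omega> pt w x) \<partial>lborel)
    = ennreal (mixed_vol (\<lambda>i. convex hull (pt i ` wsupp \<Omega> (w i))))"
  unfolding integral_mixed_cov(2)[OF w, symmetric]
  by (rule nn_integral_eq_integral[OF integral_mixed_cov(1)[OF w]]) (simp add: mixed_cov_nonneg[OF w])

lemma borel_measurable_mixed_cov:
  fixes pt :: "'n::finite \<Rightarrow> 's \<Rightarrow> real ^ 'n"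
  assumes w: "\<And>i. weights_on \<Omega> (w i)"
  shows "mixed_cov \<Omega> pt w \<in> borel_measurable borel"
  unfolding mixed_cov_def[abs_def] alt_sum_def
  by (intro borel_measurable_continuous_onI continuous_intros continuous_on_det_total_cov w finite)

lemma mixed_vol_nonneg_hulls:
  fixes pt :: "'n::finite \<Rightarrow> 's \<Rightarrow> real ^ 'n"
  assumes w: "\<And>i. weights_on \<Omega> (w i)"
  shows "0 \<le> mixed_vol (\<lambda>i. convex hull (pt i ` wsupp \<Omega> (w i)))"
  unfolding integral_mixed_cov(2)[OF w, symmetric]
  by (rule Bochner_Integration.integral_nonneg) (rule mixed_cov_nonneg[OF w])

text \<open>Moving the origin to \<open>x k\<close> multiplies each weight by an exponential, and
  \<open>m k i\<close> rescales all weights of member \<open>i\<close> at once, which covariances do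
  not see. Hence convergence of the rescaled weights suffices.\<close>

lemma tendsto_mixed_cov:
  fixes pt :: "'n::finite \<Rightarrow> 's \<Rightarrow> real ^ 'n"
  assumes u: "\<And>i. weights_on \<Omega> (u i)"
    and m: "\<And>k i. m k i \<noteq> (0::real)"
    and lim: "\<And>i s. s \<in> \<Omega> \<Longrightarrow> ((\<lambda>k. w k i s * exp (pt i s \<bullet> x k) / m k i) \<longlongrightarrow> u i s) F"
  shows "((\<lambda>k. mixed_cov \<Omega> pt (w k) (x k + y)) \<longlongrightarrow> mixed_cov \<Omega> pt u y) F"
proof -
  have "wcov \<Omega> (pt i) (tilt (pt i) (w k i) (x k + y))
      = wcov \<Omega> (pt i) (\<lambda>s. inverse (m k i) * tilt (pt i) (w k i) (x k + y) s)" for k i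
    by (rule wcov_scale[symmetric]) (simp add: m)
  moreover have "((\<lambda>k. wcov \<Omega> (pt i) (\<lambda>s. inverse (m k i) * tilt (pt i) (w k i) (x k + y) s))
      \<longlongrightarrow> wcov \<Omega> (pt i) (tilt (pt i) (u i) y)) F" for i
  proof (rule tendsto_wcov)
    show "sum (tilt (pt i) (u i) y) \<Omega> \<noteq> 0"
      using weights_on_sum_pos[OF weights_on_tilt[OF u[of i]], of "pt i" y] by simp
    fix s assume "s \<in> \<Omega>"
    from tendsto_mult[OF lim[OF this] tendsto_const]
    have "((\<lambda>k. w k i s * exp (pt i s \<bullet> x k) / m k i * exp (pt i s \<bullet> y)) \<longlongrightarrow> u i s * exp (pt i s \<bullet> y)) F" .
    then show "((\<lambda>k. inverse (m k i) * tilt (pt i) (w k i) (x k + y) s) \<longlongrightarrow> tilt (pt i) (u i) y s) F"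
      by (simp add: tilt_def inner_add_right exp_add divide_inverse mult_ac)
  qed
  ultimately show ?thesis
    unfolding mixed_cov_def alt_sum_def total_cov_def
    by (intro tendsto_sum tendsto_mult tendsto_const tendsto_det) (simp only:)
qed

lemma nn_integral_lborel_shift:
  fixes f :: "'a::euclidean_space \<Rightarrow> ennreal"
  assumes "f \<in> borel_measurable borel"
  shows "(\<integral>\<^sup>+y. f (t + y) \<partial>lborel) = (\<integral>\<^sup>+x. f x \<partial>lborel)"
proof -
  have "(\<integral>\<^sup>+x. f x \<partial>lborel) = (\<integral>\<^sup>+x. f x \<partial>distr lborel borel ((+) t))"
    by (simp add: lborel_distr_plus)
  also have "\<dots> = (\<integral>\<^sup>+y. f (t + y) \<partial>lborel)"
    using assms by (intro nn_integral_distr) auto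
  finally show ?thesis by simp
qed

text \<open>A degenerating family of weights concentrates near several points \<open>x k c\<close> that move apart, and
  near each of them the covariance density converges to that of a limit configuration. By Fatou's
  lemma the mixed volumes of the limit configurations add up to at most the mixed volume of the
  original tuple. (These are the mixed cells of a coherent mixed subdivision.)\<close>

theorem sum_mixed_vol_cells_le:
  fixes pt :: "'n::finite \<Rightarrow> 's \<Rightarrow> real ^ 'n" and cells :: "'c set"
  assumes cells: "finite cells"
    and w: "\<And>k i. weights_on \<Omega> (w k i)"
    and u: "\<And>c i. c \<in> cells \<Longrightarrow> weights_on \<Omega> (u c i)"
    and Q: "\<And>k i. convex hull (pt i ` wsupp \<Omega> (w k i)) = Q i"
    and m: "\<And>c k i. m c k i \<noteq> (0::real)"
    and lim: "\<And>c i s. c \<in> cells \<Longrightarrow> s \<in> \<Omega> \<Longrightarrow>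
      (\<lambda>k. w k i s * exp (pt i s \<bullet> x c k) / m c k i) \<longlonglongrightarrow> u c i s"
    and sep: "\<And>c d k. c \<in> cells \<Longrightarrow> d \<in> cells \<Longrightarrow> c \<noteq> d \<Longrightarrow> real k \<le> dist (x c k) (x d k)"
  shows "(\<Sum>c\<in>cells. mixed_vol (\<lambda>i. convex hull (pt i ` wsupp \<Omega> (u c i)))) \<le> mixed_vol Q"
proof -
  define D where "D k = (\<lambda>y. ennreal (mixed_cov \<Omega> pt (w k) y))" for k
  define E where "E c = (\<lambda>y. ennreal (mixed_cov \<Omega> pt (u c) y))" for c
  \<comment> \<open>The density near each centre, in coordinates centred there and cut off at half
    the distance by which the centres are separated.\<close>
  define G where "G k y = (\<Sum>c\<in>cells. D k (x c k + y) * indicator (ball 0 (real k / 2)) y)" for k y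
  have D_meas: "D k \<in> borel_measurable borel" for k
    unfolding D_def using borel_measurable_mixed_cov[OF w] by (intro measurable_compose[OF _ measurable_ennreal])
  have E_meas: "E c \<in> borel_measurable borel" if "c \<in> cells" for c
    unfolding E_def using borel_measurable_mixed_cov[OF u[OF that]]
    by (intro measurable_compose[OF _ measurable_ennreal])
  have D_shift: "(\<lambda>y. D k (t + y)) \<in> borel_measurable borel" for k t
    using D_meas by measurable
  have G_le: "(\<integral>\<^sup>+y. G k y \<partial>lborel) \<le> ennreal (mixed_vol Q)" for k
  proof -
    let ?f = "\<lambda>c z. D k z * indicator (ball (x c k) (real k / 2)) z"
    have shift: "?f c (x c k + y) = D k (x c k + y) * indicator (ball 0 (real k / 2)) y" for c y
      by (simp add: indicator_def dist_norm)
    have meas: "?f c \<in> borel_measurable borel" for c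
      by (intro borel_measurable_times_ennreal D_meas borel_measurable_indicator) simp
    have "(\<integral>\<^sup>+y. G k y \<partial>lborel) = (\<Sum>c\<in>cells. \<integral>\<^sup>+y. ?f c (x c k + y) \<partial>lborel)"
      unfolding G_def shift[symmetric]
    proof (rule nn_integral_sum)
      fix c
      have "(\<lambda>y. x c k + y) \<in> borel_measurable borel" by simp
      from measurable_compose[OF this meas, of c]
      show "(\<lambda>y. ?f c (x c k + y)) \<in> borel_measurable lborel" by (simp only: measurable_lborel2)
    qed
    also have "\<dots> = (\<Sum>c\<in>cells. \<integral>\<^sup>+z. ?f c z \<partial>lborel)"
      by (intro sum.cong refl nn_integral_lborel_shift meas)
    also have "\<dots> = (\<integral>\<^sup>+z. (\<Sum>c\<in>cells. ?f c z) \<partial>lborel)"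
      by (rule nn_integral_sum[symmetric]) (simp only: measurable_lborel2 meas)
    also have "\<dots> \<le> (\<integral>\<^sup>+z. D k z \<partial>lborel)"
    proof (rule nn_integral_mono)
      fix z
      show "(\<Sum>c\<in>cells. ?f c z) \<le> D k z"
      proof (cases "\<exists>c\<in>cells. z \<in> ball (x c k) (real k / 2)")
        case True
        then obtain c where c: "c \<in> cells" "z \<in> ball (x c k) (real k / 2)" by blast
        \<comment> \<open>The balls around different centres are disjoint by \<open>sep\<close>, so
          at most one summand is nonzero.\<close>
        have "?f d z = 0" if "d \<in> cells - {c}" for d
        proof -
          have "z \<notin> ball (x d k) (real k / 2)"
          proof
            assume "z \<in> ball (x d k) (real k / 2)"
            then have "dist (x c k) (x d k) < real k"
              using c(2) dist_triangle_half_r[of z "x c k" "real k" "x d k"] by (simp add: dist_commute)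
            then show False using sep[of c d k] c(1) that by force
          qed
          then show ?thesis by simp
        qed
        then have "(\<Sum>d\<in>cells. ?f d z) = ?f c z + 0"
          unfolding sum.remove[OF cells c(1)] by (intro arg_cong2[of _ _ _ _ "(+)"] refl sum.neutral ballI)
        then show ?thesis using c(2) by simp
      next
        case False
        then have "(\<Sum>c\<in>cells. ?f c z) = 0"
          by (intro sum.neutral ballI) (auto simp: indicator_def)
        then show ?thesis by (simp only: zero_le)
      qed
    qed
    also have "\<dots> = ennreal (mixed_vol Q)"
      unfolding D_def nn_integral_mixed_cov[OF w] Q ..
    finally show ?thesis .
  qed
  have lim_G: "(\<lambda>k. G k y) \<longlonglongrightarrow> (\<Sum>c\<in>cells. E c y)" for y
    unfolding G_def
  proof (rule tendsto_sum)
    fix c assume c: "c \<in> cells"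
    have "(\<lambda>k. mixed_cov \<Omega> pt (w k) (x c k + y)) \<longlonglongrightarrow> mixed_cov \<Omega> pt (u c) y"
      by (rule tendsto_mixed_cov[OF u[OF c] m lim[OF c]])
    then have "(\<lambda>k. D k (x c k + y)) \<longlonglongrightarrow> E c y"
      unfolding D_def E_def by (rule tendsto_ennrealI)
    \<comment> \<open>For fixed \<open>y\<close> the cutoff has no effect once \<open>k\<close>
      exceeds twice the norm of \<open>y\<close>.\<close>
    moreover have "eventually (\<lambda>k. D k (x c k + y) = D k (x c k + y) * indicator (ball 0 (real k / 2)) y) sequentially"
    proof -
      obtain N :: nat where "2 * norm y < real N" using reals_Archimedean2 by blast
      then have "\<forall>k\<ge>N. y \<in> ball 0 (real k / 2)" by auto
      then show ?thesis unfolding eventually_sequentially by (metis indicator_simps(1) mult.right_neutral)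
    qed
    ultimately show "(\<lambda>k. D k (x c k + y) * indicator (ball 0 (real k / 2)) y) \<longlonglongrightarrow> E c y"
      by (rule Lim_transform_eventually)
  qed
  have G_meas: "G k \<in> borel_measurable lborel" for k
    unfolding G_def[abs_def] measurable_lborel2
    by (intro borel_measurable_sum borel_measurable_times_ennreal D_shift borel_measurable_indicator) simp
  have "(\<integral>\<^sup>+y. (\<Sum>c\<in>cells. E c y) \<partial>lborel) = (\<integral>\<^sup>+y. liminf (\<lambda>k. G k y) \<partial>lborel)"
    by (intro nn_integral_cong) (simp add: lim_imp_Liminf[OF _ lim_G])
  also have "\<dots> \<le> liminf (\<lambda>k. \<integral>\<^sup>+y. G k y \<partial>lborel)"
    by (rule nn_integral_liminf[OF G_meas])
  also have "\<dots> \<le> ennreal (mixed_vol Q)"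
    using Liminf_mono[OF always_eventually[OF allI[OF G_le]], of sequentially] by (simp add: Liminf_const)
  finally have le: "(\<integral>\<^sup>+y. (\<Sum>c\<in>cells. E c y) \<partial>lborel) \<le> ennreal (mixed_vol Q)" .
  have "(\<integral>\<^sup>+y. (\<Sum>c\<in>cells. E c y) \<partial>lborel) = (\<Sum>c\<in>cells. \<integral>\<^sup>+y. E c y \<partial>lborel)"
    using E_meas by (intro nn_integral_sum) simp
  also have "\<dots> = (\<Sum>c\<in>cells. ennreal (mixed_vol (\<lambda>i. convex hull (pt i ` wsupp \<Omega> (u c i)))))"
    unfolding E_def by (intro sum.cong refl nn_integral_mixed_cov u)
  also have "\<dots> = ennreal (\<Sum>c\<in>cells. mixed_vol (\<lambda>i. convex hull (pt i ` wsupp \<Omega> (u c i))))"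
    by (intro sum_ennreal mixed_vol_nonneg_hulls u)
  finally have "ennreal (\<Sum>c\<in>cells. mixed_vol (\<lambda>i. convex hull (pt i ` wsupp \<Omega> (u c i)))) \<le> ennreal (mixed_vol Q)"
    using le by simp
  moreover have "0 \<le> mixed_vol Q"
    using mixed_vol_nonneg_hulls[where w="w 0" and pt=pt, OF w] unfolding Q .
  ultimately show ?thesis by (simp add: ennreal_le_iff)
qed

text \<open>A degeneration with a single cell and a fixed centre: points of \<open>A i\<close> keep
  weight 1, while the weights of the other points of \<open>A' i\<close> tend to 0.\<close>

lemma mixed_vol_mono:
  fixes A A' :: "'n::finite \<Rightarrow> (real ^ 'n) set"
  assumes A: "\<And>i. finite (A i)" "\<And>i. A i \<noteq> {}" and A': "\<And>i. finite (A' i)"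
    and sub: "\<And>i. convex hull (A i) \<subseteq> convex hull (A' i)"
  shows "mixed_vol (\<lambda>i. convex hull (A i)) \<le> mixed_vol (\<lambda>i. convex hull (A' i))"
proof -
  define \<Omega> where "\<Omega> = (\<Union>i. A i \<union> A' i)"
  define w where "w k i s = (if s \<in> A i then 1 else if s \<in> A' i then inverse (real (Suc k)) else 0)" for k i s
  define u where "u i s = (if s \<in> A i then 1 else 0 :: real)" for i s
  have fin: "finite \<Omega>" unfolding \<Omega>_def using A A' by auto
  have w: "weights_on \<Omega> (w k i)" for k i
    using A(2)[of i] fin by (force simp: weights_on_def w_def \<Omega>_def)
  have u: "weights_on \<Omega> (u i)" for i
    using A(2)[of i] fin by (force simp: weights_on_def u_def \<Omega>_def)
  have sw: "wsupp \<Omega> (w k i) = A i \<union> A' i" for k i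
    by (auto simp: w_def \<Omega>_def split: if_splits)
  have su: "wsupp \<Omega> (u i) = A i" for i
    by (auto simp: u_def \<Omega>_def split: if_splits)
  have hull: "convex hull (A i \<union> A' i) = convex hull (A' i)" for i
  proof (rule antisym)
    show "convex hull (A i \<union> A' i) \<subseteq> convex hull (A' i)"
      using sub[of i] hull_subset[of "A i" convex] hull_subset[of "A' i" convex] by (intro hull_minimal) auto
  qed (intro hull_mono, auto)
  have "(\<Sum>c\<in>{()}. mixed_vol (\<lambda>i. convex hull ((\<lambda>s. s) ` wsupp \<Omega> (u i)))) \<le> mixed_vol (\<lambda>i. convex hull (A' i))"
  proof (rule sum_mixed_vol_cells_le[where w=w and m="\<lambda>_ _ _. 1" and x="\<lambda>_ _. 0"])
    show "(\<lambda>k. w k i s * exp (s \<bullet> 0) / 1) \<longlonglongrightarrow> u i s" for i s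
      by (cases "s \<in> A i"; cases "s \<in> A' i")
         (simp_all add: w_def u_def LIMSEQ_inverse_real_of_nat del: of_nat_Suc)
  qed (use w u in \<open>simp_all only: sw hull image_ident\<close>, simp_all)
  then show ?thesis by (simp add: su)
qed

section \<open>Truncating bodies in the orthant\<close>

text \<open>The vector \<open>a\<close> bounds the complement: an orthant point outside
  \<open>B\<close> has all its coordinates below \<open>a\<close>. The truncation to
  \<open>cbox 0 a\<close> therefore determines \<open>B\<close>.\<close>

definition orthant_body :: "real ^ 'n::finite \<Rightarrow> (real ^ 'n) set \<Rightarrow> bool" where
  "orthant_body a B \<longleftrightarrow> convex B \<and> B \<subseteq> pos_orthant \<and> (\<forall>j. 0 < a $ j) \<and>
     (\<forall>x\<in>pos_orthant. \<forall>j. a $ j \<le> x $ j \<longrightarrow> x \<in> B)"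

lemma orthant_bodyD:
  assumes "orthant_body a B"
  shows "convex B" "B \<subseteq> pos_orthant" "0 < a $ j" "x \<in> pos_orthant \<Longrightarrow> a $ j \<le> x $ j \<Longrightarrow> x \<in> B"
  using assms by (auto simp: orthant_body_def)

lemma pos_orthant_add: "x \<in> pos_orthant \<Longrightarrow> y \<in> pos_orthant \<Longrightarrow> x + y \<in> pos_orthant"
  by (simp add: pos_orthant_def)

lemma pos_orthant_scaleR: "x \<in> pos_orthant \<Longrightarrow> 0 \<le> c \<Longrightarrow> c *\<^sub>R x \<in> pos_orthant"
  by (simp add: pos_orthant_def)

lemma convex_pos_orthant: "convex pos_orthant"
  by (auto simp: convex_def pos_orthant_def)

text \<open>Far along the ray from \<open>x\<close> in direction \<open>v\<close> some coordinate
  exceeds its bound in \<open>a\<close>, so the ray reaches \<open>B\<close> again; convexity fills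
  in the points between.\<close>

lemma orthant_body_up:
  assumes B: "orthant_body a B" and x: "x \<in> B" and v: "v \<in> pos_orthant"
  shows "x + v \<in> B"
proof (cases "v = 0")
  case False
  then obtain j where "v $ j \<noteq> 0" by (auto simp: vec_eq_iff)
  with v have j: "0 < v $ j" by (auto simp: pos_orthant_def less_le)
  define s where "s = max 1 (a $ j / v $ j)"
  have s: "1 \<le> s" "a $ j \<le> s * v $ j"
    using j by (auto simp: s_def max_def field_simps)
  have xC: "x \<in> pos_orthant" using x orthant_bodyD(2)[OF B] by blast
  then have "0 \<le> x $ j" by (simp add: pos_orthant_def)
  have "x + s *\<^sub>R v \<in> B"
    by (rule orthant_bodyD(4)[OF B, of _ j])
       (use xC v s \<open>0 \<le> x $ j\<close> in \<open>auto intro!: pos_orthant_add pos_orthant_scaleR\<close>)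
  then have "(1 - 1 / s) *\<^sub>R x + (1 / s) *\<^sub>R (x + s *\<^sub>R v) \<in> B"
    using x s by (intro convexD[OF orthant_bodyD(1)[OF B]]) auto
  moreover have "(1 - 1 / s) *\<^sub>R x + (1 / s) *\<^sub>R (x + s *\<^sub>R v) = x + v"
    using s by (simp add: algebra_simps)
  ultimately show ?thesis by simp
qed (use x in simp)

lemma orthant_body_upward:
  assumes B: "orthant_body a B" and x: "x \<in> B" and le: "\<And>j. x $ j \<le> y $ j"
  shows "y \<in> B"
proof -
  have "x + (y - x) \<in> B"
    by (rule orthant_body_up[OF B x]) (simp add: pos_orthant_def le)
  then show ?thesis by simp
qed

text \<open>A point whose coordinate \<open>j\<close> is large is split in the proportion of
  \<open>a $ j\<close> to \<open>a' $ j\<close>, which makes coordinate \<open>j\<close> of both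
  parts large enough.\<close>

lemma orthant_body_plus:
  assumes B: "orthant_body a B" and B': "orthant_body a' B'"
  shows "orthant_body (a + a') (B + B')"
  unfolding orthant_body_def
proof (intro conjI allI ballI impI)
  show "convex (B + B')" by (intro convex_set_plus orthant_bodyD(1)[OF B] orthant_bodyD(1)[OF B'])
  show "B + B' \<subseteq> pos_orthant"
    using orthant_bodyD(2)[OF B] orthant_bodyD(2)[OF B'] by (auto simp: set_plus_def intro!: pos_orthant_add)
  show pos: "0 < (a + a') $ j" for j
    using orthant_bodyD(3)[OF B, of j] orthant_bodyD(3)[OF B', of j] by simp
  fix x :: "real ^ 'a" and j assume x: "x \<in> pos_orthant" and le: "(a + a') $ j \<le> x $ j"
  let ?t = "a $ j / (a + a') $ j" and ?t' = "a' $ j / (a + a') $ j"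
  have t: "0 \<le> ?t" "0 \<le> ?t'" "?t + ?t' = 1"
    using pos[of j] orthant_bodyD(3)[OF B, of j] orthant_bodyD(3)[OF B', of j]
    by (auto simp: add_divide_distrib[symmetric])
  have "?t * (a + a') $ j \<le> ?t * x $ j" "?t' * (a + a') $ j \<le> ?t' * x $ j"
    using le t by (simp_all only: mult_left_mono)
  then have tx: "a $ j \<le> (?t *\<^sub>R x) $ j" "a' $ j \<le> (?t' *\<^sub>R x) $ j"
    using pos[of j] by simp_all
  have "?t *\<^sub>R x \<in> B"
    by (rule orthant_bodyD(4)[OF B _ tx(1)]) (rule pos_orthant_scaleR[OF x t(1)])
  moreover have "?t' *\<^sub>R x \<in> B'"
    by (rule orthant_bodyD(4)[OF B' _ tx(2)]) (rule pos_orthant_scaleR[OF x t(2)])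
  ultimately have "?t *\<^sub>R x + ?t' *\<^sub>R x \<in> B + B'" by (rule set_plus_intro)
  then show "x \<in> B + B'" unfolding scaleR_add_left[symmetric] t(3) by simp
qed

text \<open>When \<open>b\<close> leaves its box, a new decomposition of the same sum is found whose
  two parts stay in their boxes.\<close>

lemma truncation_split:
  assumes B: "orthant_body a B" and B': "orthant_body a' B'"
    and b: "b \<in> B" and b': "b' \<in> B'" and le: "\<And>j. b $ j + b' $ j \<le> a $ j + a' $ j"
    and i: "a $ i < b $ i"
  shows "b + b' \<in> (B \<inter> cbox 0 a) + (B' \<inter> cbox 0 a')"
proof -
  have nn: "0 \<le> b $ j" "0 \<le> b' $ j" "0 < a $ j" "0 < a' $ j" for j
    using orthant_bodyD(2)[OF B] orthant_bodyD(2)[OF B'] b b' orthant_bodyD(3)[OF B] orthant_bodyD(3)[OF B']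
    by (auto simp: pos_orthant_def)
  \<comment> \<open>Clip \<open>b\<close> at \<open>a\<close>, but raise it wherever the remainder
    would exceed \<open>a'\<close>. Coordinate \<open>i\<close> becomes exactly
    \<open>a $ i\<close>, which keeps \<open>y\<close> in \<open>B\<close>.\<close>
  define y where "y = (\<chi> j. max (min (b $ j) (a $ j)) (b $ j + b' $ j - a' $ j))"
  have y: "0 \<le> y $ j" "y $ j \<le> a $ j" "y $ j \<le> b $ j + b' $ j" "b $ j + b' $ j - y $ j \<le> a' $ j" for j
    using nn[of j] le[of j] by (auto simp: y_def)
  have "y \<in> B"
    by (rule orthant_bodyD(4)[OF B, of _ i]) (use y i nn in \<open>auto simp: pos_orthant_def y_def\<close>)
  \<comment> \<open>Either a raised coordinate makes the remainder equal to \<open>a'\<close> there,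
    or the remainder dominates \<open>b'\<close> in every coordinate.\<close>
  moreover have "b + b' - y \<in> B'"
  proof (cases "\<exists>j. b $ j \<le> a $ j \<and> a' $ j < b' $ j")
    case True
    then obtain j where j: "b $ j \<le> a $ j" "a' $ j < b' $ j" by blast
    show ?thesis
      by (rule orthant_bodyD(4)[OF B', of _ j]) (use y j in \<open>auto simp: pos_orthant_def y_def\<close>)
  next
    case False
    have "b' $ j \<le> (b + b' - y) $ j" for j
    proof (cases "b $ j \<le> a $ j")
      case True
      with False have "b' $ j \<le> a' $ j" by (meson not_le)
      with True show ?thesis by (simp add: y_def)
    next
      case False
      with le[of j] show ?thesis by (simp add: y_def)
    qed
    then show ?thesis by (rule orthant_body_upward[OF B' b'])
  qed
  ultimately have "y + (b + b' - y) \<in> (B \<inter> cbox 0 a) + (B' \<inter> cbox 0 a')"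
    using y by (intro set_plus_intro) (auto simp: mem_box_cart)
  then show ?thesis by simp
qed

text \<open>Decompositions that leave the boxes are repaired by \<open>truncation_split\<close>.
  This compatibility reduces relative mixed volumes to mixed volumes of polytopes.\<close>

lemma truncation_plus:
  assumes B: "orthant_body a B" and B': "orthant_body a' B'"
  shows "(B \<inter> cbox 0 a) + (B' \<inter> cbox 0 a') = (B + B') \<inter> cbox 0 (a + a')"
proof (rule antisym)
  show "(B \<inter> cbox 0 a) + (B' \<inter> cbox 0 a') \<subseteq> (B + B') \<inter> cbox 0 (a + a')"
    by (auto simp: set_plus_def mem_box_cart intro!: add_mono)
  show "(B + B') \<inter> cbox 0 (a + a') \<subseteq> (B \<inter> cbox 0 a) + (B' \<inter> cbox 0 a')"
  proof
    fix x assume "x \<in> (B + B') \<inter> cbox 0 (a + a')"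
    then obtain b b' where b: "b \<in> B" "b' \<in> B'" and x: "x = b + b'"
      and le: "\<And>j. b $ j + b' $ j \<le> a $ j + a' $ j"
      by (auto simp: set_plus_def mem_box_cart)
    have nn: "0 \<le> b $ j" "0 \<le> b' $ j" for j
      using orthant_bodyD(2)[OF B] orthant_bodyD(2)[OF B'] b by (auto simp: pos_orthant_def)
    consider i where "a $ i < b $ i" | i where "a' $ i < b' $ i"
      | "\<And>i. b $ i \<le> a $ i" "\<And>i. b' $ i \<le> a' $ i"
      by (meson not_le)
    then show "x \<in> (B \<inter> cbox 0 a) + (B' \<inter> cbox 0 a')"
    proof cases
      case 1
      then show ?thesis unfolding x by (intro truncation_split[OF B B' b le])
    next
      case 2
      have "b' + b \<in> (B' \<inter> cbox 0 a') + (B \<inter> cbox 0 a)"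
        by (rule truncation_split[OF B' B b(2,1) _ 2]) (use le in \<open>simp add: add.commute\<close>)
      then show ?thesis by (simp add: x add.commute)
    next
      case 3
      then show ?thesis unfolding x using b nn by (intro set_plus_intro) (auto simp: mem_box_cart)
    qed
  qed
qed

lemma orthant_body_sum:
  assumes "finite I" "I \<noteq> {}" "\<And>i. orthant_body (a i) (B i)"
  shows "orthant_body (\<Sum>i\<in>I. a i) (\<Sum>i\<in>I. B i) \<and>
    (\<Sum>i\<in>I. B i \<inter> cbox 0 (a i)) = (\<Sum>i\<in>I. B i) \<inter> cbox 0 (\<Sum>i\<in>I. a i)"
  using assms(1,2)
proof (induction I rule: finite_ne_induct)
  case (insert i I)
  then show ?case
    using orthant_body_plus[OF assms(3), of "\<Sum>i\<in>I. a i" "\<Sum>i\<in>I. B i" i]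
      truncation_plus[OF assms(3), of "\<Sum>i\<in>I. a i" "\<Sum>i\<in>I. B i" i]
    by simp
qed (use assms(3) in simp)

section \<open>Mixed volumes of boxes\<close>

lemma cbox_0_plus:
  fixes a b :: "real ^ 'n::finite"
  assumes "\<And>j. 0 \<le> a $ j" "\<And>j. 0 \<le> b $ j"
  shows "cbox 0 a + cbox 0 b = cbox 0 (a + b)"
proof (rule antisym)
  show "cbox 0 a + cbox 0 b \<subseteq> cbox 0 (a + b)"
    by (auto simp: set_plus_def mem_box_cart intro!: add_mono)
  show "cbox 0 (a + b) \<subseteq> cbox 0 a + cbox 0 b"
  proof
    fix x assume x: "x \<in> cbox 0 (a + b)"
    define y where "y = (\<chi> j. min (x $ j) (a $ j))"
    have "y \<in> cbox 0 a" "x - y \<in> cbox 0 b"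
      using x assms by (auto simp: mem_box_cart y_def min_def) (metis add.commute diff_le_eq)
    then have "y + (x - y) \<in> cbox 0 a + cbox 0 b" by (rule set_plus_intro)
    then show "x \<in> cbox 0 a + cbox 0 b" by simp
  qed
qed

lemma cbox_0_sum:
  fixes a :: "'i \<Rightarrow> real ^ 'n::finite"
  assumes "\<And>i j. 0 \<le> a i $ j"
  shows "(\<Sum>i\<in>I. cbox 0 (a i)) = cbox 0 (\<Sum>i\<in>I. a i)"
proof (induction I rule: infinite_finite_induct)
  case (insert i I)
  then show ?case by (simp add: cbox_0_plus assms sum_component sum_nonneg)
qed (auto simp: set_zero)

lemma sum_singletons: "(\<Sum>i\<in>I. {t i}) = {\<Sum>i\<in>I. t i}"
  by (induction I rule: infinite_finite_induct) (auto simp: set_zero set_plus_def)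

text \<open>The volume of a sum of boxes is a product of summed edge lengths, whose polarization is
  the permanent of the edge lengths; translations do not matter.\<close>

lemma mixed_vol_translated_boxes:
  fixes a t :: "'n::finite \<Rightarrow> real ^ 'n"
  assumes a: "\<And>i j. 0 \<le> a i $ j"
  shows "mixed_vol (\<lambda>i. (+) (t i) ` cbox 0 (a i)) = (\<Sum>p\<in>{p. bij p}. \<Prod>j\<in>UNIV. a (p j) $ j)"
proof -
  have "(\<Sum>i\<in>I. (+) (t i) ` cbox 0 (a i)) = (+) (\<Sum>i\<in>I. t i) ` cbox 0 (\<Sum>i\<in>I. a i)" for I
    by (simp only: translation_eq_singleton_plus sum.distrib sum_singletons cbox_0_sum[OF a])
  moreover have "measure lebesgue (cbox 0 (\<Sum>i\<in>I. a i)) = (\<Prod>j\<in>UNIV. \<Sum>i\<in>I. a i $ j)" for I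
  proof -
    have "cbox 0 (\<Sum>i\<in>I. a i) \<noteq> {}"
      by (simp add: interval_ne_empty_cart sum_component sum_nonneg a)
    then show ?thesis by (simp add: content_cbox_cart sum_component)
  qed
  ultimately show ?thesis
    by (simp only: mixed_vol_def measure_translation alt_sum_prod_sum)
qed

lemma mixed_vol_boxes:
  fixes a :: "'n::finite \<Rightarrow> real ^ 'n"
  assumes "\<And>i j. 0 \<le> a i $ j"
  shows "mixed_vol (\<lambda>i. cbox 0 (a i)) = (\<Sum>p\<in>{p. bij p}. \<Prod>j\<in>UNIV. a (p j) $ j)"
  using mixed_vol_translated_boxes[OF assms, of "\<lambda>_. 0"] by simp

section \<open>Relative mixed volumes as differences of mixed volumes\<close>

lemma rel_mixed_volume_alt_sum:
  "rel_mixed_volume C B = alt_sum (\<lambda>I. measure lebesgue (C - rel_minkowski_sum C B I))"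
  by (simp add: rel_mixed_volume_def alt_sum_def rel_volume_def sum_divide_distrib)

text \<open>The complement of a Minkowski sum in the orthant is the summed box minus the truncated
  sum, and polarization is linear.\<close>

lemma rel_mixed_volume_truncation:
  fixes B :: "'n::finite \<Rightarrow> (real ^ 'n) set"
  assumes B: "\<And>i. orthant_body (a i) (B i)"
  shows "rel_mixed_volume pos_orthant B
    = mixed_vol (\<lambda>i. cbox 0 (a i)) - mixed_vol (\<lambda>i. B i \<inter> cbox 0 (a i))"
  unfolding rel_mixed_volume_alt_sum mixed_vol_def alt_sum_diff[symmetric]
proof (rule arg_cong[of _ _ alt_sum], rule ext)
  fix I :: "'n set"
  show "measure lebesgue (pos_orthant - rel_minkowski_sum pos_orthant B I)
    = measure lebesgue (\<Sum>i\<in>I. cbox 0 (a i)) - measure lebesgue (\<Sum>i\<in>I. B i \<inter> cbox 0 (a i))"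
  \<comment> \<open>For the empty set the left side is the volume of \<open>C - C\<close>, and on
    the right the two empty sums are the same singleton and cancel.\<close>
  proof (cases "I = {}")
    case False
    let ?S = "\<Sum>i\<in>I. B i" and ?a = "\<Sum>i\<in>I. a i"
    have S: "orthant_body ?a ?S" and Q: "(\<Sum>i\<in>I. B i \<inter> cbox 0 (a i)) = ?S \<inter> cbox 0 ?a"
      using orthant_body_sum[OF finite False B] by auto
    have "pos_orthant - ?S = cbox 0 ?a - (?S \<inter> cbox 0 ?a)"
      using orthant_bodyD(2)[OF S] orthant_bodyD(4)[OF S]
      by (auto simp: mem_box_cart pos_orthant_def) (meson linear)
    moreover have "?S \<inter> cbox 0 ?a \<in> lmeasurable"
      by (intro measurable_convex convex_Int orthant_bodyD(1)[OF S] convex_box bounded_Int) auto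
    moreover have "(\<Sum>i\<in>I. cbox 0 (a i)) = cbox 0 ?a"
      by (rule cbox_0_sum) (simp add: less_imp_le orthant_bodyD(3)[OF B])
    ultimately show ?thesis
      using False Q by (simp add: rel_minkowski_sum_def measurable_measure_Diff fmeasurableD)
  qed (simp add: rel_minkowski_sum_def)
qed

lemma mixed_vol_mono_polytopes:
  fixes P Q :: "'n::finite \<Rightarrow> (real ^ 'n) set"
  assumes "\<And>i. polytope (P i)" "\<And>i. P i \<noteq> {}" "\<And>i. polytope (Q i)" "\<And>i. P i \<subseteq> Q i"
  shows "mixed_vol P \<le> mixed_vol Q"
proof -
  obtain A where A: "\<And>i. finite (A i)" "\<And>i. P i = convex hull (A i)"
    using assms(1) unfolding polytope_def by metis
  obtain A' where A': "\<And>i. finite (A' i)" "\<And>i. Q i = convex hull (A' i)"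
    using assms(3) unfolding polytope_def by metis
  have "mixed_vol (\<lambda>i. convex hull (A i)) \<le> mixed_vol (\<lambda>i. convex hull (A' i))"
    by (rule mixed_vol_mono) (use A A' assms in auto)
  then show ?thesis by (simp add: A(2)[symmetric] A'(2)[symmetric])
qed

text \<open>With common boxes, larger bodies have larger truncations, and the mixed volume of the
  truncations is subtracted.\<close>

lemma rel_mixed_volume_antimono:
  fixes B B' :: "'n::finite \<Rightarrow> (real ^ 'n) set"
  assumes B: "\<And>i. orthant_body (a i) (B i)" "\<And>i. polytope (B i \<inter> cbox 0 (a i))"
    and B': "\<And>i. orthant_body (a i) (B' i)" "\<And>i. polytope (B' i \<inter> cbox 0 (a i))"
    and sub: "\<And>i. B i \<subseteq> B' i"
  shows "rel_mixed_volume pos_orthant B' \<le> rel_mixed_volume pos_orthant B"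
proof -
  have "B i \<inter> cbox 0 (a i) \<noteq> {}" for i
  proof -
    have "0 < a i $ j" for j by (rule orthant_bodyD(3)[OF B(1)])
    then have "a i \<in> B i \<inter> cbox 0 (a i)"
      using orthant_bodyD(4)[OF B(1), of "a i" i undefined] by (auto simp: pos_orthant_def mem_box_cart less_imp_le)
    then show ?thesis by blast
  qed
  then have "mixed_vol (\<lambda>i. B i \<inter> cbox 0 (a i)) \<le> mixed_vol (\<lambda>i. B' i \<inter> cbox 0 (a i))"
    by (intro mixed_vol_mono_polytopes B(2) B'(2) Int_mono sub subset_refl)
  then show ?thesis
    using rel_mixed_volume_truncation[OF B(1)] rel_mixed_volume_truncation[OF B'(1)] by simp
qed

lemma orthant_body_hull_insert:
  assumes B: "orthant_body a B" and d: "\<delta> \<in> pos_orthant"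
  shows "orthant_body a (convex hull (B \<union> {\<delta>}))"
  unfolding orthant_body_def
proof (intro conjI allI ballI impI)
  show "convex hull (B \<union> {\<delta>}) \<subseteq> pos_orthant"
    using orthant_bodyD(2)[OF B] d by (intro hull_minimal convex_pos_orthant) auto
  show "x \<in> convex hull (B \<union> {\<delta>})" if "x \<in> pos_orthant" "a $ j \<le> x $ j" for x j
    using orthant_bodyD(4)[OF B that] by (intro hull_inc) simp
qed (use orthant_bodyD(3)[OF B] in auto)

text \<open>Truncating the hull gives the hull of the truncation and \<open>\<delta>\<close>: a
  segment from \<open>\<delta>\<close> to a point of \<open>B\<close> beyond the box leaves the box
  at a point that already belongs to \<open>B\<close>.\<close>

lemma polytope_hull_insert_truncation:
  assumes B: "orthant_body a B" "polytope (B \<inter> cbox 0 a)" and d: "\<delta> \<in> pos_orthant" "\<delta> \<notin> B"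
  shows "polytope (convex hull (B \<union> {\<delta>}) \<inter> cbox 0 a)"
proof -
  have pos: "0 < a $ j" for j by (rule orthant_bodyD(3)[OF B(1)])
  have da: "\<delta> $ j < a $ j" for j
    using orthant_bodyD(4)[OF B(1) d(1), of j] d(2) by (meson not_le)
  have d0: "0 \<le> \<delta> $ j" for j using d(1) by (simp add: pos_orthant_def)
  let ?H = "convex hull ((B \<inter> cbox 0 a) \<union> {\<delta>})"
  have ne: "B \<noteq> {}"
    using orthant_bodyD(4)[OF B(1), of a undefined] pos by (auto simp: pos_orthant_def less_imp_le)
  have dH: "\<delta> \<in> ?H" by (intro hull_inc) simp
  have "x \<in> ?H" if x: "x \<in> convex hull (B \<union> {\<delta>})" "x \<in> cbox 0 a" for x
  proof -
    have hB: "convex hull B = B" using orthant_bodyD(1)[OF B(1)] by (simp add: hull_same)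
    have "x \<in> convex hull (insert \<delta> B)" using x(1) by simp
    then obtain u v b where uv: "0 \<le> u" "0 \<le> v" "u + v = 1" and b: "b \<in> B" and xe: "x = u *\<^sub>R \<delta> + v *\<^sub>R b"
      unfolding convex_hull_insert[OF ne] hB by blast
    have b0: "0 \<le> b $ j" for j using b orthant_bodyD(2)[OF B(1)] by (auto simp: pos_orthant_def)
    have xj: "x $ j = \<delta> $ j + v * (b $ j - \<delta> $ j)" for j
    proof -
      have u: "u = 1 - v" using uv(3) by simp
      show ?thesis unfolding xe u by (simp add: algebra_simps)
    qed
    show ?thesis
    proof (cases "\<forall>j. b $ j \<le> a $ j")
      case True
      then have "b \<in> ?H" using b b0 by (intro hull_inc) (auto simp: mem_box_cart)
      then show ?thesis unfolding xe using uv dH by (intro convexD convex_convex_hull)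
    next
      case False
      let ?J = "{j. a $ j < b $ j}"
      \<comment> \<open>The parameter at which the segment meets the face where coordinate
        \<open>j\<close> equals \<open>a $ j\<close>; the smallest one is where it leaves the
        box.\<close>
      define r where "r j = (a $ j - \<delta> $ j) / (b $ j - \<delta> $ j)" for j
      have J: "finite ?J" "?J \<noteq> {}" using False by (auto simp: not_le)
      obtain i where i: "i \<in> ?J" "\<And>j. j \<in> ?J \<Longrightarrow> r i \<le> r j"
        using arg_min_if_finite(1)[OF J, of r] arg_min_least[OF J] by blast
      define t where "t = r i"
      have bd: "0 < b $ i - \<delta> $ i" using i(1) da[of i] by simp
      have t: "0 < t" "t \<le> 1" "\<delta> $ i + t * (b $ i - \<delta> $ i) = a $ i"
        using i(1) da[of i] bd by (auto simp: t_def r_def field_simps)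
      define y where "y = (1 - t) *\<^sub>R \<delta> + t *\<^sub>R b"
      have yj: "y $ j = \<delta> $ j + t * (b $ j - \<delta> $ j)" for j by (simp add: y_def algebra_simps)
      have y0: "0 \<le> y $ j" for j
        using t d0[of j] b0[of j] by (simp add: y_def)
      have "y $ j \<le> a $ j" for j
      proof (cases "j \<in> ?J")
        case True
        then have "t \<le> r j" "0 < b $ j - \<delta> $ j" using i(2) da[of j] by (auto simp: t_def)
        then show ?thesis by (simp add: yj r_def field_simps)
      next
        case False
        have "y $ j \<le> (1 - t) * a $ j + t * a $ j"
          unfolding y_def using False t da[of j] by (simp add: add_mono mult_left_mono less_imp_le)
        then show ?thesis by (simp add: algebra_simps)
      qed
      moreover have "y \<in> B"
        by (rule orthant_bodyD(4)[OF B(1), of _ i]) (use y0 t in \<open>auto simp: pos_orthant_def yj\<close>)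
      ultimately have yH: "y \<in> ?H" using y0 by (intro hull_inc) (auto simp: mem_box_cart)
      have "x $ i \<le> a $ i" using x(2) by (simp add: mem_box_cart)
      then have "v * (b $ i - \<delta> $ i) \<le> t * (b $ i - \<delta> $ i)" using t(3) xj[of i] by linarith
      then have vt: "v \<le> t" using bd by simp
      have "x = (1 - v / t) *\<^sub>R \<delta> + (v / t) *\<^sub>R y"
        using t(1) by (simp add: vec_eq_iff xj yj field_simps)
      also have "\<dots> \<in> ?H"
        using vt uv t by (intro convexD convex_convex_hull dH yH) auto
      finally show ?thesis .
    qed
  qed
  moreover have "?H \<subseteq> convex hull (B \<union> {\<delta>}) \<inter> cbox 0 a"
  proof (intro Int_greatest hull_mono hull_minimal convex_box)
    show "B \<inter> cbox 0 a \<union> {\<delta>} \<subseteq> cbox 0 a"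
      using d0 da by (auto simp: mem_box_cart less_imp_le)
  qed auto
  ultimately have eq: "convex hull (B \<union> {\<delta>}) \<inter> cbox 0 a = ?H" by blast
  obtain A where A: "finite A" "B \<inter> cbox 0 a = convex hull A"
    using B(2) unfolding polytope_def by blast
  have "?H = convex hull (A \<union> {\<delta>})"
    unfolding A(2) by (metis hull_Un_left)
  then show ?thesis unfolding eq polytope_def using A(1) by (metis finite.emptyI finite_UnI finite_insert)
qed

text \<open>An upward closed body containing the origin is the whole orthant. It is neutral for
  Minkowski sums, so the terms with and without \<open>i\<close> cancel.\<close>

lemma rel_mixed_volume_orthant:
  fixes B :: "'n::finite \<Rightarrow> (real ^ 'n) set"
  assumes B: "\<And>i. orthant_body (a i) (B i)" and i: "0 \<in> B i"
  shows "rel_mixed_volume pos_orthant B = 0"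
proof -
  have C: "B i = pos_orthant"
    using orthant_body_upward[OF B i] orthant_bodyD(2)[OF B, of i] by (auto simp: pos_orthant_def)
  show ?thesis
    unfolding rel_mixed_volume_alt_sum
  proof (rule alt_sum_cancel)
    fix I assume I: "i \<notin> I"
    show "measure lebesgue (pos_orthant - rel_minkowski_sum pos_orthant B (insert i I))
      = measure lebesgue (pos_orthant - rel_minkowski_sum pos_orthant B I)"
    proof (cases "I = {}")
      case False
      have S: "orthant_body (\<Sum>i\<in>I. a i) (\<Sum>i\<in>I. B i)"
        using orthant_body_sum[OF finite False B] by auto
      have "pos_orthant + (\<Sum>i\<in>I. B i) = (\<Sum>i\<in>I. B i)"
      proof (rule antisym)
        show "pos_orthant + (\<Sum>i\<in>I. B i) \<subseteq> (\<Sum>i\<in>I. B i)"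
        proof
          fix x assume "x \<in> pos_orthant + (\<Sum>i\<in>I. B i)"
          then obtain c s where "c \<in> pos_orthant" "s \<in> (\<Sum>i\<in>I. B i)" "x = c + s"
            by (auto simp: set_plus_def)
          then show "x \<in> (\<Sum>i\<in>I. B i)"
            using orthant_body_up[OF S, of s c] by (simp add: add.commute)
        qed
        show "(\<Sum>i\<in>I. B i) \<subseteq> pos_orthant + (\<Sum>i\<in>I. B i)"
          using set_plus_intro[of 0 pos_orthant] by (force simp: pos_orthant_def)
      qed
      then show ?thesis using I False by (simp add: rel_minkowski_sum_def C)
    qed (simp add: rel_minkowski_sum_def C)
  qed
qed

lemma rel_mixed_volume_permute:
  fixes B :: "'n::finite \<Rightarrow> (real ^ 'n) set"
  assumes p: "bij p"
  shows "rel_mixed_volume C (\<lambda>i. B (p i)) = rel_mixed_volume C B"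
proof -
  have inj: "inj p" using p by (rule bij_is_inj)
  have "(\<Sum>i\<in>I. B (p i)) = (\<Sum>i\<in>p ` I. B i)" for I
    by (subst sum.reindex) (auto intro: inj_on_subset[OF inj])
  then have "rel_minkowski_sum C (\<lambda>i. B (p i)) I = rel_minkowski_sum C B (p ` I)" for I
    by (simp add: rel_minkowski_sum_def)
  moreover have "card (p ` I) = card I" for I
    by (rule card_image) (rule inj_on_subset[OF inj], simp)
  moreover have "bij_betw ((`) p) (Pow UNIV) (Pow UNIV)"
    by (rule bij_betw_Pow[OF p])
  ultimately show ?thesis
    unfolding rel_mixed_volume_alt_sum alt_sum_def
    using sum.reindex_bij_betw[of "(`) p" "Pow UNIV" "Pow UNIV"
        "\<lambda>I. (-1) ^ (CARD('n) - card I) * measure lebesgue (C - rel_minkowski_sum C B I)"] by simp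
qed

section \<open>Two estimates of the relative mixed volume\<close>

text \<open>For \<open>c > 0\<close> this is the dilate of \<open>truncated_orthant w\<close> by
  \<open>c\<close>; with \<open>w\<close> fixed, these sets are closed under Minkowski sums.\<close>

definition slab :: "('n::finite \<Rightarrow> real) \<Rightarrow> real \<Rightarrow> (real ^ 'n) set" where
  "slab w c = {x \<in> pos_orthant. c \<le> (\<Sum>j\<in>UNIV. x $ j / w j)}"

lemma truncated_orthant_slab: "truncated_orthant w = slab w 1"
  by (simp add: truncated_orthant_def slab_def)

lemma slab_halfspace: "slab w c = pos_orthant \<inter> {x. (\<chi> j. 1 / w j) \<bullet> x \<ge> c}"
  by (auto simp: slab_def inner_vec_def)

lemma convex_slab: "convex (slab w c)"
  unfolding slab_halfspace by (intro convex_Int convex_pos_orthant convex_halfspace_ge)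

lemma slab_subset: "slab w c \<subseteq> pos_orthant"
  by (auto simp: slab_def)

lemma slab_plus:
  fixes w :: "'n::finite \<Rightarrow> real"
  assumes "0 < c" "0 < d"
  shows "slab w c + slab w d = slab w (c + d)"
proof (rule antisym)
  show "slab w c + slab w d \<subseteq> slab w (c + d)"
    by (auto simp: set_plus_def slab_def pos_orthant_add add_divide_distrib sum.distrib)
  show "slab w (c + d) \<subseteq> slab w c + slab w d"
  proof
    fix x assume x: "x \<in> slab w (c + d)"
    have "(e / (c + d)) *\<^sub>R x \<in> slab w e" if "0 < e" for e
    proof -
      have "e / (c + d) * (c + d) \<le> e / (c + d) * (\<Sum>j\<in>UNIV. x $ j / w j)"
        using x assms that by (intro mult_left_mono) (auto simp: slab_def)
      then show ?thesis
        using x assms that by (simp add: slab_def pos_orthant_scaleR sum_distrib_left)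
    qed
    then have "(c / (c + d)) *\<^sub>R x + (d / (c + d)) *\<^sub>R x \<in> slab w c + slab w d"
      using assms by (intro set_plus_intro) auto
    then show "x \<in> slab w c + slab w d"
      unfolding scaleR_add_left[symmetric] add_divide_distrib[symmetric] using assms by simp
  qed
qed

lemma slab_sum:
  assumes "finite I" "I \<noteq> {}" "\<And>i. 0 < c i"
  shows "(\<Sum>i\<in>I. slab w (c i)) = slab w (\<Sum>i\<in>I. c i)"
  using assms(1,2) by (induction I rule: finite_ne_induct) (auto simp: slab_plus assms(3) sum_pos)

text \<open>The standard simplex, stretched by \<open>c * w j\<close> in each coordinate, differs
  from the region below the slab only within a hyperplane.\<close>

lemma measure_below_slab:
  fixes w :: "'n::finite \<Rightarrow> real"
  assumes w: "\<And>j. 0 < w j" and c: "0 < c"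
  shows "measure lebesgue (pos_orthant - slab w c) = c ^ CARD('n) * (\<Prod>j\<in>UNIV. w j) / fact CARD('n)"
proof -
  let ?S = "convex hull (insert 0 Basis) :: (real ^ 'n) set"
  let ?f = "\<lambda>x :: real ^ 'n. \<chi> j. (c * w j) * x $ j"
  have Basis: "Basis = range (\<lambda>j :: 'n. axis j (1 :: real))" by (auto simp: Basis_vec_def)
  have inj: "inj (\<lambda>j :: 'n. axis j (1 :: real))" by (auto simp: inj_on_def axis_eq_axis)
  have S: "?S = {x. (\<forall>j. 0 \<le> x $ j) \<and> (\<Sum>j\<in>UNIV. x $ j) \<le> 1}"
    unfolding std_simplex by (simp add: Basis sum.reindex[OF inj] inner_axis)
  have compS: "compact ?S" by (intro finite_imp_compact_convex_hull) simp
  then have Slm: "?S \<in> lmeasurable" by (rule lmeasurable_compact)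
  have "measure lebesgue ?S = measure lborel ?S"
    using compS by (intro measure_completion) (simp add: compact_imp_closed)
  then have mS: "measure lebesgue ?S = 1 / fact CARD('n)"
    using content_std_simplex[where 'a="real ^ 'n"] by simp
  let ?T = "{x \<in> pos_orthant. (\<Sum>j\<in>UNIV. x $ j / w j) \<le> c}"
  have img: "?f ` ?S = ?T"
  proof (rule antisym)
    show "?f ` ?S \<subseteq> ?T"
      unfolding S using w c
      by (auto simp: pos_orthant_def less_imp_le sum_distrib_left[symmetric] mult.assoc
          less_imp_neq[OF w, THEN not_sym] intro!: mult_nonneg_nonneg)
    show "?T \<subseteq> ?f ` ?S"
    proof
      fix x assume x: "x \<in> ?T"
      let ?y = "\<chi> j. x $ j / w j / c"
      have fy: "?f ?y = x" using w c by (simp add: vec_eq_iff less_imp_neq[OF w, THEN not_sym])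
      moreover have "?y \<in> ?S"
      proof -
        have "(\<Sum>j\<in>UNIV. x $ j / w j / c) \<le> 1"
          unfolding sum_divide_distrib[symmetric] using x c by simp
        moreover have "0 \<le> x $ j / w j / c" for j
          using x w[of j] c by (simp add: pos_orthant_def)
        ultimately show ?thesis
          unfolding S mem_Collect_eq vec_lambda_beta by (intro conjI allI)
      qed
      ultimately show "x \<in> ?f ` ?S" using image_eqI[of x ?f ?y ?S] by (simp only: simp_thms)
    qed
  qed
  have Tlm: "?T \<in> lmeasurable"
    using measurable_stretch[OF Slm, of "\<lambda>j. c * w j"] unfolding img .
  have "measure lebesgue ?T = \<bar>\<Prod>j\<in>UNIV. c * w j\<bar> * (1 / fact CARD('n))"
    using measure_stretch[OF Slm, of "\<lambda>j. c * w j"] unfolding img mS .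
  also have "\<dots> = c ^ CARD('n) * (\<Prod>j\<in>UNIV. w j) / fact CARD('n)"
    using w c by (simp add: prod.distrib abs_mult less_imp_le prod_nonneg)
  finally have mT: "measure lebesgue ?T = c ^ CARD('n) * (\<Prod>j\<in>UNIV. w j) / fact CARD('n)" .
  have "measure lebesgue (pos_orthant - slab w c) = measure lebesgue ?T"
  proof (rule measure_negligible_symdiff[OF Tlm])
    let ?H = "{x. (\<chi> j. 1 / w j) \<bullet> x = c}"
    have "negligible ?H" by (rule negligible_hyperplane) (use c in auto)
    moreover have "(?T - (pos_orthant - slab w c)) \<union> ((pos_orthant - slab w c) - ?T) \<subseteq> ?H"
      by (auto simp: slab_def inner_vec_def)
    ultimately show "negligible ((?T - (pos_orthant - slab w c)) \<union> ((pos_orthant - slab w c) - ?T))"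
      by (rule negligible_subset)
  qed
  then show ?thesis using mT by simp
qed

lemma card_bij_UNIV: "card {p :: 'n::finite \<Rightarrow> 'n. bij p} = fact CARD('n)"
proof -
  have "{p :: 'n \<Rightarrow> 'n. bij p} = {p. p permutes UNIV}"
    by (auto simp: permutes_bij intro: bij_imp_permutes)
  then show ?thesis by (simp add: card_permutes_UNIV)
qed

text \<open>The volume below a sum of slabs is a constant times the power \<open>CARD('n)\<close> of
  the sum of the \<open>c i\<close>. Its polarization is a permanent in which all \<open>n!\<close>
  terms are equal.\<close>

lemma rel_mixed_volume_slabs:
  fixes w c :: "'n::finite \<Rightarrow> real"
  assumes w: "\<And>j. 0 < w j" and c: "\<And>i. 0 < c i"
  shows "rel_mixed_volume pos_orthant (\<lambda>i. slab w (c i)) = (\<Prod>i\<in>UNIV. c i) * (\<Prod>j\<in>UNIV. w j)"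
proof -
  let ?W = "(\<Prod>j\<in>UNIV. w j) / fact CARD('n)"
  have "measure lebesgue (pos_orthant - rel_minkowski_sum pos_orthant (\<lambda>i. slab w (c i)) I)
      = ?W * (\<Prod>j\<in>(UNIV::'n set). \<Sum>i\<in>I. c i)" for I
  proof (cases "I = {}")
    case True
    then show ?thesis by (simp add: rel_minkowski_sum_def)
  next
    case False
    then have "0 < sum c I" by (intro sum_pos c) auto
    then show ?thesis
      using False by (simp add: rel_minkowski_sum_def slab_sum c measure_below_slab w)
  qed
  then have "rel_mixed_volume pos_orthant (\<lambda>i. slab w (c i))
      = ?W * (\<Sum>p\<in>{p :: 'n \<Rightarrow> 'n. bij p}. \<Prod>j\<in>UNIV. c (p j))"
    by (simp only: rel_mixed_volume_alt_sum alt_sum_cmult alt_sum_prod_sum)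
  also have "(\<Sum>p\<in>{p :: 'n \<Rightarrow> 'n. bij p}. \<Prod>j\<in>UNIV. c (p j)) = (\<Sum>p\<in>{p :: 'n \<Rightarrow> 'n. bij p}. \<Prod>j\<in>UNIV. c j)"
    by (rule sum.cong[OF refl]) (simp add: prod.reindex_bij_betw)
  finally show ?thesis by (simp add: card_bij_UNIV)
qed

lemma polytope_slab_truncation: "polytope (slab w c \<inter> cbox 0 a)"
proof -
  have "slab w c \<inter> cbox 0 a = cbox 0 a \<inter> {x. (\<chi> j. 1 / w j) \<bullet> x \<ge> c}"
    by (auto simp: slab_halfspace pos_orthant_def mem_box_cart)
  then show ?thesis
    by (simp add: polytope_Int_polyhedron polytope_interval polyhedron_halfspace_ge)
qed

text \<open>The lower estimate: enlarging each body to its slab can only decrease the relative mixed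
  volume, and slabs have an explicit one.\<close>

lemma prod_le_rel_mixed_volume:
  fixes B :: "'n::finite \<Rightarrow> (real ^ 'n) set"
  assumes B: "\<And>i. orthant_body (a i) (B i)" "\<And>i. polytope (B i \<inter> cbox 0 (a i))"
    and w: "\<And>j. 0 < w j" and c: "\<And>i. 0 < c i" and sub: "\<And>i. B i \<subseteq> slab w (c i)"
  shows "(\<Prod>i\<in>UNIV. c i) * (\<Prod>j\<in>UNIV. w j) \<le> rel_mixed_volume pos_orthant B"
proof -
  have "orthant_body (a i) (slab w (c i))" for i
    unfolding orthant_body_def
    by (intro conjI allI ballI impI convex_slab slab_subset orthant_bodyD(3)[OF B(1)]
        subsetD[OF sub orthant_bodyD(4)[OF B(1)]])
  from rel_mixed_volume_antimono[OF B this polytope_slab_truncation sub]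
  show ?thesis by (simp add: rel_mixed_volume_slabs w c)
qed

section \<open>The upper estimate: simplices on the axes and vertices of boxes\<close>

lemma orthant_body_enlarge:
  assumes B: "orthant_body a B" and le: "\<And>j. a $ j \<le> b $ j"
  shows "orthant_body b B"
  using B le unfolding orthant_body_def by (meson order_less_le_trans order_trans)

text \<open>Dividing a point of the slab by its height, which is at least 1, gives a convex
  combination of the given axis points; \<open>B\<close> is upward closed.\<close>

lemma slab_subset_body:
  fixes w :: "'n::finite \<Rightarrow> real"
  assumes B: "orthant_body a B" and w: "\<And>j. 0 < w j" and v: "\<And>j. axis j (w j) \<in> B"
  shows "slab w 1 \<subseteq> B"
proof
  fix x assume x: "x \<in> slab w 1"
  let ?T = "\<Sum>j\<in>UNIV. x $ j / w j"
  have T: "1 \<le> ?T" and x0: "\<And>j. 0 \<le> x $ j" using x by (auto simp: slab_def pos_orthant_def)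
  let ?y = "\<Sum>j\<in>UNIV. (x $ j / w j / ?T) *\<^sub>R axis j (w j)"
  have y: "?y \<in> B"
  proof (rule convex_sum[OF finite orthant_bodyD(1)[OF B]])
    show "(\<Sum>j\<in>UNIV. x $ j / w j / ?T) = 1"
      unfolding sum_divide_distrib[symmetric] using T by simp
    show "0 \<le> x $ j / w j / ?T" for j using x0[of j] w[of j] T by simp
  qed (rule v)
  have "?y $ j = x $ j / ?T" for j
  proof -
    have "?y $ j = (\<Sum>i\<in>UNIV. if i = j then x $ j / ?T else 0)"
      unfolding sum_component
      by (rule sum.cong) (use w in \<open>auto simp: axis_def less_imp_neq[OF w, THEN not_sym]\<close>)
    then show ?thesis by simp
  qed
  moreover have "x $ j / ?T \<le> x $ j" for j using T x0[of j] by (simp add: divide_le_eq mult_le_cancel_left1)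
  ultimately show "x \<in> B" by (intro orthant_body_upward[OF B y]) simp
qed

text \<open>The vertices of \<open>cbox 0 b\<close> indexed by sets of coordinates; the empty set
  gives the origin.\<close>

definition subset_vertex :: "real ^ 'n::finite \<Rightarrow> 'n set \<Rightarrow> real ^ 'n" where
  "subset_vertex b S = (\<chi> j. if j \<in> S then b $ j else 0)"

lemma subset_vertex_inner: "subset_vertex b S \<bullet> x = (\<Sum>j\<in>S. b $ j * x $ j)"
  unfolding subset_vertex_def inner_vec_def
  by (simp add: if_distrib[of "\<lambda>t. t * _"] sum.If_cases cong: if_cong)

text \<open>An edge of a box is a translated degenerate box, so the formula for boxes also evaluates
  mixed cells made of edges.\<close>

lemma segment_box:
  assumes q: "q \<notin> S" and b: "0 < b $ q"
  shows "convex hull {subset_vertex b S, subset_vertex b (insert q S)}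
    = (+) (subset_vertex b S) ` cbox 0 (axis q (b $ q))"
proof -
  let ?v = "subset_vertex b S"
  have v: "subset_vertex b (insert q S) = ?v + axis q (b $ q)"
    using q by (auto simp: subset_vertex_def axis_def vec_eq_iff)
  have box: "cbox 0 (axis q (b $ q)) = (\<lambda>u. u *\<^sub>R axis q (b $ q)) ` {0..1}"
  proof (rule antisym)
    show "cbox 0 (axis q (b $ q)) \<subseteq> (\<lambda>u. u *\<^sub>R axis q (b $ q)) ` {0..1}"
    proof
      fix x assume x: "x \<in> cbox 0 (axis q (b $ q))"
      have "x $ j = 0" if "j \<noteq> q" for j
        using x that by (intro antisym) (auto simp: mem_box_cart axis_def dest: spec[of _ j])
      then have "x = (x $ q / b $ q) *\<^sub>R axis q (b $ q)"
        using b by (auto simp: vec_eq_iff axis_def)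
      moreover have "0 \<le> x $ q" "x $ q \<le> b $ q"
        using x unfolding mem_box_cart by (metis axis_nth zero_index)+
      then have "x $ q / b $ q \<in> {0..1}" using b by simp
      ultimately show "x \<in> (\<lambda>u. u *\<^sub>R axis q (b $ q)) ` {0..1}" by blast
    qed
    show "(\<lambda>u. u *\<^sub>R axis q (b $ q)) ` {0..1} \<subseteq> cbox 0 (axis q (b $ q))"
      using b by (auto simp: mem_box_cart axis_def mult_left_le_one_le)
  qed
  have "(1 - u) *\<^sub>R ?v + u *\<^sub>R (?v + axis q (b $ q)) = ?v + u *\<^sub>R axis q (b $ q)" for u
    by (simp add: algebra_simps)
  then show ?thesis
    unfolding v segment_convex_hull[symmetric] closed_segment_image_interval box image_image by simp
qed

section \<open>Cyclic lifting heights and the mixed subdivision of boxes\<close>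

lemma mod_diff_nat:
  fixes x y N :: nat
  assumes "x < N" "y < N"
  shows "(x + N - y) mod N = (if y \<le> x then x - y else x + N - y)"
  using assms by (auto simp: mod_if)

text \<open>On a cycle of length \<open>N\<close>: whoever starts at \<open>a\<close> and meets
  \<open>c\<close> before \<open>b\<close> will, starting at \<open>b\<close>, meet \<open>a\<close>
  before \<open>c\<close>.\<close>

lemma cyclic_distance_less:
  fixes a b c N :: nat
  assumes lt: "a < N" "b < N" and ne: "c \<noteq> a" "b \<noteq> a"
    and less: "(if a \<le> c then c - a else c + N - a) < (if a \<le> b then b - a else b + N - a)"
  shows "(if b \<le> a then a - b else a + N - b) < (if b \<le> c then c - b else c + N - b)"
proof (cases "a \<le> b")
  case True
  have "a < c"
  proof (rule ccontr)
    assume "\<not> a < c"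
    then have "c + N - a < b - a" using less ne True by simp
    then show False using lt True by linarith
  qed
  then have "c < b" using less True by simp
  then show ?thesis using \<open>a < c\<close> ne True lt by simp
next
  case False
  show ?thesis
  proof (cases "a \<le> c")
    case True
    then show ?thesis using False ne by simp
  next
    case c: False
    then have "c < b" using less False lt by simp
    then show ?thesis using False lt by simp
  qed
qed

text \<open>If \<open>p\<close> moves \<open>i\<close>, take \<open>j = i\<close>. Otherwise measure
  distances from \<open>i\<close>: \<open>p\<close> permutes them, so being different from the
  identity it lowers one of them, and \<open>cyclic_distance_less\<close> turns this round.\<close>

lemma cyclic_shift:
  fixes \<iota> :: "'n::finite \<Rightarrow> nat"
  assumes \<iota>: "inj \<iota>" "\<And>i. \<iota> i < N" and p: "bij p" "p \<noteq> id"
  shows "\<exists>j. (\<iota> i + N - \<iota> j) mod N < (\<iota> (p j) + N - \<iota> j) mod N"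
proof -
  note sub = mod_diff_nat[where N=N]
  show ?thesis
  proof (cases "p i = i")
    case False
    then have "\<iota> (p i) \<noteq> \<iota> i" using \<iota>(1) by (simp add: inj_eq)
    then have "(\<iota> i + N - \<iota> i) mod N < (\<iota> (p i) + N - \<iota> i) mod N"
      using \<iota>(2)[of i] \<iota>(2)[of "p i"] by (auto simp: sub)
    then show ?thesis ..
  next
    case True
    define pos where "pos j = (\<iota> j + N - \<iota> i) mod N" for j
    have inj_pos: "j = l" if "pos j = pos l" for j l
    proof -
      have "\<iota> j = \<iota> l"
        using that \<iota>(2)[of i] \<iota>(2)[of j] \<iota>(2)[of l] by (auto simp: pos_def sub split: if_splits)
      then show ?thesis using \<iota>(1) by (simp add: inj_eq)
    qed
    have "\<exists>j. pos (p j) < pos j"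
    proof (rule ccontr)
      assume "\<not> ?thesis"
      then have le: "pos j \<le> pos (p j)" for j by (meson not_le)
      have "(\<Sum>j\<in>UNIV. pos (p j)) = (\<Sum>j\<in>UNIV. pos j)"
        by (rule sum.reindex_bij_betw[OF p(1)])
      then have "pos (p j) = pos j" for j
        using sum_mono_inv[of pos UNIV "\<lambda>j. pos (p j)" j] le by simp
      then have "p = id" using inj_pos by (auto simp: fun_eq_iff)
      then show False using p(2) by simp
    qed
    then obtain j where j: "pos (p j) < pos j" ..
    then have "j \<noteq> i" using True by auto
    then have "p j \<noteq> i" using True p(1) by (metis bij_is_inj injD)
    then have "\<iota> (p j) \<noteq> \<iota> i" "\<iota> j \<noteq> \<iota> i" using \<iota>(1) \<open>j \<noteq> i\<close> by (auto simp: inj_eq)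
    then have "(\<iota> i + N - \<iota> j) mod N < (\<iota> (p j) + N - \<iota> j) mod N"
      using j cyclic_distance_less[OF \<iota>(2)[of i] \<iota>(2)[of j], of "\<iota> (p j)"]
      by (simp only: pos_def sub \<iota>(2) if_True simp_thms)
    then show ?thesis ..
  qed
qed

text \<open>The two sums differ by the positive entries that \<open>S\<close> omits and the negative
  ones that it contains. This identifies the vertices of a box where a linear functional is
  maximal.\<close>

lemma sum_positive_part:
  fixes f :: "'a::finite \<Rightarrow> real"
  shows "sum f S \<le> sum f {j. 0 < f j}"
    and "sum f S = sum f {j. 0 < f j} \<Longrightarrow> {j. 0 < f j} \<subseteq> S \<and> S \<subseteq> {j. 0 \<le> f j}"
proof -
  let ?P = "{j. 0 < f j}"
  have split: "sum f ?P - sum f S = sum f (?P - S) + sum (\<lambda>j. - f j) (S - ?P)"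
    by (simp add: sum_negf sum.Int_Diff[of ?P f S] sum.Int_Diff[of S f ?P] Int_commute)
  have nn: "0 \<le> sum f (?P - S)" "0 \<le> sum (\<lambda>j. - f j) (S - ?P)"
    by (auto intro!: sum_nonneg)
  show "sum f S \<le> sum f ?P" using split nn by linarith
  assume "sum f S = sum f ?P"
  then have z: "sum f (?P - S) = 0" "sum (\<lambda>j. - f j) (S - ?P) = 0" using split nn by linarith+
  have 1: "sum f (?P - S) = 0 \<longleftrightarrow> (\<forall>j\<in>?P - S. f j = 0)"
    by (rule sum_nonneg_eq_0_iff) auto
  have 2: "sum (\<lambda>j. - f j) (S - ?P) = 0 \<longleftrightarrow> (\<forall>j\<in>S - ?P. - f j = 0)"
    by (rule sum_nonneg_eq_0_iff) auto
  show "?P \<subseteq> S \<and> S \<subseteq> {j. 0 \<le> f j}"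
  proof (intro conjI subsetI CollectI)
    fix j assume j: "j \<in> ?P"
    show "j \<in> S"
    proof (rule ccontr)
      assume "j \<notin> S"
      with j have "j \<in> ?P - S" by blast
      with z(1)[unfolded 1] have "f j = 0" by (rule bspec)
      with j show False by simp
    qed
  next
    fix j assume "j \<in> S"
    show "0 \<le> f j"
    proof (rule ccontr)
      assume neg: "\<not> 0 \<le> f j"
      with \<open>j \<in> S\<close> have "j \<in> S - ?P" by simp
      with z(2)[unfolded 2] have "- f j = 0" by (rule bspec)
      with neg show False by simp
    qed
  qed
qed

text \<open>The boxes have a mixed subdivision with one cell for each permutation. The lifting heights
  \<open>(i - j) mod n\<close> are chosen so that every cell other than that of the identity avoids the vertex
  at the origin in every box, and hence survives the removal of these vertices.\<close>

lemma mixed_vol_punctured_boxes: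
  fixes b :: "'n::finite \<Rightarrow> real ^ 'n"
  assumes b: "\<And>i j. 0 < b i $ j"
  shows "(\<Sum>p\<in>{p. bij p} - {id}. \<Prod>j\<in>UNIV. b (p j) $ j)
    \<le> mixed_vol (\<lambda>i. convex hull (subset_vertex (b i) ` {S. S \<noteq> {}}))"
proof -
  obtain \<iota> :: "'n \<Rightarrow> nat" where bij: "bij_betw \<iota> UNIV {0..<CARD('n)}"
    using ex_bij_betw_finite_nat[OF finite_class.finite_UNIV] by blast
  have \<iota>: "inj \<iota>" "\<And>i. \<iota> i < CARD('n)"
    using bij_betw_imp_inj_on[OF bij] bij_betwE[OF bij] by simp_all
  define \<delta> where "\<delta> i j = (\<iota> i + CARD('n) - \<iota> j) mod CARD('n)" for i j
  have \<delta>_inj: "i = l" if "\<delta> i j = \<delta> l j" for i l j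
  proof -
    have "\<iota> i = \<iota> l"
      using that \<iota>(2)[of i] \<iota>(2)[of j] \<iota>(2)[of l] by (auto simp: \<delta>_def mod_diff_nat split: if_splits)
    then show ?thesis using \<iota>(1) by (simp add: inj_eq)
  qed
  \<comment> \<open>The centre of cell \<open>p\<close>: coordinate \<open>j\<close> is chosen so
    that box \<open>p j\<close> is indifferent to direction \<open>j\<close>.\<close>
  define x :: "('n \<Rightarrow> 'n) \<Rightarrow> nat \<Rightarrow> real ^ 'n" where "x p k = (\<chi> j. real k * real (\<delta> (p j) j))" for p k
  \<comment> \<open>At the centre of cell \<open>p\<close>, the growth rate in \<open>k\<close> of
    the log-weight of a vertex of box \<open>i\<close> when \<open>j\<close> is added to its
    set.\<close>
  define f where "f p i j = b i $ j * (real (\<delta> (p j) j) - real (\<delta> i j))" for p i j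
  define P where "P p i = {j. 0 < f p i j}" for p i
  \<comment> \<open>Weight 0 for the empty set removes the origin from every box.\<close>
  define w where "w k i S = (if S = {} then 0 else exp (- (\<Sum>j\<in>S. b i $ j * (real k * real (\<delta> i j)))))"
    for k :: nat and i S
  \<comment> \<open>Only vertices maximising the total gain survive: the positive directions, with
    or without the one direction of gain zero. They span an edge in direction
    \<open>inv p i\<close>.\<close>
  define u where "u p i S = (if S = P p i \<or> S = insert (inv p i) (P p i) then 1 else 0 :: real)" for p i S
  let ?cells = "{p :: 'n \<Rightarrow> 'n. bij p} - {id}"
  \<comment> \<open>Nonemptiness keeps the surviving edge away from the removed origin; this is
    where the identity has to be excluded.\<close>
  have P_ne: "P p i \<noteq> {}" if p: "p \<in> ?cells" for p i
  proof -
    have "\<exists>j. \<delta> i j < \<delta> (p j) j"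
      unfolding \<delta>_def by (rule cyclic_shift[OF \<iota>]) (use p in auto)
    then obtain j where "\<delta> i j < \<delta> (p j) j" ..
    then have "0 < f p i j" unfolding f_def by (intro mult_pos_pos b) simp
    then show ?thesis unfolding P_def by blast
  qed
  have f_zero: "f p i j = 0 \<longleftrightarrow> j = inv p i" if p: "bij p" for p i j
  proof -
    have "f p i j = 0 \<longleftrightarrow> \<delta> (p j) j = \<delta> i j" using b[of i j] by (simp add: f_def)
    also have "\<dots> \<longleftrightarrow> p j = i" using \<delta>_inj by blast
    also have "\<dots> \<longleftrightarrow> j = inv p i" using p by (metis bij_inv_eq_iff)
    finally show ?thesis .
  qed
  have q: "inv p i \<notin> P p i" if "bij p" for p i
    using f_zero[OF that, of i "inv p i"] by (simp add: P_def)
  \<comment> \<open>Dividing by the largest possible value leaves an exponent that is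
    \<open>k\<close> times a nonpositive deficit.\<close>
  have weight: "w k i S * exp (subset_vertex (b i) S \<bullet> x p k) / exp (real k * sum (f p i) (P p i))
      = (if S = {} then 0 else exp (real k * (sum (f p i) S - sum (f p i) (P p i))))" for k i S p
  proof -
    have "- (\<Sum>j\<in>S. b i $ j * (real k * real (\<delta> i j))) + (\<Sum>j\<in>S. b i $ j * (real k * real (\<delta> (p j) j)))
        = real k * sum (f p i) S"
      by (simp add: f_def sum_distrib_left sum_negf[symmetric] sum.distrib[symmetric] algebra_simps)
    then show ?thesis
      by (simp add: w_def subset_vertex_inner x_def exp_add[symmetric] exp_diff[symmetric] right_diff_distrib)
  qed
  have "(\<Sum>p\<in>?cells. mixed_vol (\<lambda>i. convex hull (subset_vertex (b i) ` wsupp UNIV (u p i))))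
      \<le> mixed_vol (\<lambda>i. convex hull (subset_vertex (b i) ` {S. S \<noteq> {}}))"
  proof (rule sum_mixed_vol_cells_le[where w=w and x=x and m="\<lambda>p k i. exp (real k * sum (f p i) (P p i))"])
    show "finite ?cells" by (rule finite_subset[OF subset_UNIV]) simp
    show "weights_on UNIV (w k i)" for k i
      unfolding weights_on_def w_def by (auto intro!: exI[of _ UNIV])
    show "weights_on UNIV (u p i)" for p i
      by (auto simp: weights_on_def u_def)
    have "wsupp UNIV (w k i) = {S. S \<noteq> {}}" for k i by (auto simp: w_def)
    then show "convex hull (subset_vertex (b i) ` wsupp UNIV (w k i))
        = convex hull (subset_vertex (b i) ` {S. S \<noteq> {}})" for k i by simp
    show "exp (real k * sum (f p i) (P p i)) \<noteq> 0" for k p i by simp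
  next
    fix p i and S :: "'n set" assume p: "p \<in> ?cells"
    then have bp: "bij p" by simp
    show "(\<lambda>k. w k i S * exp (subset_vertex (b i) S \<bullet> x p k) / exp (real k * sum (f p i) (P p i)))
        \<longlonglongrightarrow> u p i S"
    proof (cases "S = P p i \<or> S = insert (inv p i) (P p i)")
      case True
      then have "sum (f p i) S = sum (f p i) (P p i)"
        using q[OF bp, of i] f_zero[OF bp, of i "inv p i"] by auto
      moreover have "S \<noteq> {}" using True P_ne[OF p, of i] by auto
      ultimately show ?thesis unfolding weight using True by (simp add: u_def)
    next
      case False
      have "sum (f p i) S \<noteq> sum (f p i) (P p i)"
      proof
        assume "sum (f p i) S = sum (f p i) (P p i)"
        from sum_positive_part(2)[OF this[unfolded P_def]]
        have 1: "P p i \<subseteq> S" "S \<subseteq> {j. 0 \<le> f p i j}" by (simp_all add: P_def)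
        have "S \<subseteq> insert (inv p i) (P p i)"
        proof
          fix j assume "j \<in> S"
          with 1 have "f p i j = 0 \<or> j \<in> P p i" by (auto simp: P_def less_le)
          then show "j \<in> insert (inv p i) (P p i)" using f_zero[OF bp] by blast
        qed
        with 1 False show False by blast
      qed
      then have neg: "sum (f p i) S - sum (f p i) (P p i) < 0"
        using sum_positive_part(1)[of "f p i" S] unfolding P_def by simp
      then have "exp (sum (f p i) S - sum (f p i) (P p i)) < 1" by simp
      then have "(\<lambda>k. exp (sum (f p i) S - sum (f p i) (P p i)) ^ k) \<longlonglongrightarrow> 0"
        by (intro LIMSEQ_realpow_zero) auto
      then have lim: "(\<lambda>k. exp (real k * (sum (f p i) S - sum (f p i) (P p i)))) \<longlonglongrightarrow> 0"
        by (simp only: exp_of_nat_mult)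
      show ?thesis
      proof (cases "S = {}")
        case True
        then show ?thesis unfolding weight using False by (simp add: u_def)
      next
        case ne: False
        then show ?thesis unfolding weight using False lim by (simp add: u_def)
      qed
    qed
  next
    \<comment> \<open>Heights are integers, so centres of different permutations differ by at least
      \<open>k\<close> in some coordinate.\<close>
    fix p p' :: "'n \<Rightarrow> 'n" and k assume "p \<noteq> p'"
    then obtain j where j: "p j \<noteq> p' j" by blast
    then have "\<delta> (p j) j \<noteq> \<delta> (p' j) j" using \<delta>_inj by blast
    then have "1 \<le> \<bar>real (\<delta> (p j) j) - real (\<delta> (p' j) j)\<bar>" by linarith
    then have "real k * 1 \<le> real k * \<bar>real (\<delta> (p j) j) - real (\<delta> (p' j) j)\<bar>"
      by (intro mult_left_mono) auto
    also have "\<dots> = dist (x p k $ j) (x p' k $ j)"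
      by (simp add: x_def dist_real_def abs_mult right_diff_distrib[symmetric])
    also have "\<dots> \<le> dist (x p k) (x p' k)" by (rule dist_vec_nth_le)
    finally show "real k \<le> dist (x p k) (x p' k)" by simp
  qed
  moreover have "mixed_vol (\<lambda>i. convex hull (subset_vertex (b i) ` wsupp UNIV (u p i)))
      = (\<Prod>j\<in>UNIV. b (p j) $ j)" if p: "p \<in> ?cells" for p
  proof -
    have bp: "bij p" using p by simp
    have "wsupp UNIV (u p i) = {P p i, insert (inv p i) (P p i)}" for i
      by (auto simp: u_def split: if_splits)
    then have "mixed_vol (\<lambda>i. convex hull (subset_vertex (b i) ` wsupp UNIV (u p i)))
        = mixed_vol (\<lambda>i. (+) (subset_vertex (b i) (P p i)) ` cbox 0 (axis (inv p i) (b i $ inv p i)))"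
      using segment_box[OF q[OF bp]] b by simp
    also have "\<dots> = (\<Sum>r\<in>{r. bij r}. \<Prod>j\<in>UNIV. axis (inv p (r j)) (b (r j) $ inv p (r j)) $ j)"
      by (rule mixed_vol_translated_boxes) (simp add: axis_def less_imp_le[OF b])
    \<comment> \<open>Each edge has length in one direction only, so \<open>p\<close> is the only
      permutation with a nonzero term in the permanent.\<close>
    also have "\<dots> = (\<Sum>r\<in>{p}. \<Prod>j\<in>UNIV. axis (inv p (r j)) (b (r j) $ inv p (r j)) $ j)"
    proof (rule sum.mono_neutral_right)
      show "finite {r :: 'n \<Rightarrow> 'n. bij r}" by (rule finite_subset[OF subset_UNIV]) simp
      show "\<forall>r\<in>{r. bij r} - {p}. (\<Prod>j\<in>UNIV. axis (inv p (r j)) (b (r j) $ inv p (r j)) $ j) = 0"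
      proof
        fix r assume "r \<in> {r. bij r} - {p}"
        then obtain j where "r j \<noteq> p j" by (auto simp: fun_eq_iff)
        then have "inv p (r j) \<noteq> j" using bp by (metis bij_inv_eq_iff)
        then have "axis (inv p (r j)) (b (r j) $ inv p (r j)) $ j = 0" by (simp add: axis_def)
        then show "(\<Prod>j\<in>UNIV. axis (inv p (r j)) (b (r j) $ inv p (r j)) $ j) = 0"
          by (intro prod_zero) auto
      qed
    qed (use bp in auto)
    also have "\<dots> = (\<Prod>j\<in>UNIV. b (p j) $ j)"
      using bp by (simp add: inv_f_f bij_is_inj axis_def)
    finally show ?thesis .
  qed
  ultimately show ?thesis by simp
qed

text \<open>Shrink \<open>B i\<close> to the slab that meets axis \<open>i\<close> at 1 and the
  other axes at \<open>K\<close>. Its truncation contains all box vertices except the origin, so all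
  terms of the permanent of the boxes but the diagonal one are cancelled, and that term is
  1.\<close>

theorem rel_mixed_volume_le_1:
  fixes B :: "'n::finite \<Rightarrow> (real ^ 'n) set"
  assumes B: "\<And>i. orthant_body (a i) (B i)" "\<And>i. polyhedron (B i)" and e: "\<And>i. axis i 1 \<in> B i"
  shows "rel_mixed_volume pos_orthant B \<le> 1"
proof -
  \<comment> \<open>A common bound for all box sizes, so that \<open>axis j K\<close> lies in every
    \<open>B i\<close> and one cube truncates all bodies.\<close>
  define K where "K = Max (insert 1 (range (\<lambda>(i, j). a i $ j)))"
  have K: "1 \<le> K" "a i $ j \<le> K" for i j
  proof -
    let ?R = "range (\<lambda>(i, j). a i $ j)"
    have "a i $ j \<in> ?R" by (rule range_eqI[of _ _ "(i, j)"]) simp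
    then show "1 \<le> K" "a i $ j \<le> K" unfolding K_def by (intro Max_ge; simp)+
  qed
  define w where "w i j = (if j = i then 1 else K)" for i j :: 'n
  define b :: "'n \<Rightarrow> real ^ 'n" where "b i = (\<chi> j. w i j)" for i
  have w: "0 < w i j" for i j using K by (simp add: w_def)
  have b: "0 < b i $ j" for i j using w by (simp add: b_def)
  have vert: "axis j (w i j) \<in> B i" for i j
  proof (cases "j = i")
    case False
    show ?thesis
      by (rule orthant_bodyD(4)[OF B(1)[of i], of _ j])
         (use False K(1) K(2)[of i j] in \<open>auto simp: w_def pos_orthant_def axis_def\<close>)
  qed (use e in \<open>simp add: w_def\<close>)
  have sub: "slab (w i) 1 \<subseteq> B i" for i
    by (rule slab_subset_body[OF B(1) w vert])
  have slab_mem: "x \<in> slab (w i) 1" if "x \<in> pos_orthant" "w i j \<le> x $ j" for x i j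
  proof -
    have "1 \<le> x $ j / w i j" using that(2) w[of i j] by simp
    also have "\<dots> \<le> (\<Sum>j\<in>UNIV. x $ j / w i j)"
      by (rule member_le_sum) (use that w in \<open>auto simp: pos_orthant_def less_imp_le\<close>)
    finally show ?thesis using that by (simp add: slab_def)
  qed
  have slab_body: "orthant_body (b i) (slab (w i) 1)" for i
    unfolding orthant_body_def using b slab_mem by (auto simp: convex_slab slab_subset[THEN subsetD] b_def)
  let ?K = "\<chi> j. K"
  have "rel_mixed_volume pos_orthant B \<le> rel_mixed_volume pos_orthant (\<lambda>i. slab (w i) 1)"
  proof (rule rel_mixed_volume_antimono[where a="\<lambda>_. ?K"])
    show "orthant_body ?K (slab (w i) 1)" for i
      by (rule orthant_body_enlarge[OF slab_body]) (use K in \<open>simp add: b_def w_def\<close>)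
    show "orthant_body ?K (B i)" for i
      by (rule orthant_body_enlarge[OF B(1)]) (use K in simp)
    show "polytope (B i \<inter> cbox 0 ?K)" for i
      using polytope_Int_polyhedron[OF polytope_interval B(2)] by (simp add: Int_commute)
  qed (rule polytope_slab_truncation sub)+
  also have "\<dots> = mixed_vol (\<lambda>i. cbox 0 (b i)) - mixed_vol (\<lambda>i. slab (w i) 1 \<inter> cbox 0 (b i))"
    by (rule rel_mixed_volume_truncation[OF slab_body])
  also have "\<dots> \<le> 1"
  proof -
    have "mixed_vol (\<lambda>i. convex hull (subset_vertex (b i) ` {S. S \<noteq> {}}))
        \<le> mixed_vol (\<lambda>i. slab (w i) 1 \<inter> cbox 0 (b i))"
    proof (rule mixed_vol_mono_polytopes)
      show "polytope (convex hull (subset_vertex (b i) ` {S. S \<noteq> {}}))" for i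
        unfolding polytope_def by (metis finite finite_imageI)
      show "convex hull (subset_vertex (b i) ` {S. S \<noteq> {}}) \<noteq> {}" for i
        by auto
      show "convex hull (subset_vertex (b i) ` {S. S \<noteq> {}}) \<subseteq> slab (w i) 1 \<inter> cbox 0 (b i)" for i
      proof (intro hull_minimal convex_Int convex_slab convex_box image_subsetI)
        fix S :: "'n set" assume "S \<in> {S. S \<noteq> {}}"
        then obtain j where "j \<in> S" by auto
        then have "subset_vertex (b i) S \<in> slab (w i) 1"
          using w by (intro slab_mem[of _ i j]) (auto simp: subset_vertex_def pos_orthant_def b_def less_imp_le)
        then show "subset_vertex (b i) S \<in> slab (w i) 1 \<inter> cbox 0 (b i)"
          using w by (auto simp: subset_vertex_def mem_box_cart b_def less_imp_le)
      qed
    qed (rule polytope_slab_truncation)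
    moreover have "mixed_vol (\<lambda>i. cbox 0 (b i))
        = (\<Prod>j\<in>UNIV. b j $ j) + (\<Sum>p\<in>{p. bij p} - {id}. \<Prod>j\<in>UNIV. b (p j) $ j)"
    proof -
      have "finite {p :: 'n \<Rightarrow> 'n. bij p}" by (rule finite_subset[OF subset_UNIV]) simp
      from sum.remove[OF this, of id "\<lambda>p. \<Prod>j\<in>UNIV. b (p j) $ j"]
      show ?thesis using b by (simp add: mixed_vol_boxes less_imp_le)
    qed
    moreover have "(\<Prod>j\<in>UNIV. b j $ j) = 1" by (simp add: b_def w_def)
    ultimately show ?thesis using mixed_vol_punctured_boxes[where b=b, OF b] by linarith
  qed
  finally show ?thesis .
qed

section \<open>Lattice polyhedra of mixed volume two\<close>

text \<open>Induction on the size of \<open>X\<close>. If a proper nonempty subset is tight, it and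
  its complement are matched separately; if none is, one element is matched arbitrarily and the
  slack preserves the condition.\<close>

theorem hall_marriage:
  fixes E :: "'a \<Rightarrow> 'b set"
  assumes "finite X" "\<And>i. i \<in> X \<Longrightarrow> finite (E i)"
    and "\<And>K. K \<subseteq> X \<Longrightarrow> card K \<le> card (\<Union>i\<in>K. E i)"
  shows "\<exists>f. inj_on f X \<and> (\<forall>i\<in>X. f i \<in> E i)"
  using assms
proof (induction "card X" arbitrary: X E rule: less_induct)
  case less
  note fin = less.prems(1) and finE = less.prems(2) and hall = less.prems(3)
  have finU: "finite (\<Union>i\<in>K. E i)" if "K \<subseteq> X" for K
    by (rule finite_UN_I[OF finite_subset[OF that fin]]) (use that finE in blast)
  show ?case
  proof (cases "\<exists>K. K \<subset> X \<and> K \<noteq> {} \<and> card (\<Union>i\<in>K. E i) = card K")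
    case True
    then obtain K where K: "K \<subset> X" "K \<noteq> {}" "card (\<Union>i\<in>K. E i) = card K" by blast
    let ?EK = "\<Union>i\<in>K. E i"
    have finK: "finite K" using K(1) fin finite_subset by blast
    have "card K < card X" using K(1) fin by (rule psubset_card_mono[rotated])
    then have "\<exists>f. inj_on f K \<and> (\<forall>i\<in>K. f i \<in> E i)"
      by (rule less.hyps) (use K finK finE hall in auto)
    then obtain f where f: "inj_on f K" "\<And>i. i \<in> K \<Longrightarrow> f i \<in> E i" by blast
    have "\<exists>g. inj_on g (X - K) \<and> (\<forall>i\<in>X - K. g i \<in> E i - ?EK)"
    proof (rule less.hyps)
      have "X - K \<subset> X" using K(1,2) by blast
      then show "card (X - K) < card X" using fin by (rule psubset_card_mono[rotated])
      fix L assume L: "L \<subseteq> X - K"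
      have finL: "finite L" using L fin finite_subset by blast
      \<comment> \<open>Hall's condition for \<open>L \<union> K\<close> minus the tight equality
        for \<open>K\<close> is the condition for \<open>L\<close> without the neighbours of
        \<open>K\<close>.\<close>
      have "card L + card K = card (L \<union> K)"
        using L finL finK by (subst card_Un_disjoint) auto
      also have "\<dots> \<le> card (\<Union>i\<in>L \<union> K. E i)"
        by (rule hall) (use L K in blast)
      also have "(\<Union>i\<in>L \<union> K. E i) = (\<Union>i\<in>L. E i - ?EK) \<union> ?EK" by blast
      also have "card \<dots> \<le> card (\<Union>i\<in>L. E i - ?EK) + card ?EK" by (rule card_Un_le)
      finally show "card L \<le> card (\<Union>i\<in>L. E i - ?EK)" using K(3) by simp
    qed (use fin finE in auto)
    then obtain g where g: "inj_on g (X - K)" "\<And>i. i \<in> X - K \<Longrightarrow> g i \<in> E i - ?EK" by blast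
    let ?h = "\<lambda>i. if i \<in> K then f i else g i"
    have "inj_on ?h X"
    proof (rule inj_onI)
      fix i j assume ij: "i \<in> X" "j \<in> X" "?h i = ?h j"
      show "i = j"
      proof (cases "i \<in> K"; cases "j \<in> K")
        assume "i \<in> K" "j \<in> K"
        then show ?thesis using ij f(1) by (auto dest: inj_onD)
      next
        assume "i \<notin> K" "j \<notin> K"
        then show ?thesis using ij g(1) by (auto dest: inj_onD)
      next
        assume "i \<in> K" "j \<notin> K"
        then show ?thesis using ij f(2)[of i] g(2)[of j] by auto
      next
        assume "i \<notin> K" "j \<in> K"
        then show ?thesis using ij f(2)[of j] g(2)[of i] by auto
      qed
    qed
    moreover have "\<forall>i\<in>X. ?h i \<in> E i" using f(2) g(2) by auto
    ultimately show ?thesis by blast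
  next
    case False
    show ?thesis
    proof (cases "X = {}")
      case ne: False
      then obtain i where i: "i \<in> X" by blast
      have "E i \<noteq> {}" using hall[of "{i}"] i by auto
      then obtain e where e: "e \<in> E i" by blast
      have "\<exists>g. inj_on g (X - {i}) \<and> (\<forall>j\<in>X - {i}. g j \<in> E j - {e})"
      proof (rule less.hyps)
        show "card (X - {i}) < card X" using i fin by (rule card_Diff1_less[rotated])
        fix L assume L: "L \<subseteq> X - {i}"
        have eq: "(\<Union>j\<in>L. E j - {e}) = (\<Union>j\<in>L. E j) - {e}" by blast
        show "card L \<le> card (\<Union>j\<in>L. E j - {e})"
        proof (cases "L = {}")
          case L_ne: False
          have LX: "L \<subset> X" using L i by blast
          then have "card L < card (\<Union>j\<in>L. E j)"
            using False L_ne hall[of L] by (metis le_neq_implies_less psubset_imp_subset)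
          moreover have "card (\<Union>j\<in>L. E j) \<le> Suc (card ((\<Union>j\<in>L. E j) - {e}))"
          proof (cases "e \<in> (\<Union>j\<in>L. E j)")
            case True
            then show ?thesis using LX by (simp only: card_Suc_Diff1 finU psubset_imp_subset le_refl)
          next
            case False
            then have "(\<Union>j\<in>L. E j) - {e} = (\<Union>j\<in>L. E j)" by blast
            then show ?thesis by simp
          qed
          ultimately show ?thesis unfolding eq by linarith
        qed simp
      qed (use fin finE in auto)
      then obtain g where g: "inj_on g (X - {i})" "\<And>j. j \<in> X - {i} \<Longrightarrow> g j \<in> E j - {e}" by blast
      have "inj_on (g(i := e)) X"
      proof (rule inj_onI)
        fix j l assume jl: "j \<in> X" "l \<in> X" "(g(i := e)) j = (g(i := e)) l"
        show "j = l"
          using jl g(2)[of j] g(2)[of l] inj_onD[OF g(1), of j l] by (auto split: if_splits)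
      qed
      moreover have "\<forall>j\<in>X. (g(i := e)) j \<in> E j" using g(2) e by auto
      ultimately show ?thesis by blast
    qed auto
  qed
qed

text \<open>A nonzero coordinate contributes at least 1 inside \<open>J\<close> and at least 1/2
  outside, so a total below 1 leaves room for one coordinate only, outside \<open>J\<close> and
  equal to 1.\<close>

lemma small_lattice_point_is_axis:
  fixes v :: "real ^ 'n::finite"
  assumes int: "\<And>j. v $ j \<in> \<int>" and nn: "\<And>j. 0 \<le> v $ j" and ne: "v \<noteq> 0"
    and less: "(\<Sum>j\<in>UNIV. v $ j / (if j \<in> J then 1 else 2)) < 1"
  shows "\<exists>l. l \<notin> J \<and> v = axis l 1"
proof -
  let ?w = "\<lambda>j. if j \<in> J then 1 else 2 :: real"
  have pos: "1 \<le> v $ j" if "v $ j \<noteq> 0" for j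
  proof -
    obtain z :: int where z: "v $ j = of_int z" using int[of j] Ints_cases by blast
    then have "0 < z" using that nn[of j] by simp
    then show ?thesis using z by simp
  qed
  have term_nn: "0 \<le> v $ j / ?w j" for j using nn[of j] by simp
  have part: "(\<Sum>j\<in>S. v $ j / ?w j) < 1" for S
    using sum_mono2[of UNIV S "\<lambda>j. v $ j / ?w j"] term_nn less by simp
  obtain l where l: "v $ l \<noteq> 0" using ne by (auto simp: vec_eq_iff)
  have lJ: "l \<notin> J" using part[of "{l}"] pos[OF l] by auto
  have "v $ l < 2" using part[of "{l}"] lJ by simp
  moreover obtain z :: int where "v $ l = of_int z" using int[of l] Ints_cases by blast
  ultimately have vl: "v $ l = 1" using pos[OF l] by simp
  have "v $ j = 0" if "j \<noteq> l" for j
  proof (rule ccontr)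
    assume "v $ j \<noteq> 0"
    then have "1 / 2 \<le> v $ j / ?w j" using pos[of j] by auto
    then have "1 \<le> (\<Sum>j\<in>{j, l}. v $ j / ?w j)"
      using that lJ vl by (cases "j \<in> J") simp_all
    then show False using part[of "{j, l}"] by linarith
  qed
  then have "v = axis l 1" using vl by (auto simp: vec_eq_iff axis_def)
  then show ?thesis using lJ by blast
qed

text \<open>If the linear form drops below 1 on \<open>B\<close>, its minimum is attained at an
  extreme point. That is a lattice point of small height, hence a unit vector outside
  \<open>J\<close>, contrary to the choice of \<open>J\<close>.\<close>

lemma lattice_polyhedron_subset_slab:
  fixes B :: "(real ^ 'n::finite) set"
  assumes B: "lattice_polyhedron B" "B \<subseteq> pos_orthant" and zero: "0 \<notin> B"
    and J: "\<And>l. axis l 1 \<in> B \<Longrightarrow> l \<in> J"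
  shows "B \<subseteq> slab (\<lambda>j. if j \<in> J then 1 else 2) 1"
proof (rule ccontr)
  let ?w = "\<lambda>j. if j \<in> J then 1 else 2 :: real"
  let ?h = "(\<chi> j. 1 / ?w j) :: real ^ 'n"
  have poly: "polyhedron B" using B(1) by (simp add: lattice_polyhedron_def)
  have conv: "convex B" by (rule polyhedron_imp_convex[OF poly])
  have h: "?h \<bullet> y = (\<Sum>j\<in>UNIV. y $ j / ?w j)" for y
    by (auto simp: inner_vec_def intro!: sum.cong)
  assume "\<not> B \<subseteq> slab ?w 1"
  then obtain x where x: "x \<in> B" "x \<notin> slab ?w 1" by blast
  then have "x \<in> pos_orthant" using B(2) by blast
  with x(2) have x1: "?h \<bullet> x < 1" unfolding slab_def h by (simp add: not_le)
  \<comment> \<open>\<open>B\<close> is unbounded, so the minimum is sought on the compact part of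
    height at most 1.\<close>
  let ?D = "B \<inter> {y. ?h \<bullet> y \<le> 1}"
  have "?D \<subseteq> cbox 0 (\<chi> j. 2)"
  proof
    fix y assume y: "y \<in> ?D"
    have y0: "0 \<le> y $ j" for j using y B(2) by (auto simp: pos_orthant_def)
    have "y $ j \<le> 2" for j
    proof -
      have "y $ j / ?w j \<le> (\<Sum>j\<in>UNIV. y $ j / ?w j)"
        by (rule member_le_sum) (use y0 in auto)
      also have "\<dots> \<le> 1" using y by (simp add: h)
      finally show ?thesis using y0[of j] by (auto split: if_splits)
    qed
    then show "y \<in> cbox 0 (\<chi> j. 2)" using y0 by (simp add: mem_box_cart)
  qed
  then have "bounded ?D" by (rule bounded_subset[OF bounded_cbox])
  then have compD: "compact ?D"
    unfolding compact_eq_bounded_closed using polyhedron_imp_closed[OF poly] by (auto simp: closed_halfspace_le)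
  have "\<exists>y0\<in>?D. \<forall>y\<in>?D. ?h \<bullet> y0 \<le> ?h \<bullet> y"
    by (rule continuous_attains_inf[OF compD]) (use x(1) x1 in \<open>auto intro!: continuous_intros\<close>)
  then obtain y0 where y0: "y0 \<in> ?D" "\<And>y. y \<in> ?D \<Longrightarrow> ?h \<bullet> y0 \<le> ?h \<bullet> y" by blast
  have "?h \<bullet> y0 \<le> ?h \<bullet> x" by (rule y0(2)) (use x(1) x1 in simp)
  then have m1: "?h \<bullet> y0 < 1" using x1 by (rule le_less_trans)
  have min: "?h \<bullet> y0 \<le> ?h \<bullet> y" if "y \<in> B" for y
  proof (cases "?h \<bullet> y \<le> 1")
    case True
    then show ?thesis by (intro y0(2)) (use that in simp)
  qed (use m1 in linarith)
  \<comment> \<open>The face of minimal height is compact because it lies in \<open>?D\<close>, so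
    it has an extreme point, which is also extreme in \<open>B\<close>.\<close>
  let ?F = "B \<inter> {y. ?h \<bullet> y = ?h \<bullet> y0}"
  have face: "?F face_of B"
    by (rule face_of_Int_supporting_hyperplane_ge[OF conv]) (rule min)
  have FD: "?F = ?D \<inter> {y. ?h \<bullet> y = ?h \<bullet> y0}" using m1 by auto
  have "compact ?F" unfolding FD by (intro compact_Int_closed compD closed_hyperplane)
  moreover have "convex ?F" by (rule face_of_imp_convex[OF face])
  moreover have "?F \<noteq> {}" using y0(1) by blast
  ultimately obtain v where v: "v extreme_point_of ?F" by (rule extreme_point_exists_convex)
  then have ext: "v extreme_point_of B" and vF: "v \<in> ?F"
    unfolding extreme_point_of_face[OF face] by simp_all
  have "\<exists>l. l \<notin> J \<and> v = axis l 1"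
  proof (rule small_lattice_point_is_axis)
    show "v $ j \<in> \<int>" for j using B(1) ext by (simp add: lattice_polyhedron_def)
    show "0 \<le> v $ j" for j using vF B(2) by (auto simp: pos_orthant_def)
    show "v \<noteq> 0" using vF zero by auto
    show "(\<Sum>j\<in>UNIV. v $ j / ?w j) < 1" using vF m1 by (simp add: h)
  qed
  then show False using J vF by blast
qed

lemma bounded_complement_orthant_body:
  fixes B :: "(real ^ 'n::finite) set"
  assumes "convex B" "B \<subseteq> pos_orthant" "bounded (pos_orthant - B)"
  shows "\<exists>a. orthant_body a B"
proof -
  obtain N where N: "0 < N" "\<And>x. x \<in> pos_orthant - B \<Longrightarrow> norm x \<le> N"
    using assms(3) unfolding bounded_pos by blast
  \<comment> \<open>The bound is \<open>N + 1\<close> because points of norm exactly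
    \<open>N\<close> may lie outside \<open>B\<close>.\<close>
  have "x \<in> B" if "x \<in> pos_orthant" "N + 1 \<le> x $ j" for x j
  proof (rule ccontr)
    assume "x \<notin> B"
    then have "norm x \<le> N" using N(2) that by blast
    moreover have "\<bar>x $ j\<bar> \<le> norm x" by (rule component_le_norm_cart)
    ultimately show False using that by linarith
  qed
  then have "orthant_body (\<chi> j. N + 1) B"
    using assms N(1) unfolding orthant_body_def by simp
  then show ?thesis ..
qed

text \<open>Numbers the elements of \<open>K\<close> first; it provides both the reordering of the
  members and the permutation of the coordinates.\<close>

lemma ex_numbering:
  fixes K :: "'n::finite set"
  shows "\<exists>p :: 'n \<Rightarrow> nat. bij_betw p UNIV {1..CARD('n)} \<and>
    (\<forall>i. p i \<in> {1..card K} \<longleftrightarrow> i \<in> K) \<and> (\<forall>i. p i \<in> {card K + 1..CARD('n)} \<longleftrightarrow> i \<notin> K)"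
proof -
  have le: "card K \<le> CARD('n)" by (rule card_mono) auto
  have "card (- K) = card {card K + 1..CARD('n)}" by (simp add: Compl_eq_Diff_UNIV card_Diff_subset)
  then obtain g where g: "bij_betw g (- K) {card K + 1..CARD('n)}"
    using finite_same_card_bij[of "- K" "{card K + 1..CARD('n)}"] by auto
  obtain f where f: "bij_betw f K {1..card K}"
    using finite_same_card_bij[of K "{1..card K}"] by auto
  let ?p = "\<lambda>i. if i \<in> K then f i else g i"
  have 1: "bij_betw ?p K {1..card K}" by (rule bij_betw_cong[THEN iffD1, OF _ f]) simp
  have 2: "bij_betw ?p (- K) {card K + 1..CARD('n)}" by (rule bij_betw_cong[THEN iffD1, OF _ g]) simp
  have "bij_betw ?p (K \<union> - K) ({1..card K} \<union> {card K + 1..CARD('n)})"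
    by (rule bij_betw_combine[OF 1 2]) auto
  moreover have "{1..card K} \<union> {card K + 1..CARD('n)} = {1..CARD('n)}" using le by auto
  ultimately have "bij_betw ?p UNIV {1..CARD('n)}" by (simp add: Compl_partition)
  moreover have "?p i \<in> {1..card K} \<longleftrightarrow> i \<in> K" "?p i \<in> {card K + 1..CARD('n)} \<longleftrightarrow> i \<notin> K" for i
    using bij_betwE[OF 1, rule_format, of i] bij_betwE[OF 2, rule_format, of i] by auto
  ultimately show ?thesis by blast
qed

theorem theorem5:
  fixes B :: "'n::finite \<Rightarrow> (real ^ 'n) set"
  assumes "\<And>i. lattice_polyhedron (B i)"
    and "\<And>i. B i \<subseteq> pos_orthant"
    and "\<And>i. bounded (pos_orthant - B i)"
    and "minimal_with_mixed_volume pos_orthant B 2"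
  shows "\<exists>k \<in> {1..CARD('n)}. \<exists>p q :: 'n \<Rightarrow> nat.
           bij_betw p UNIV {1..CARD('n)} \<and> bij_betw q UNIV {1..CARD('n)} \<and>
           (\<forall>i. p i \<in> {1..k} \<longrightarrow>
              B i = truncated_orthant (\<lambda>j. if q j \<in> {1..k - 1} then 1 else 2)) \<and>
           (\<forall>i. p i \<in> {k + 1..CARD('n)} \<longrightarrow> B i = truncated_orthant (\<lambda>j. 1))"
proof -
  have vol: "rel_mixed_volume pos_orthant B = 2"
    and minimal: "\<And>i \<delta>. \<delta> \<in> pos_orthant - B i \<Longrightarrow>
      rel_mixed_volume pos_orthant (B(i := convex hull (B i \<union> {\<delta>}))) < 2"
    using assms(4) by (auto simp: minimal_with_mixed_volume_def)
  have poly: "polyhedron (B i)" for i using assms(1) by (simp add: lattice_polyhedron_def)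
  have "\<exists>a. orthant_body a (B i)" for i
    by (rule bounded_complement_orthant_body[OF polyhedron_imp_convex[OF poly] assms(2,3)])
  then obtain a where body: "\<And>i. orthant_body (a i) (B i)" by metis
  have trunc: "polytope (B i \<inter> cbox 0 (a i))" for i
    using polytope_Int_polyhedron[OF polytope_interval poly] by (simp add: Int_commute)
  have zero: "0 \<notin> B i" for i
    using rel_mixed_volume_orthant[where a=a and B=B and i=i, OF body] vol by auto
  define E where "E i = {j. axis j (1::real) \<in> B i}" for i
  \<comment> \<open>A perfect matching would force the mixed volume down to at most 1.\<close>
  have "\<not> (\<exists>f. inj_on f UNIV \<and> (\<forall>i\<in>UNIV. f i \<in> E i))"
  proof
    assume "\<exists>f. inj_on f UNIV \<and> (\<forall>i\<in>UNIV. f i \<in> E i)"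
    then obtain f where f: "inj f" "\<And>i. f i \<in> E i" by auto
    then have bij: "bij f" by (simp add: bij_def finite_UNIV_inj_surj)
    have "axis i 1 \<in> B (inv f i)" for i
      using f(2)[of "inv f i"] surj_f_inv_f[OF bij_is_surj[OF bij]] by (simp add: E_def)
    then have "rel_mixed_volume pos_orthant (\<lambda>i. B (inv f i)) \<le> 1"
      by (rule rel_mixed_volume_le_1[OF body poly])
    then show False
      unfolding rel_mixed_volume_permute[OF bij_imp_bij_inv[OF bij]] vol by simp
  qed
  then have "\<exists>K. \<not> card K \<le> card (\<Union>i\<in>K. E i)"
    using hall_marriage[of UNIV E] by (meson finite)
  then obtain K where K: "card (\<Union>i\<in>K. E i) < card K" by (meson not_le)
  have K1: "1 \<le> card K" using K by simp
  have Kn: "card K \<le> CARD('n)" by (rule card_mono) auto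
  \<comment> \<open>Hall's violation only bounds the number of neighbours by
    \<open>card K - 1\<close>; padding to exactly this size makes the lower bound equal to
    2.\<close>
  have "\<exists>J. (\<Union>i\<in>K. E i) \<subseteq> J \<and> J \<subseteq> UNIV \<and> card J = card K - 1"
    by (rule exists_subset_between) (use K Kn in auto)
  then obtain J where J: "(\<Union>i\<in>K. E i) \<subseteq> J" "card J = card K - 1" by blast
  define w where "w j = (if j \<in> J then 1 else 2 :: real)" for j
  \<comment> \<open>The factor 1/2 is admissible outside \<open>K\<close> because every
    \<open>w j\<close> is at most 2.\<close>
  define c where "c i = (if i \<in> K then 1 else 1 / 2 :: real)" for i
  \<comment> \<open>The extremal tuple, from which \<open>B\<close> will turn out not to
    differ.\<close>
  define T where "T i = (if i \<in> K then slab w 1 else slab (\<lambda>_. 1) 1)" for i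
  have BT: "B i \<subseteq> T i" for i
  proof (cases "i \<in> K")
    case True
    then have "B i \<subseteq> slab (\<lambda>j. if j \<in> J then 1 else 2) 1"
      using J(1) by (intro lattice_polyhedron_subset_slab assms(1,2) zero) (auto simp: E_def)
    then show ?thesis using True by (simp add: T_def w_def[abs_def])
  next
    case False
    \<comment> \<open>With \<open>J = UNIV\<close> all weights are 1, and the condition on unit
      vectors holds trivially.\<close>
    have "B i \<subseteq> slab (\<lambda>j. if j \<in> UNIV then 1 else 2) 1"
      by (intro lattice_polyhedron_subset_slab assms(1,2) zero) auto
    then show ?thesis using False by (simp add: T_def)
  qed
  have Tc: "T i \<subseteq> slab w (c i)" for i
  proof (cases "i \<in> K")
    case False
    have "slab (\<lambda>_. 1) 1 \<subseteq> slab w (1 / 2)"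
    proof
      fix x :: "real ^ 'n" assume x: "x \<in> slab (\<lambda>_. 1) 1"
      have "1 / 2 \<le> (\<Sum>j\<in>UNIV. x $ j / 2)"
        using x by (simp add: slab_def sum_divide_distrib[symmetric])
      also have "\<dots> \<le> (\<Sum>j\<in>UNIV. x $ j / w j)"
        using x by (intro sum_mono) (auto simp: slab_def pos_orthant_def w_def)
      finally show "x \<in> slab w (1 / 2)" using x by (simp add: slab_def)
    qed
    then show ?thesis using False by (simp add: T_def c_def)
  qed (simp add: T_def c_def)
  have prod: "(\<Prod>i\<in>UNIV. c i) * (\<Prod>j\<in>UNIV. w j) = 2"
  proof -
    have "(\<Prod>i\<in>UNIV. c i) = (1 / 2) ^ (CARD('n) - card K)"
      by (simp add: c_def prod.If_cases Compl_eq_Diff_UNIV card_Diff_subset)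
    moreover have "(\<Prod>j\<in>UNIV. w j) = 2 ^ (CARD('n) - card J)"
      by (simp add: w_def prod.If_cases Compl_eq_Diff_UNIV card_Diff_subset)
    \<comment> \<open>Since \<open>J\<close> is one smaller than \<open>K\<close>, there is one more
      factor 2 than there are factors 1/2.\<close>
    moreover have "CARD('n) - card J = Suc (CARD('n) - card K)" using J(2) K1 Kn by simp
    ultimately show ?thesis by (simp add: power_one_over)
  qed
  \<comment> \<open>Adding a missing point of \<open>T i\<close> keeps the tuple below the slab
    bounds, so its mixed volume stays at least 2, against minimality.\<close>
  have TB: "T i \<subseteq> B i" for i
  proof (rule subsetI, rule ccontr)
    fix \<delta> assume \<delta>: "\<delta> \<in> T i" "\<delta> \<notin> B i"
    then have \<delta>C: "\<delta> \<in> pos_orthant" by (auto simp: T_def slab_def split: if_splits)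
    let ?B = "B(i := convex hull (B i \<union> {\<delta>}))"
    have hull: "convex hull (B i \<union> {\<delta>}) \<subseteq> T i"
      by (rule hull_minimal) (use BT \<delta>(1) in \<open>auto simp: T_def convex_slab\<close>)
    have "(\<Prod>i\<in>UNIV. c i) * (\<Prod>j\<in>UNIV. w j) \<le> rel_mixed_volume pos_orthant ?B"
    proof (rule prod_le_rel_mixed_volume)
      show "orthant_body (a l) (?B l)" for l
        using body orthant_body_hull_insert[OF body \<delta>C] by simp
      show "polytope (?B l \<inter> cbox 0 (a l))" for l
        using trunc polytope_hull_insert_truncation[OF body trunc \<delta>C \<delta>(2)] by simp
      show "?B l \<subseteq> slab w (c l)" for l
        using order_trans[OF hull Tc] order_trans[OF BT Tc] by (cases "l = i") simp_all
    qed (simp_all add: w_def c_def)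
    moreover have "rel_mixed_volume pos_orthant ?B < 2"
      by (rule minimal) (use \<delta>(2) \<delta>C in simp)
    ultimately show False using prod by simp
  qed
  have B: "B i = T i" for i using BT TB by (rule antisym)
  obtain p :: "'n \<Rightarrow> nat" where p: "bij_betw p UNIV {1..CARD('n)}"
    "\<And>i. p i \<in> {1..card K} \<longleftrightarrow> i \<in> K" "\<And>i. p i \<in> {card K + 1..CARD('n)} \<longleftrightarrow> i \<notin> K"
    using ex_numbering[of K] by blast
  obtain q :: "'n \<Rightarrow> nat" where q: "bij_betw q UNIV {1..CARD('n)}"
    "\<And>j. q j \<in> {1..card K - 1} \<longleftrightarrow> j \<in> J"
    using ex_numbering[of J] unfolding J(2) by blast
  show ?thesis
  proof (rule bexI[of _ "card K"], rule exI[of _ p], rule exI[of _ q], intro conjI allI impI)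
    show "B i = truncated_orthant (\<lambda>j. if q j \<in> {1..card K - 1} then 1 else 2)" if "p i \<in> {1..card K}" for i
      using that unfolding p(2) q(2) B truncated_orthant_slab by (simp add: T_def w_def[abs_def])
    show "B i = truncated_orthant (\<lambda>j. 1)" if "p i \<in> {card K + 1..CARD('n)}" for i
      using that unfolding p(3) B truncated_orthant_slab by (simp add: T_def)
  qed (use p(1) q(1) K1 Kn in auto)
qed

end
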